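(* Let $n_1,n_2$ be positive integers and $n=\max\{n_1,n_2\}$. Let $\tau\in S_{n_1}$ be a $k$-Grassmannian permutation whose associated Young diagram $\lambda$ has exactly $2$ rows, and let $w\in S_{n_2}$. Write \[\mathfrak{S}_{w}\, s_{\lambda}(x_1,\dots,x_k)=\sum_{v} c_{w\tau}^{v}\,\mathfrak{S}_{v}.\] Then: (1) if $k=n_2$, then $c_{w\tau}^{v}\in\{0,1\}$ for all $v$; (2) if $k=n_2-1$, then $c_{w\tau}^{v}\in\{0,1\}$ for all $v$; (3) if $k=n_2-2$, then $c_{w\tau}^{v}\in\{0,1,2\}$ for all $v$.
   Context: For $w\in S_N$, $\mathfrak{S}_w$ denotes the Schubert polynomial: $\mathfrak{S}_{w_0}=x_1^{N-1}x_2^{N-2}\cdots x_{N-1}$ for the longest element $w_0\in S_N$, and $\mathfrak{S}_{ws_i}=\partial_i\mathfrak{S}_w$ whenever $w(i)>w(i+1)$, where $\partial_i f=(f-s_if)/(x_i-x_{i+1})$ and $s_i$ swaps $x_i,x_{i+1}$. Permutations in $S_N$ are regarded as permutations of $S_{N'}$ ($N'\ge N$) fixing $N+1,\dots,N'$; Schubert polynomials are stable under this embedding and form a basis of the polynomial ring, so the coefficients $c^v_{w\tau}$ in the expansion are well defined. A permutation $\tau\in S_{N}$ is $k$-Grassmannian if $\tau(1)<\dots<\tau(k)$ and $\tau(k+1)<\dots<\tau(N)$; its associated Young diagram (partition) is $\lambda=(\tau(k)-k,\dots,\tau(2)-2,\tau(1)-1)$ (zero parts removed), and $\mathfrak{S}_\tau=s_\lambda(x_1,\dots,x_k)$,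 the Schur polynomial in $k$ variables, i.e. the sum over semistandard Young tableaux $T$ of shape $\lambda$ with entries in $\{1,\dots,k\}$ of $\prod_i x_i^{t_i}$, $t_i$ the number of entries equal to $i$. *)

theory Defs
  imports
    "HOL-Library.Poly_Mapping"
    "HOL-Library.FuncSet"
    "HOL-Combinatorics.Permutations"
begin

text \<open>
  Integer polynomials in the variables x_1, x_2, ...: finitely supported functions from
  monomials (exponent vectors) to coefficients. The index 0 is available in the type but is
  never used below.
\<close>

type_synonym zpoly = "(nat \<Rightarrow>\<^sub>0 nat) \<Rightarrow>\<^sub>0 int"

definition X :: "nat \<Rightarrow> zpoly" where
  "X i = Poly_Mapping.single (Poly_Mapping.single i 1) 1"

text \<open>
  The inner \<open>map_key\<close> exchanges the exponents of x_i and x_(i+1) in a monomial; the outer one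
  reads off coefficients along this involution of the monomials.
\<close>

definition swap_vars :: "nat \<Rightarrow> zpoly \<Rightarrow> zpoly" where
  "swap_vars i f =
     Poly_Mapping.map_key (Poly_Mapping.map_key (Transposition.transpose i (Suc i))) f"

text \<open>The quotient is exact, and unique because \<open>zpoly\<close> is an integral domain.\<close>

definition divided_diff :: "nat \<Rightarrow> zpoly \<Rightarrow> zpoly" where
  "divided_diff i f = (THE g. g * (X i - X (Suc i)) = f - swap_vars i f)"

text \<open>
  An element of S_N is a function \<open>w\<close> with \<open>w permutes {1..N}\<close>. Such a function fixes every
  number outside \<open>{1..N}\<close>, so S_N is literally a subset of S_N' for N \<open>\<le>\<close> N'.
\<close>

definition finitary_perms :: "(nat \<Rightarrow> nat) set" where
  "finitary_perms = {w. \<exists>N. w permutes {1..N}}"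

definition longest_perm :: "nat \<Rightarrow> nat \<Rightarrow> nat" where
  "longest_perm N i = (if i \<in> {1..N} then N + 1 - i else i)"

inductive schubert_in :: "nat \<Rightarrow> (nat \<Rightarrow> nat) \<Rightarrow> zpoly \<Rightarrow> bool" for N :: nat where
  longest: "schubert_in N (longest_perm N) (\<Prod>i = 1..N. X i ^ (N - i))"
| descent: "schubert_in N w f \<Longrightarrow> 1 \<le> i \<Longrightarrow> i < N \<Longrightarrow> w i > w (Suc i) \<Longrightarrow>
    schubert_in N (w \<circ> Transposition.transpose i (Suc i)) (divided_diff i f)"

text \<open>
  The description determines the same polynomial for every reduced path down from the longest
  element, and for every N with w in S_N (stability).
\<close>

definition schubert :: "(nat \<Rightarrow> nat) \<Rightarrow> zpoly" where
  "schubert w = (THE f. \<exists>N. schubert_in N w f)"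

text \<open>
  The coefficient of the Schubert polynomial of \<open>v\<close> in the expansion of \<open>f\<close>; the coefficient
  function is unique, and exists for every f not involving the spare variable of index 0, since
  the Schubert polynomials form a basis.
\<close>

definition schubert_coeff :: "zpoly \<Rightarrow> (nat \<Rightarrow> nat) \<Rightarrow> int" where
  "schubert_coeff f =
     (THE c. finite {v. c v \<noteq> 0} \<and> {v. c v \<noteq> 0} \<subseteq> finitary_perms \<and>
             f = (\<Sum>v | c v \<noteq> 0. of_int (c v) * schubert v))"

definition grassmannian :: "nat \<Rightarrow> nat \<Rightarrow> (nat \<Rightarrow> nat) \<Rightarrow> bool" where
  "grassmannian k N \<tau> \<longleftrightarrow> k \<le> N \<and> \<tau> permutes {1..N} \<and>
     strict_mono_on {1..k} \<tau> \<and> strict_mono_on {k+1..N} \<tau>"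

text \<open>
  The parts are \<open>\<tau> k - k, \<dots>, \<tau> 1 - 1\<close> in this order. For Grassmannian \<open>\<tau>\<close> one has
  \<open>j \<le> \<tau> j\<close> for \<open>1 \<le> j \<le> k\<close>, so the subtraction does not truncate.
\<close>

definition grassmannian_shape :: "nat \<Rightarrow> (nat \<Rightarrow> nat) \<Rightarrow> nat list" where
  "grassmannian_shape k \<tau> = filter (\<lambda>p. p \<noteq> 0) (map (\<lambda>j. \<tau> j - j) (rev [1..<k+1]))"

definition young_diagram :: "nat list \<Rightarrow> (nat \<times> nat) set" where
  "young_diagram \<mu> = {(r, c). r < length \<mu> \<and> c < \<mu> ! r}"

text \<open>
  Fillings are taken in \<open>\<rightarrow>\<^sub>E\<close> (constantly \<open>undefined\<close> off the diagram), so that each tableau is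
  counted exactly once.
\<close>

definition ssyt :: "nat list \<Rightarrow> nat \<Rightarrow> (nat \<times> nat \<Rightarrow> nat) set" where
  "ssyt \<mu> k = {T \<in> young_diagram \<mu> \<rightarrow>\<^sub>E {1..k}.
     (\<forall>r c c'. (r, c) \<in> young_diagram \<mu> \<and> (r, c') \<in> young_diagram \<mu> \<and> c < c' \<longrightarrow>
        T (r, c) \<le> T (r, c')) \<and>
     (\<forall>r r' c. (r, c) \<in> young_diagram \<mu> \<and> (r', c) \<in> young_diagram \<mu> \<and> r < r' \<longrightarrow>
        T (r, c) < T (r', c))}"

definition schur :: "nat list \<Rightarrow> nat \<Rightarrow> zpoly" where
  "schur \<mu> k = (\<Sum>T\<in>ssyt \<mu> k. \<Prod>i = 1..k. X i ^ card {b \<in> young_diagram \<mu>. T b = i})"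

end

theory Submission
  imports Defs "HOL-Computational_Algebra.Polynomial"
begin

text \<open>
  The two-row Jacobi-Trudi identity writes the Schur polynomial of shape \<open>(p, q)\<close> as
  \<open>h_p h_q - h_(p+1) h_(q-1)\<close>, and by the Pieri rule the coefficient of the Schubert polynomial of
  \<open>u\<close> in the product of that of \<open>w\<close> with \<open>h_p h_q\<close> counts pairs of Pieri steps from \<open>w\<close> to \<open>u\<close>,
  of lengths \<open>p\<close> and \<open>q\<close>. Suppose that \<open>w\<close> increases after position \<open>k\<close>. For fixed \<open>w\<close> and \<open>u\<close>
  the possible midpoints split into independent choices, so the generating function of the length
  of the first step is a power of \<open>t\<close> times a product of polynomials \<open>1 + t + \<dots> + t^m\<close>. Apart
  from the factor of the topmost moved position, the degrees of these add up to at most the number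
  \<open>r = n_2 - k\<close> of values missing from \<open>w(1), \<dots>, w(k)\<close>, so the coefficients of their product are
  at most those of \<open>(1 + t)^r\<close>. Since the \<open>h_m\<close> commute, the whole generating function is
  palindromic, and past its centre consecutive coefficients decrease by at most the central
  binomial coefficient of \<open>r\<close>, which is 1, 1, 2 for \<open>r = 0, 1, 2\<close>.

  The remaining case is \<open>k = n_2 - 2\<close> and \<open>w(k+1) > w(k+2)\<close>. If \<open>v\<close> also has a descent at \<open>k + 1\<close>,
  a divided difference reduces to the case above. Otherwise
  \<open>h_m(x_1, \<dots>, x_k) = h_m(x_1, \<dots>, x_K) - x_K h_(m-1)(x_1, \<dots>, x_K)\<close> with \<open>K = k + 1\<close>, together with
  Monk's rule for \<open>x_K\<close>, expresses the coefficient through midpoints on \<open>K\<close> positions, where only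
  one value is missing.
\<close>

declare One_nat_def [simp del]

section \<open>Divided differences\<close>

abbreviation adj_transp :: "nat \<Rightarrow> nat \<Rightarrow> nat" where
  "adj_transp i \<equiv> Transposition.transpose i (Suc i)"

lemma monomial_induct [case_names zero step]:
  fixes m :: "nat \<Rightarrow>\<^sub>0 nat"
  assumes "P 0" and step: "\<And>m j. P m \<Longrightarrow> P (Poly_Mapping.single j 1 + m)"
  shows "P m"
proof (induction m rule: update_induct)
  case const
  show ?case by fact
next
  case (update f a b)
  have "P (Poly_Mapping.single a n + f)" for n
  proof (induction n)
    case (Suc n)
    have "Poly_Mapping.single a (Suc n) = Poly_Mapping.single a 1 + Poly_Mapping.single a n"
      by (simp add: One_nat_def flip: single_add)
    then show ?case using step[OF Suc] by (simp add: add.assoc)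
  qed (use update in simp)
  moreover have "Poly_Mapping.update a b f = Poly_Mapping.single a b + f"
    using update by (intro poly_mapping_eqI)
      (auto simp: lookup_update lookup_add lookup_single when_def in_keys_iff)
  ultimately show ?case by simp
qed

lemma X_mult_single:
  "X j * Poly_Mapping.single m c = Poly_Mapping.single (Poly_Mapping.single j 1 + m) c"
  by (simp add: X_def mult_single)

lemma zpoly_induct [case_names zero one mult diff]:
  fixes f :: zpoly
  assumes "P 0" "P 1" and mult: "\<And>j f. P f \<Longrightarrow> P (X j * f)"
    and diff: "\<And>f g. P f \<Longrightarrow> P g \<Longrightarrow> P (f - g)"
  shows "P f"
proof -
  have "P (frag_of m)" for m
  proof (induction m rule: monomial_induct)
    case (step m j)
    then show ?case using mult[of "frag_of m" j] by (simp add: X_mult_single)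
  qed (use assms in simp)
  then show ?thesis
    using frag_induction[of f UNIV P] assms by blast
qed

lemma map_key_adj_transp_involutory:
  "Poly_Mapping.map_key (adj_transp i) (Poly_Mapping.map_key (adj_transp i) m) = m"
  by (simp add: map_key_compose map_key_id[unfolded id_def[symmetric]] transpose_comp_involutory)

lemma inj_map_key_adj_transp:
  "inj (Poly_Mapping.map_key (adj_transp i) :: (nat \<Rightarrow>\<^sub>0 nat) \<Rightarrow> _)"
  by (rule inj_on_inverseI[where g = "Poly_Mapping.map_key (adj_transp i)"])
     (rule map_key_adj_transp_involutory)

lemma lookup_swap_vars:
  "Poly_Mapping.lookup (swap_vars i f) m
    = Poly_Mapping.lookup f (Poly_Mapping.map_key (adj_transp i) m)"
  by (simp add: swap_vars_def map_key.rep_eq[OF inj_map_key_adj_transp])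

lemma swap_vars_add: "swap_vars i (f + g) = swap_vars i f + swap_vars i g"
  and swap_vars_diff: "swap_vars i (f - g) = swap_vars i f - swap_vars i g"
  and swap_vars_0 [simp]: "swap_vars i 0 = 0"
  by (rule poly_mapping_eqI; simp add: lookup_swap_vars lookup_add lookup_minus)+

lemma map_key_adj_transp_single:
  "Poly_Mapping.map_key (adj_transp i) (Poly_Mapping.single j c)
    = Poly_Mapping.single (adj_transp i j) c"
  using map_key_single[of "adj_transp i" "adj_transp i j" c] by simp

lemma swap_vars_single:
  "swap_vars i (Poly_Mapping.single m c)
    = Poly_Mapping.single (Poly_Mapping.map_key (adj_transp i) m) c"
  using map_key_single[OF inj_map_key_adj_transp, of i "Poly_Mapping.map_key (adj_transp i) m" c]
  by (simp add: swap_vars_def map_key_adj_transp_involutory)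

lemma swap_vars_1 [simp]: "swap_vars i 1 = 1"
  using swap_vars_single[of i 0 1] by simp

lemma swap_vars_X_mult: "swap_vars i (X j * f) = X (adj_transp i j) * swap_vars i f"
proof -
  have on_monomial: "swap_vars i (X j * frag_of m) = X (adj_transp i j) * swap_vars i (frag_of m)"
    for m
    by (simp add: X_mult_single swap_vars_single map_key_plus map_key_adj_transp_single)
  show ?thesis
    by (rule frag_induction[where c = f and S = UNIV])
       (auto simp: on_monomial swap_vars_diff right_diff_distrib)
qed

lemma swap_vars_mult: "swap_vars i (f * g) = swap_vars i f * swap_vars i g"
  by (induction f rule: zpoly_induct)
     (auto simp: swap_vars_diff left_diff_distrib swap_vars_X_mult mult.assoc)

lemma swap_vars_X [simp]: "swap_vars i (X j) = X (adj_transp i j)"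
  using swap_vars_X_mult[of i j 1] by simp

lemma swap_vars_power: "swap_vars i (f ^ n) = swap_vars i f ^ n"
  by (induction n) (auto simp: swap_vars_mult)

lemma swap_vars_prod: "swap_vars i (prod f A) = (\<Prod>a\<in>A. swap_vars i (f a))"
  by (induction A rule: infinite_finite_induct) (auto simp: swap_vars_mult)

lemma swap_vars_swap_vars [simp]: "swap_vars i (swap_vars i f) = f"
  by (induction f rule: zpoly_induct) (auto simp: swap_vars_diff swap_vars_X_mult)

lemma swap_vars_commute:
  assumes "Suc i < j \<or> Suc j < i"
  shows "swap_vars i (swap_vars j f) = swap_vars j (swap_vars i f)"
  using assms by (induction f rule: zpoly_induct)
    (auto simp: swap_vars_diff swap_vars_X_mult transpose_def)

lemma swap_vars_braid:
  "swap_vars i (swap_vars (Suc i) (swap_vars i f))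
    = swap_vars (Suc i) (swap_vars i (swap_vars (Suc i) f))"
  by (induction f rule: zpoly_induct)
     (auto simp: swap_vars_diff swap_vars_X_mult transpose_def)

lemma X_inject [simp]: "X i = X j \<longleftrightarrow> i = j"
  by (auto simp: X_def frag_of_eq dest: arg_cong[where f = Poly_Mapping.keys])

lemma divided_diff_exists: "\<exists>g. g * (X i - X (Suc i)) = f - swap_vars i f"
proof (induction f rule: zpoly_induct)
  case (mult j f)
  then obtain g where g: "g * (X i - X (Suc i)) = f - swap_vars i f" by blast
  define d :: zpoly where "d = (if j = i then 1 else if j = Suc i then - 1 else 0)"
  have d: "d * (X i - X (Suc i)) = X j - X (adj_transp i j)"
    by (auto simp: d_def transpose_def)
  have "(d * f + X (adj_transp i j) * g) * (X i - X (Suc i))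
      = f * (d * (X i - X (Suc i))) + X (adj_transp i j) * (g * (X i - X (Suc i)))"
    by (simp add: algebra_simps)
  also have "\<dots> = X j * f - swap_vars i (X j * f)"
    by (simp only: d g swap_vars_X_mult) (simp add: algebra_simps)
  finally show ?case by blast
next
  case (diff f g)
  then obtain a b where "a * (X i - X (Suc i)) = f - swap_vars i f"
    "b * (X i - X (Suc i)) = g - swap_vars i g"
    by blast
  then have "(a - b) * (X i - X (Suc i)) = f - g - swap_vars i (f - g)"
    by (simp add: swap_vars_diff left_diff_distrib)
  then show ?case by blast
qed (rule exI[of _ 0], simp)+

lemma divided_diff_eqI:
  assumes "g * (X i - X (Suc i)) = f - swap_vars i f"
  shows "divided_diff i f = g"
  unfolding divided_diff_def
proof (rule the_equality)
  fix g' assume "g' * (X i - X (Suc i)) = f - swap_vars i f"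
  with assms have "(g' - g) * (X i - X (Suc i)) = 0" by (simp add: left_diff_distrib)
  then show "g' = g" by simp
qed fact

lemma divided_diff_mult_cancel: "divided_diff i f * (X i - X (Suc i)) = f - swap_vars i f"
  using divided_diff_exists divided_diff_eqI by blast

lemma divided_diff_add: "divided_diff i (f + g) = divided_diff i f + divided_diff i g"
  by (rule divided_diff_eqI) (simp add: distrib_right divided_diff_mult_cancel swap_vars_add)

lemma divided_diff_diff: "divided_diff i (f - g) = divided_diff i f - divided_diff i g"
  by (rule divided_diff_eqI) (simp add: left_diff_distrib divided_diff_mult_cancel swap_vars_diff)

lemma divided_diff_0 [simp]: "divided_diff i 0 = 0"
  by (rule divided_diff_eqI) simp

lemma divided_diff_1 [simp]: "divided_diff i 1 = 0"
  by (rule divided_diff_eqI) simp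

lemma divided_diff_uminus: "divided_diff i (- f) = - divided_diff i f"
  using divided_diff_diff[of i 0 f] by simp

lemma divided_diff_sum: "divided_diff i (sum f A) = (\<Sum>a\<in>A. divided_diff i (f a))"
  by (induction A rule: infinite_finite_induct) (auto simp: divided_diff_add)

lemma divided_diff_mult:
  "divided_diff i (f * g) = divided_diff i f * g + swap_vars i f * divided_diff i g"
proof (rule divided_diff_eqI)
  let ?d = "X i - X (Suc i)"
  have "(divided_diff i f * g + swap_vars i f * divided_diff i g) * ?d
      = (divided_diff i f * ?d) * g + swap_vars i f * (divided_diff i g * ?d)"
    by (simp add: algebra_simps)
  also have "\<dots> = f * g - swap_vars i (f * g)"
    by (simp only: divided_diff_mult_cancel) (simp add: swap_vars_mult algebra_simps)
  finally show "(divided_diff i f * g + swap_vars i f * divided_diff i g) * ?d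
      = f * g - swap_vars i (f * g)" .
qed

lemma divided_diff_X:
  "divided_diff i (X j) = (if j = i then 1 else if j = Suc i then - 1 else 0)"
  by (rule divided_diff_eqI) (auto simp: transpose_def)

lemma divided_diff_eq_0_iff: "divided_diff i f = 0 \<longleftrightarrow> swap_vars i f = f"
proof
  assume "divided_diff i f = 0"
  then show "swap_vars i f = f" using divided_diff_mult_cancel[of i f] by simp
qed (auto intro: divided_diff_eqI)

lemma swap_vars_divided_diff [simp]: "swap_vars i (divided_diff i f) = divided_diff i f"
proof -
  have "swap_vars i (divided_diff i f * (X i - X (Suc i))) = swap_vars i (f - swap_vars i f)"
    by (simp only: divided_diff_mult_cancel)
  then have "swap_vars i (divided_diff i f) * (X (Suc i) - X i) = swap_vars i f - f"
    by (simp add: swap_vars_mult swap_vars_diff)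
  then have "swap_vars i (divided_diff i f) * (X i - X (Suc i)) = f - swap_vars i f"
    by (metis minus_diff_eq mult_minus_right)
  then show ?thesis by (metis divided_diff_eqI)
qed

lemma divided_diff_divided_diff [simp]: "divided_diff i (divided_diff i f) = 0"
  by (simp add: divided_diff_eq_0_iff)

lemma divided_diff_mult_symmetric:
  "divided_diff i g = 0 \<Longrightarrow> divided_diff i (f * g) = divided_diff i f * g"
  "divided_diff i g = 0 \<Longrightarrow> divided_diff i (g * f) = g * divided_diff i f"
  by (simp_all add: divided_diff_mult divided_diff_eq_0_iff)

lemma divided_diff_divided_diff_mult_cancel:
  assumes "Suc i < j \<or> Suc j < i"
  shows "divided_diff i (divided_diff j f) * ((X i - X (Suc i)) * (X j - X (Suc j)))
    = f - swap_vars i f - swap_vars j f + swap_vars i (swap_vars j f)"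
proof -
  let ?d = "X i - X (Suc i)" and ?e = "X j - X (Suc j)"
  have fixed: "swap_vars i ?e = ?e"
    using assms by (auto simp: swap_vars_diff transpose_def)
  have "divided_diff i (divided_diff j f) * (?d * ?e)
      = (divided_diff j f - swap_vars i (divided_diff j f)) * ?e"
    by (simp only: mult.assoc[symmetric] divided_diff_mult_cancel)
  also have "\<dots> = divided_diff j f * ?e - swap_vars i (divided_diff j f * ?e)"
    using fixed by (simp add: swap_vars_mult left_diff_distrib)
  also have "\<dots> = f - swap_vars i f - swap_vars j f + swap_vars i (swap_vars j f)"
    by (simp add: divided_diff_mult_cancel swap_vars_diff)
  finally show ?thesis .
qed

lemma divided_diff_commute:
  assumes "Suc i < j"
  shows "divided_diff i (divided_diff j f) = divided_diff j (divided_diff i f)"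
proof -
  let ?d = "X i - X (Suc i)" and ?e = "X j - X (Suc j)"
  have "divided_diff i (divided_diff j f) * (?d * ?e)
      = divided_diff j (divided_diff i f) * (?e * ?d)"
    unfolding divided_diff_divided_diff_mult_cancel[OF disjI1[OF assms]]
      divided_diff_divided_diff_mult_cancel[OF disjI2[OF assms]]
      swap_vars_commute[OF disjI1[OF assms]]
    by simp
  moreover have "?d * ?e \<noteq> 0" by simp
  ultimately show ?thesis by (metis mult.commute mult_right_cancel)
qed

text \<open>Both sides of the braid relation, multiplied by the Vandermonde product, antisymmetrize.\<close>

lemma divided_diff_triple_mult_cancel:
  fixes i j :: nat
  defines "d \<equiv> X i - X (Suc i)" and "e \<equiv> X j - X (Suc j)"
    and "s \<equiv> swap_vars i" and "t \<equiv> swap_vars j"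
  assumes adjacent: "j = Suc i \<or> i = Suc j"
  shows "divided_diff i (divided_diff j (divided_diff i f)) * (d * e * (d + e))
    = f - s f - t f + t (s f) + s (t f) - s (t (s f))"
proof -
  define g h where "g = divided_diff i f" and "h = divided_diff j g"
  have mult: "s (x * y) = s x * s y" "t (x * y) = t x * t y"
    and diff: "s (x - y) = s x - s y" "t (x - y) = t x - t y" for x y
    by (simp_all add: s_def t_def swap_vars_mult swap_vars_diff)
  have roots: "s e = d + e" "s (d + e) = e" "t d = d + e" "t (d + e) = d"
    using adjacent
    by (auto simp: s_def t_def d_def e_def swap_vars_diff swap_vars_add transpose_def)
  have g: "g * d = f - s f" and h: "h * e = g - t g" and sg: "s g = g"
    by (simp_all add: g_def h_def d_def e_def s_def t_def divided_diff_mult_cancel)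
  have sh: "s h * (d + e) = g - s (t g)"
    using arg_cong[OF h, of s] by (simp only: mult diff roots sg)
  have tg: "t g * (d + e) = t f - t (s f)"
    using arg_cong[OF g, of t] by (simp only: mult diff roots)
  have stg: "s (t g) * e = s (t f) - s (t (s f))"
    using arg_cong[OF tg, of s] by (simp only: mult diff roots)
  have "divided_diff i h * (d * e * (d + e)) = (divided_diff i h * d) * (e * (d + e))"
    by (simp add: mult_ac)
  also have "\<dots> = (h - s h) * (e * (d + e))"
    by (simp only: d_def s_def divided_diff_mult_cancel)
  also have "\<dots> = (h * e) * (d + e) - (s h * (d + e)) * e"
    by (simp add: algebra_simps)
  also have "\<dots> = g * d - t g * (d + e) + s (t g) * e"
    by (simp only: h sh) (simp add: algebra_simps)
  also have "\<dots> = f - s f - t f + t (s f) + s (t f) - s (t (s f))"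
    by (simp only: g tg stg) (simp add: algebra_simps)
  finally show ?thesis by (simp only: h_def g_def)
qed

lemma divided_diff_braid:
  "divided_diff i (divided_diff (Suc i) (divided_diff i f))
    = divided_diff (Suc i) (divided_diff i (divided_diff (Suc i) f))"
proof -
  let ?d = "X i - X (Suc i)" and ?e = "X (Suc i) - X (Suc (Suc i))"
  have "divided_diff i (divided_diff (Suc i) (divided_diff i f)) * (?d * ?e * (?d + ?e))
      = divided_diff (Suc i) (divided_diff i (divided_diff (Suc i) f)) * (?e * ?d * (?e + ?d))"
    unfolding divided_diff_triple_mult_cancel[OF disjI1[OF refl]]
      divided_diff_triple_mult_cancel[OF disjI2[OF refl]] swap_vars_braid
    by (simp only: algebra_simps)
  moreover have "?e * ?d * (?e + ?d) = ?d * ?e * (?d + ?e)"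
    by (simp only: mult.commute[of ?e ?d] add.commute[of ?e ?d])
  moreover have "?d * ?e * (?d + ?e) \<noteq> 0" by simp
  ultimately show ?thesis by (metis mult_right_cancel)
qed

lemma swap_vars_monomial:
  assumes "i \<in> A \<longleftrightarrow> Suc i \<in> A"
  shows "swap_vars i (\<Prod>a\<in>A. X a ^ c a) = (\<Prod>a\<in>A. X a ^ c (adj_transp i a))"
proof -
  have "swap_vars i (\<Prod>a\<in>A. X a ^ c a) = (\<Prod>a\<in>A. X (adj_transp i a) ^ c a)"
    by (simp add: swap_vars_prod swap_vars_power)
  also have "\<dots> = (\<Prod>a\<in>A. X a ^ c (adj_transp i a))"
    by (rule prod.reindex_bij_witness[where i = "adj_transp i" and j = "adj_transp i"])
       (use transpose_image_eq[OF assms] in auto)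
  finally show ?thesis .
qed

lemma divided_diff_monomial_symmetric:
  assumes "i \<in> A \<longleftrightarrow> Suc i \<in> A" and "c i = c (Suc i)"
  shows "divided_diff i (\<Prod>a\<in>A. X a ^ c a) = 0"
  unfolding divided_diff_eq_0_iff swap_vars_monomial[OF assms(1)]
  using assms(2) by (intro prod.cong) (auto simp: transpose_def)

lemma divided_diff_monomial_step:
  assumes "finite A" "i \<in> A" "Suc i \<in> A" and "c i = Suc (c (Suc i))"
  shows "divided_diff i (\<Prod>a\<in>A. X a ^ c a) = (\<Prod>a\<in>A. X a ^ (c(i := c (Suc i))) a)"
proof -
  let ?c = "c(i := c (Suc i))"
  have "(\<Prod>a\<in>A. X a ^ c a) = X i * (\<Prod>a\<in>A. X a ^ ?c a)"
    using assms by (simp add: prod.remove[of A i] mult.assoc)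
  moreover have "divided_diff i (\<Prod>a\<in>A. X a ^ ?c a) = 0"
    using assms by (intro divided_diff_monomial_symmetric) auto
  ultimately show ?thesis
    by (simp add: divided_diff_mult divided_diff_X)
qed

lemma divided_diff_X_power: "j \<noteq> i \<Longrightarrow> j \<noteq> Suc i \<Longrightarrow> divided_diff i (X j ^ n) = 0"
  by (simp add: divided_diff_eq_0_iff swap_vars_power)

section \<open>Homogeneous polynomials\<close>

inductive homogeneous :: "nat \<Rightarrow> zpoly \<Rightarrow> bool" where
  zero: "homogeneous d 0"
| one: "homogeneous 0 1"
| mult_X: "homogeneous d f \<Longrightarrow> homogeneous (Suc d) (X j * f)"
| diff: "homogeneous d f \<Longrightarrow> homogeneous d g \<Longrightarrow> homogeneous d (f - g)"

lemma homogeneous_uminus: "homogeneous d f \<Longrightarrow> homogeneous d (- f)"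
  using homogeneous.diff[OF homogeneous.zero] by fastforce

lemma homogeneous_add: "homogeneous d f \<Longrightarrow> homogeneous d g \<Longrightarrow> homogeneous d (f + g)"
  using homogeneous.diff[OF _ homogeneous_uminus] by fastforce

lemma homogeneous_X: "homogeneous 1 (X j)"
  using homogeneous.mult_X[OF homogeneous.one] by (simp add: One_nat_def)

lemma homogeneous_mult: "homogeneous d f \<Longrightarrow> homogeneous e g \<Longrightarrow> homogeneous (d + e) (f * g)"
  by (induction rule: homogeneous.induct)
     (auto simp: mult.assoc left_diff_distrib intro: homogeneous.intros)

lemma homogeneous_power: "homogeneous d f \<Longrightarrow> homogeneous (n * d) (f ^ n)"
  by (induction n) (auto intro: homogeneous.one homogeneous_mult)

lemma homogeneous_prod:
  "finite A \<Longrightarrow> (\<And>a. a \<in> A \<Longrightarrow> homogeneous (d a) (f a)) \<Longrightarrow> homogeneous (sum d A) (prod f A)"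
  by (induction A rule: finite_induct) (auto intro: homogeneous.one homogeneous_mult)

lemma homogeneous_divided_diff:
  "homogeneous d f \<Longrightarrow> homogeneous (d - 1) (divided_diff i f) \<and> (d = 0 \<longrightarrow> divided_diff i f = 0)"
proof (induction rule: homogeneous.induct)
  case (mult_X d f j)
  have "homogeneous d (divided_diff i (X j) * f)"
    using mult_X.hyps by (auto simp: divided_diff_X intro: homogeneous.zero homogeneous_uminus)
  moreover have "homogeneous d (X (adj_transp i j) * divided_diff i f)"
    using mult_X.IH homogeneous.mult_X[of "d - 1"] by (cases d) (auto intro: homogeneous.zero)
  ultimately show ?case by (simp add: divided_diff_mult homogeneous_add)
qed (auto intro: homogeneous.intros simp: divided_diff_diff)

lemma lookup_X_mult_0: "Poly_Mapping.lookup (X j * f) 0 = 0"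
proof -
  have on_monomial: "Poly_Mapping.lookup (X j * frag_of m) 0 = 0" for m :: "nat \<Rightarrow>\<^sub>0 nat"
  proof -
    have "Poly_Mapping.lookup (Poly_Mapping.single j 1 + m) j \<noteq> 0" by (simp add: lookup_add)
    then have "Poly_Mapping.single j 1 + m \<noteq> 0" by (metis lookup_zero)
    then show ?thesis by (simp add: X_mult_single lookup_single)
  qed
  show ?thesis
    by (rule frag_induction[where c = f and S = UNIV])
       (auto simp: on_monomial right_diff_distrib lookup_minus)
qed

lemma homogeneous_constant_term:
  "homogeneous d f \<Longrightarrow> d \<noteq> 0 \<Longrightarrow> Poly_Mapping.lookup f 0 = 0"
  by (induction rule: homogeneous.induct) (auto simp: lookup_X_mult_0 lookup_minus)

section \<open>Permutations that increase after a given position\<close>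

lemma finitary_perms_ge:
  assumes "w \<in> finitary_perms"
  obtains N where "M \<le> N" "w permutes {1..N}"
proof -
  from assms obtain N where "w permutes {1..N}" by (auto simp: finitary_perms_def)
  then have "w permutes {1..max M N}" by (rule permutes_subset) auto
  then show ?thesis using that[of "max M N"] by auto
qed

lemma permutes_comp_adj_transp:
  "w permutes {1..N} \<Longrightarrow> 1 \<le> i \<Longrightarrow> i < N \<Longrightarrow> w \<circ> adj_transp i permutes {1..N}"
  by (intro permutes_compose permutes_swap_id) auto

lemma finitary_perms_comp_transpose:
  assumes "w \<in> finitary_perms" "1 \<le> a" "1 \<le> b"
  shows "w \<circ> transpose a b \<in> finitary_perms"
proof -
  obtain N where "max a b \<le> N" "w permutes {1..N}" using assms(1) finitary_perms_ge by blast
  then have "w \<circ> transpose a b permutes {1..N}"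
    using assms by (intro permutes_compose permutes_swap_id) auto
  then show ?thesis by (auto simp: finitary_perms_def)
qed

lemma comp_transpose_transpose [simp]: "w \<circ> transpose a b \<circ> transpose a b = w"
  by (simp add: comp_assoc)

lemma comp_transpose_eq_iff: "w \<circ> transpose a b = v \<longleftrightarrow> w = v \<circ> transpose a b"
  by (metis comp_transpose_transpose)

lemma inj_neq_Suc: "inj w \<Longrightarrow> w i \<noteq> w (Suc i)"
  by (simp add: inj_eq)

lemma finitary_perms_inj: "w \<in> finitary_perms \<Longrightarrow> inj w"
  by (auto simp: finitary_perms_def permutes_inj)

lemma finitary_perms_surj: "w \<in> finitary_perms \<Longrightarrow> \<exists>j. w j = y"
  unfolding finitary_perms_def using permutes_surj[of w] surjD[of w y] by fastforce

lemma finitary_perms_0: "w \<in> finitary_perms \<Longrightarrow> w 0 = 0"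
  by (auto simp: finitary_perms_def permutes_def)

lemma finitary_perms_pos: "w \<in> finitary_perms \<Longrightarrow> 0 < w a \<longleftrightarrow> 0 < a"
  by (metis finitary_perms_0 finitary_perms_inj injD neq0_conv)

lemma id_finitary_perms: "id \<in> finitary_perms"
  by (auto simp: finitary_perms_def permutes_id)

definition increasing_after :: "nat \<Rightarrow> (nat \<Rightarrow> nat) set" where
  "increasing_after k = {w \<in> finitary_perms. \<forall>i>k. w i < w (Suc i)}"

lemma increasing_after_subset: "increasing_after k \<subseteq> finitary_perms"
  by (auto simp: increasing_after_def)

lemma increasing_after_finitary: "w \<in> increasing_after k \<Longrightarrow> w \<in> finitary_perms"
  by (simp add: increasing_after_def)

lemma increasing_after_less:
  assumes "w \<in> increasing_after k" "k < i" "i < j"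
  shows "w i < w j"
  using assms(3)
proof (induction j)
  case (Suc j)
  have "w j < w (Suc j)" if "i \<le> j" using assms(1,2) that by (auto simp: increasing_after_def)
  then show ?case using Suc by (cases "i = j") auto
qed simp

lemma increasing_after_inj: "w \<in> increasing_after k \<Longrightarrow> inj w"
  using increasing_after_finitary finitary_perms_inj by blast

lemma increasing_after_inj_on: "w \<in> increasing_after k \<Longrightarrow> inj_on w A"
  using increasing_after_inj by (metis inj_on_subset subset_UNIV)

lemma increasing_after_eq_iff: "w \<in> increasing_after k \<Longrightarrow> w a = w b \<longleftrightarrow> a = b"
  using increasing_after_inj inj_eq by metis

lemma increasing_after_pos: "w \<in> increasing_after k \<Longrightarrow> 0 < a \<Longrightarrow> 0 < w a"
  using increasing_after_finitary finitary_perms_pos by blast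

lemma permutes_increasing_after:
  assumes w: "w permutes {1..n}" and inc: "\<And>i. k < i \<Longrightarrow> i < n \<Longrightarrow> w i < w (Suc i)"
  shows "w \<in> increasing_after k"
  unfolding increasing_after_def
proof (intro CollectI conjI allI impI)
  show "w \<in> finitary_perms" using w by (auto simp: finitary_perms_def)
  fix i assume i: "k < i"
  consider (inside) "i < n" | (boundary) "i = n" | (outside) "n < i" by linarith
  then show "w i < w (Suc i)"
  proof cases
    case boundary
    then have "w i \<in> {1..n}" "w (Suc i) = Suc i"
      using permutes_in_image[OF w, of i] permutes_not_in[OF w, of "Suc i"] i by auto
    then show ?thesis using boundary by simp
  qed (use inc i permutes_not_in[OF w] in auto)
qed

lemma increasing_after_least_tail:
  assumes w: "w \<in> increasing_after k" and "0 < j" "w j < w (Suc k)"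
  shows "j \<in> {1..k}"
proof -
  have "\<not> k < j"
    using increasing_after_less[OF w, of "Suc k" j] assms(3) by (cases "j = Suc k") auto
  then show ?thesis using assms(2) by simp
qed

lemma increasing_after_eqI:
  assumes w: "w \<in> increasing_after k" and v: "v \<in> increasing_after k"
    and eq: "\<And>a. a \<in> {1..k} \<Longrightarrow> w a = v a"
  shows "w = v"
proof
  fix i
  show "w i = v i"
  proof (induction i rule: less_induct)
    case (less i)
    have not_less: "\<not> x i < y i"
      if x: "x \<in> increasing_after k" and y: "y \<in> increasing_after k"
        and agree: "\<And>j. j < i \<Longrightarrow> x j = y j" and "k < i" for x y
    proof
      assume lt: "x i < y i"
      obtain j where j: "y j = x i"
        using finitary_perms_surj[OF increasing_after_finitary[OF y]] by blast
      have "\<not> j < i" using agree[of j] j increasing_after_eq_iff[OF x, of i j] by auto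
      moreover have "\<not> i < j" using increasing_after_less[OF y \<open>k < i\<close>, of j] j lt by auto
      ultimately show False using j lt by (metis less_irrefl nat_neq_iff)
    qed
    consider (zero) "i = 0" | (front) "i \<in> {1..k}" | (tail) "k < i" by fastforce
    then show ?case
    proof cases
      case zero
      then show ?thesis using w v by (simp add: finitary_perms_0 increasing_after_finitary)
    next
      case tail
      then show ?thesis using not_less[OF w v] not_less[OF v w] less by (metis nat_neq_iff)
    qed (use eq in auto)
  qed
qed

lemma permutes_no_descent:
  assumes "w permutes {1..N}" "\<And>i. 1 \<le> i \<Longrightarrow> i < N \<Longrightarrow> w i < w (Suc i)"
  shows "w = id"
proof (rule increasing_after_eqI[of _ 0])
  show "w \<in> increasing_after 0" using assms by (intro permutes_increasing_after) auto
qed (auto simp: increasing_after_def id_finitary_perms)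

definition front :: "nat \<Rightarrow> (nat \<Rightarrow> nat) \<Rightarrow> bool" where
  "front k f \<longleftrightarrow> inj_on f {1..k} \<and> (\<forall>a\<in>{1..k}. 1 \<le> f a)"

lemma front_inj_on: "front k f \<Longrightarrow> inj_on f {1..k}"
  by (simp add: front_def)

lemma front_pos: "front k f \<Longrightarrow> a \<in> {1..k} \<Longrightarrow> 1 \<le> f a"
  by (simp add: front_def)

lemma increasing_after_front:
  assumes "w \<in> increasing_after k"
  shows "front l w"
proof -
  have "1 \<le> w a" if "a \<in> {1..l}" for a
    using increasing_after_pos[OF assms, of a] that by simp
  then show ?thesis by (simp add: front_def increasing_after_inj_on[OF assms])
qed

lemma less_not_in_image:
  fixes f :: "'a \<Rightarrow> 'b::order"
  shows "(\<And>a. a \<in> A \<Longrightarrow> z < f a) \<Longrightarrow> z \<notin> f ` A"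
  by blast

lemma front_updI:
  assumes "inj_on f ({1..k} - {r})" "\<And>a. a \<in> {1..k} - {r} \<Longrightarrow> 1 \<le> f a"
    and "1 \<le> z" "z \<notin> f ` ({1..k} - {r})"
  shows "front k (f(r := z))"
proof -
  have "inj_on (f(r := z)) {1..k}"
  proof (rule inj_onI)
    fix a b assume "a \<in> {1..k}" "b \<in> {1..k}" "(f(r := z)) a = (f(r := z)) b"
    then show "a = b"
      using inj_onD[OF assms(1), of a b] assms(4) by (cases "a = r"; cases "b = r") auto
  qed
  moreover have "1 \<le> (f(r := z)) a" if "a \<in> {1..k}" for a
    using assms(2)[of a] assms(3) that by (cases "a = r") auto
  ultimately show ?thesis unfolding front_def by blast
qed

lemma front_upd: "front k f \<Longrightarrow> 1 \<le> z \<Longrightarrow> z \<notin> f ` ({1..k} - {r}) \<Longrightarrow> front k (f(r := z))"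
  by (rule front_updI) (auto simp: front_def inj_on_diff)

lemma front_extend:
  "front k f \<Longrightarrow> 1 \<le> z \<Longrightarrow> z \<notin> f ` {1..k} \<Longrightarrow> front (Suc k) (f(Suc k := z))"
  by (rule front_updI) (simp_all add: front_def atLeastAtMostSuc_conv)

lemma front_extends_to_permutation:
  assumes f: "front k f"
  shows "\<exists>w\<in>increasing_after k. \<forall>a\<in>{1..k}. w a = f a"
proof -
  define N where "N = max k (Max (insert 0 (f ` {1..k})))"
  have "f a \<le> N" if "a \<in> {1..k}" for a
    unfolding N_def using that by (intro max.coboundedI2 Max_ge) auto
  then have fN: "f ` {1..k} \<subseteq> {1..N}" using front_pos[OF f] by auto
  have kN: "k \<le> N" by (simp add: N_def)
  define L where "L = sorted_list_of_set ({1..N} - f ` {1..k})"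
  have L: "distinct L" "set L = {1..N} - f ` {1..k}" "sorted_wrt (<) L" "length L = N - k"
    using fN card_image[OF front_inj_on[OF f]] by (auto simp: L_def card_Diff_subset)
  define w where
    "w i = (if i \<in> {1..k} then f i else if i \<in> {k<..N} then L ! (i - Suc k) else i)" for i
  have "bij_betw w ({1..k} \<union> {k<..N}) (f ` {1..k} \<union> ({1..N} - f ` {1..k}))"
  proof (rule bij_betw_combine)
    show "bij_betw w {1..k} (f ` {1..k})"
      using inj_on_imp_bij_betw[OF front_inj_on[OF f]]
      by (rule bij_betw_cong[THEN iffD1, rotated]) (auto simp: w_def)
    have "bij_betw (\<lambda>i. i - Suc k) {k<..N} {..<N - k}"
      by (rule bij_betwI[where g = "\<lambda>i. i + Suc k"]) auto
    then have "bij_betw ((!) L \<circ> (\<lambda>i. i - Suc k)) {k<..N} ({1..N} - f ` {1..k})"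
      by (rule bij_betw_trans) (intro bij_betw_nth, use L in auto)
    then show "bij_betw w {k<..N} ({1..N} - f ` {1..k})"
      by (rule bij_betw_cong[THEN iffD1, rotated]) (auto simp: w_def)
  qed auto
  moreover have "{1..k} \<union> {k<..N} = {1..N}" "f ` {1..k} \<union> ({1..N} - f ` {1..k}) = {1..N}"
    using fN kN by auto
  ultimately have "w permutes {1..N}"
    using kN by (intro bij_imp_permutes) (auto simp: w_def)
  moreover have "w i < w (Suc i)" if "k < i" "i < N" for i
    using that L sorted_wrt_nth_less[of "(<)" L "i - Suc k" "Suc i - Suc k"] by (simp add: w_def)
  ultimately have "w \<in> increasing_after k" by (rule permutes_increasing_after)
  then show ?thesis by (rule bexI[rotated]) (simp add: w_def)
qed

definition perm_of_front :: "nat \<Rightarrow> (nat \<Rightarrow> nat) \<Rightarrow> nat \<Rightarrow> nat" where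
  "perm_of_front k f = (THE w. w \<in> increasing_after k \<and> (\<forall>a\<in>{1..k}. w a = f a))"

lemma perm_of_front_eqI:
  assumes "w \<in> increasing_after k" "\<And>a. a \<in> {1..k} \<Longrightarrow> w a = f a"
  shows "perm_of_front k f = w"
  unfolding perm_of_front_def
  using assms by (intro the_equality conjI ballI increasing_after_eqI[of _ k]) auto

lemma
  assumes "front k f"
  shows perm_of_front: "perm_of_front k f \<in> increasing_after k"
    and perm_of_front_apply: "a \<in> {1..k} \<Longrightarrow> perm_of_front k f a = f a"
  using front_extends_to_permutation[OF assms] perm_of_front_eqI[of _ k f] by force+

lemma perm_of_front_cong:
  "(\<And>a. a \<in> {1..k} \<Longrightarrow> f a = g a) \<Longrightarrow> perm_of_front k f = perm_of_front k g"
  by (simp add: perm_of_front_def)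

lemma increasing_after_comp_transpose:
  assumes "w \<in> increasing_after k" "a \<in> {1..k}" "b \<in> {1..k}"
  shows "w \<circ> transpose a b \<in> increasing_after k"
  using assms finitary_perms_comp_transpose[of w a b]
  by (auto simp: increasing_after_def transpose_def)

lemma increasing_after_comp_adj_transp:
  "w \<in> increasing_after k \<Longrightarrow> 1 \<le> i \<Longrightarrow> i < k \<Longrightarrow> w \<circ> adj_transp i \<in> increasing_after k"
  by (rule increasing_after_comp_transpose) auto

lemma adj_transp_image_front: "1 \<le> i \<Longrightarrow> i < k \<Longrightarrow> adj_transp i ` {1..k} = {1..k}"
  by (rule transpose_image_eq) auto

lemma adj_transp_in_front: "1 \<le> i \<Longrightarrow> i < k \<Longrightarrow> adj_transp i a \<in> {1..k} \<longleftrightarrow> a \<in> {1..k}"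
  by (auto simp: transpose_def)

lemma comp_adj_transp_image_front:
  "1 \<le> i \<Longrightarrow> i < k \<Longrightarrow> (w \<circ> adj_transp i) ` {1..k} = w ` {1..k}"
  by (simp only: image_comp[symmetric] adj_transp_image_front)

lemma perm_of_front_comp_adj_transp:
  assumes f: "front k f" and i: "1 \<le> i" "i < k"
  shows "perm_of_front k (f \<circ> adj_transp i) = perm_of_front k f \<circ> adj_transp i"
  by (rule perm_of_front_eqI[OF increasing_after_comp_adj_transp[OF perm_of_front[OF f] i]])
     (use perm_of_front_apply[OF f] adj_transp_in_front[OF i] in auto)

section \<open>Induction along adjacent transpositions\<close>

definition weighted_sum :: "(nat \<Rightarrow> nat) \<Rightarrow> nat \<Rightarrow> (nat \<Rightarrow> nat) \<Rightarrow> nat" where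
  "weighted_sum c N w = (\<Sum>i=1..N. c i * w i)"

lemma weighted_sum_comp_adj_transp:
  assumes "1 \<le> i" "i < N"
  shows "weighted_sum c N (w \<circ> adj_transp i) + (c i * w i + c (Suc i) * w (Suc i))
    = weighted_sum c N w + (c i * w (Suc i) + c (Suc i) * w i)"
proof -
  let ?B = "{1..N} - {i, Suc i}"
  have split: "weighted_sum c N u = (\<Sum>j\<in>?B. c j * u j) + (c i * u i + c (Suc i) * u (Suc i))"
    for u
  proof -
    have "(\<Sum>j=1..N. c j * u j) = (\<Sum>j\<in>?B. c j * u j) + (\<Sum>j\<in>{i, Suc i}. c j * u j)"
      using assms by (intro sum.subset_diff) auto
    then show ?thesis by (simp add: weighted_sum_def)
  qed
  have "(\<Sum>j\<in>?B. c j * (w \<circ> adj_transp i) j) = (\<Sum>j\<in>?B. c j * w j)"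
    by (intro sum.cong) (auto simp: transpose_def)
  then show ?thesis by (simp add: split)
qed

lemma weighted_sum_descent_less:
  assumes "1 \<le> i" "i < N" "w (Suc i) < w i"
  shows "weighted_sum id N w < weighted_sum id N (w \<circ> adj_transp i)"
  using weighted_sum_comp_adj_transp[OF assms(1,2), of id w] assms(3) by simp

lemma weighted_sum_rev_descent_less:
  assumes "1 \<le> i" "i < N" "w (Suc i) < w i"
  shows "weighted_sum (\<lambda>j. N - j) N (w \<circ> adj_transp i) < weighted_sum (\<lambda>j. N - j) N w"
proof -
  have "N - i = Suc (N - Suc i)" using assms by simp
  then show ?thesis
    using weighted_sum_comp_adj_transp[OF assms(1,2), of "\<lambda>j. N - j" w] assms(3) by simp
qed

lemma permutes_ascent_induct [consumes 1, case_names step]: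
  assumes "w permutes {1..N}"
    and step: "\<And>w. w permutes {1..N} \<Longrightarrow>
      (\<And>i. 1 \<le> i \<Longrightarrow> i < N \<Longrightarrow> w i < w (Suc i) \<Longrightarrow> P (w \<circ> adj_transp i)) \<Longrightarrow> P w"
  shows "P w"
  using assms(1)
proof (induction "weighted_sum id N w" arbitrary: w rule: less_induct)
  case less
  show ?case
  proof (rule step[OF less.prems])
    fix i assume i: "1 \<le> i" "i < N" "w i < w (Suc i)"
    then have "weighted_sum id N (w \<circ> adj_transp i) < weighted_sum id N w"
      using weighted_sum_descent_less[of i N "w \<circ> adj_transp i"] by simp
    then show "P (w \<circ> adj_transp i)"
      using less.prems i by (intro less.hyps permutes_comp_adj_transp)
  qed
qed

lemma finitary_perms_induct [consumes 1, case_names id descent]: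
  assumes "w \<in> finitary_perms" and "P id"
    and step: "\<And>w i. w \<in> finitary_perms \<Longrightarrow> 1 \<le> i \<Longrightarrow> w (Suc i) < w i \<Longrightarrow>
      P (w \<circ> adj_transp i) \<Longrightarrow> P w"
  shows "P w"
proof -
  obtain N where "w permutes {1..N}" using assms(1) by (auto simp: finitary_perms_def)
  then show ?thesis
  proof (induction "weighted_sum (\<lambda>j. N - j) N w" arbitrary: w rule: less_induct)
    case less
    show ?case
    proof (cases "\<exists>i. 1 \<le> i \<and> i < N \<and> w (Suc i) < w i")
      case False
      then have "w = id"
        using inj_neq_Suc[OF permutes_inj[OF less.prems]]
        by (intro permutes_no_descent[OF less.prems]) (metis nat_neq_iff)
      then show ?thesis using assms(2) by simp
    next
      case True
      then obtain i where i: "1 \<le> i" "i < N" "w (Suc i) < w i" by blast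
      then have "P (w \<circ> adj_transp i)"
        using less.prems
        by (intro less.hyps weighted_sum_rev_descent_less permutes_comp_adj_transp)
      moreover have "w \<in> finitary_perms" using less.prems by (auto simp: finitary_perms_def)
      ultimately show ?thesis using step i by blast
    qed
  qed
qed

lemma increasing_after_sort_induct [consumes 1, case_names decreasing ascent]:
  assumes "w \<in> increasing_after k"
    and decreasing: "\<And>w. w \<in> increasing_after k \<Longrightarrow> strict_antimono_on {1..k} w \<Longrightarrow> P w"
    and ascent: "\<And>w i. w \<in> increasing_after k \<Longrightarrow> 1 \<le> i \<Longrightarrow> i < k \<Longrightarrow> w i < w (Suc i) \<Longrightarrow>
      P (w \<circ> adj_transp i) \<Longrightarrow> P w"
  shows "P w"
  using assms(1)
proof (induction "weighted_sum id k w" arbitrary: w rule: less_induct)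
  case less
  show ?case
  proof (cases "\<exists>i. 1 \<le> i \<and> i < k \<and> w i < w (Suc i)")
    case True
    then obtain i where i: "1 \<le> i" "i < k" "w i < w (Suc i)" by blast
    then have "weighted_sum id k (w \<circ> adj_transp i) < weighted_sum id k w"
      using weighted_sum_descent_less[of i k "w \<circ> adj_transp i"] by simp
    then have "P (w \<circ> adj_transp i)"
      using i less.prems by (intro less.hyps increasing_after_comp_adj_transp)
    then show ?thesis using ascent[OF less.prems i] by blast
  next
    case False
    then have desc: "w (Suc i) < w i" if "1 \<le> i" "i < k" for i
      using that inj_neq_Suc[OF increasing_after_inj[OF less.prems]] by (metis nat_neq_iff)
    have "w b < w a" if "1 \<le> a" "a < b" "b \<le> k" for a b
      using that(2,3)
    proof (induction b)
      case (Suc b)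
      then show ?case using desc[of b] that(1) by (cases "a = b") auto
    qed simp
    then show ?thesis
      using less.prems by (intro decreasing monotone_onI) auto
  qed
qed

section \<open>Lehmer codes\<close>

definition lehmer_code :: "(nat \<Rightarrow> nat) \<Rightarrow> nat \<Rightarrow> nat" where
  "lehmer_code w i = card {j. i < j \<and> w j < w i}"

definition dominant :: "(nat \<Rightarrow> nat) \<Rightarrow> bool" where
  "dominant w \<longleftrightarrow> (\<forall>i\<ge>1. lehmer_code w (Suc i) \<le> lehmer_code w i)"

lemma finite_later_smaller:
  fixes w :: "nat \<Rightarrow> nat"
  assumes "inj w"
  shows "finite {j. i < j \<and> w j < x}"
  by (rule finite_subset[OF _ finite_vimageI[OF finite_lessThan[of x] assms]]) auto

lemma lehmer_code_ascent_iff: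
  assumes "inj w"
  shows "lehmer_code w i \<le> lehmer_code w (Suc i) \<longleftrightarrow> w i < w (Suc i)"
proof
  assume "w i < w (Suc i)"
  then have "{j. i < j \<and> w j < w i} \<subseteq> {j. Suc i < j \<and> w j < w (Suc i)}"
    by auto (metis Suc_lessI order_less_asym)
  then show "lehmer_code w i \<le> lehmer_code w (Suc i)"
    unfolding lehmer_code_def by (intro card_mono finite_later_smaller assms)
next
  assume le: "lehmer_code w i \<le> lehmer_code w (Suc i)"
  show "w i < w (Suc i)"
  proof (rule ccontr)
    assume "\<not> w i < w (Suc i)"
    then have "w (Suc i) < w i" using inj_neq_Suc[OF assms, of i] by simp
    then have "insert (Suc i) {j. Suc i < j \<and> w j < w (Suc i)} \<subseteq> {j. i < j \<and> w j < w i}" by auto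
    then have "card (insert (Suc i) {j. Suc i < j \<and> w j < w (Suc i)}) \<le> lehmer_code w i"
      unfolding lehmer_code_def by (intro card_mono finite_later_smaller assms)
    then show False using le finite_later_smaller[OF assms] by (simp add: lehmer_code_def)
  qed
qed

lemma lehmer_code_comp_adj_transp:
  assumes "inj w" "w i < w (Suc i)"
  shows "lehmer_code (w \<circ> adj_transp i)
    = (lehmer_code w)(i := Suc (lehmer_code w (Suc i)), Suc i := lehmer_code w i)"
proof
  fix a
  let ?s = "adj_transp i"
  consider (left) "a = i" | (right) "a = Suc i" | (other) "a \<noteq> i" "a \<noteq> Suc i" by blast
  then show "lehmer_code (w \<circ> ?s) a
    = ((lehmer_code w)(i := Suc (lehmer_code w (Suc i)), Suc i := lehmer_code w i)) a"
  proof cases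
    case left
    have "{j. i < j \<and> (w \<circ> ?s) j < (w \<circ> ?s) i} = insert (Suc i) {j. Suc i < j \<and> w j < w (Suc i)}"
      using assms(2) by (auto simp: transpose_def)
    then show ?thesis
      using left finite_later_smaller[OF assms(1)] by (simp add: lehmer_code_def)
  next
    case right
    have "{j. Suc i < j \<and> (w \<circ> ?s) j < (w \<circ> ?s) (Suc i)} = {j. i < j \<and> w j < w i}"
      using assms(2) by (auto simp: transpose_def)
    then show ?thesis using right by (simp add: lehmer_code_def)
  next
    case other
    then have "?s a = a" and later: "a < ?s j \<longleftrightarrow> a < j" for j by (auto simp: transpose_def)
    have "{j. a < j \<and> (w \<circ> ?s) j < (w \<circ> ?s) a} = ?s ` {j. a < j \<and> w j < w a}"
      by (intro set_eqI) (simp only: in_transpose_image_iff mem_Collect_eq later o_apply \<open>?s a = a\<close>)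
    then have "lehmer_code (w \<circ> ?s) a = lehmer_code w a"
      by (simp only: lehmer_code_def card_image[OF inj_on_transpose])
    then show ?thesis using other by simp
  qed
qed

lemma lehmer_code_add_earlier_smaller:
  assumes w: "w \<in> finitary_perms" and "1 \<le> a"
  shows "lehmer_code w a + card {b \<in> {1..<a}. w b < w a} = w a - 1"
proof -
  let ?later = "{j. a < j \<and> w j < w a}" and ?earlier = "{b \<in> {1..<a}. w b < w a}"
  have pos: "1 \<le> w b \<longleftrightarrow> 1 \<le> b" for b using finitary_perms_pos[OF w, of b] by linarith
  have "w ` (?later \<union> ?earlier) = {1..<w a}"
  proof (intro equalityI subsetI)
    fix y assume "y \<in> {1..<w a}"
    then obtain j where j: "y = w j" "0 < w j" "w j < w a"
      using finitary_perms_surj[OF w, of y] by auto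
    then have "0 < j" "j \<noteq> a" using finitary_perms_pos[OF w] by auto
    then show "y \<in> w ` (?later \<union> ?earlier)" using j by auto
  qed (use assms(2) in \<open>auto simp: pos\<close>)
  then have "card (?later \<union> ?earlier) = w a - 1"
    using card_image[OF inj_on_subset[OF finitary_perms_inj[OF w]], of "?later \<union> ?earlier"] by simp
  moreover have "card (?later \<union> ?earlier) = card ?later + card ?earlier"
    using finite_later_smaller[OF finitary_perms_inj[OF w]] by (intro card_Un_disjoint) auto
  ultimately show ?thesis by (simp add: lehmer_code_def)
qed

lemma lehmer_code_increasing_after:
  assumes "w \<in> increasing_after k" "k < a"
  shows "lehmer_code w a = 0"
proof -
  have "{j. a < j \<and> w j < w a} = {}"
    using increasing_after_less[OF assms] by (auto dest: less_asym)
  then show ?thesis by (simp only: lehmer_code_def card.empty)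
qed

lemma lehmer_code_decreasing_front:
  assumes w: "w \<in> increasing_after k" and dec: "strict_antimono_on {1..k} w" and a: "a \<in> {1..k}"
  shows "lehmer_code w a = w a - 1"
proof -
  have "\<not> w b < w a" if "b \<in> {1..<a}" for b
    using monotone_onD[OF dec, of b a] that a by simp
  then have "{b \<in> {1..<a}. w b < w a} = {}" by blast
  moreover have "lehmer_code w a + card {b \<in> {1..<a}. w b < w a} = w a - 1"
    using a by (intro lehmer_code_add_earlier_smaller increasing_after_finitary[OF w]) simp
  ultimately show ?thesis by (simp only: card.empty)
qed

lemma dominant_increasing_afterI:
  assumes w: "w \<in> increasing_after k"
    and le: "\<And>i. 1 \<le> i \<Longrightarrow> i < k \<Longrightarrow> lehmer_code w (Suc i) \<le> lehmer_code w i"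
  shows "dominant w"
  unfolding dominant_def
proof (intro allI impI)
  fix i :: nat assume "1 \<le> i"
  then show "lehmer_code w (Suc i) \<le> lehmer_code w i"
    using le lehmer_code_increasing_after[OF w, of "Suc i"] by (cases "i < k") auto
qed

lemma dominant_decreasing_front:
  assumes w: "w \<in> increasing_after k" and dec: "strict_antimono_on {1..k} w"
  shows "dominant w"
proof (rule dominant_increasing_afterI[OF w])
  fix i assume "1 \<le> i" "i < k"
  then show "lehmer_code w (Suc i) \<le> lehmer_code w i"
    using monotone_onD[OF dec, of i "Suc i"] by (simp add: lehmer_code_decreasing_front[OF w dec])
qed

section \<open>Schubert polynomials\<close>

lemma longest_perm_permutes: "longest_perm N permutes {1..N}"
proof (rule bij_imp_permutes)
  show "bij_betw (longest_perm N) {1..N} {1..N}"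
    by (rule bij_betwI[where g = "longest_perm N"]) (auto simp: longest_perm_def)
qed (auto simp: longest_perm_def)

lemma longest_perm_involutory: "longest_perm N \<circ> longest_perm N = id"
  by (rule ext) (auto simp: longest_perm_def)

lemma permutes_no_ascent:
  assumes w: "w permutes {1..N}" and desc: "\<And>i. 1 \<le> i \<Longrightarrow> i < N \<Longrightarrow> w (Suc i) < w i"
  shows "w = longest_perm N"
proof -
  have "w \<circ> longest_perm N = id"
  proof (rule permutes_no_descent)
    show "w \<circ> longest_perm N permutes {1..N}" by (intro permutes_compose longest_perm_permutes w)
    fix i assume i: "1 \<le> i" "i < N"
    then have "Suc (N - i) = N + 1 - i" by simp
    then show "(w \<circ> longest_perm N) i < (w \<circ> longest_perm N) (Suc i)"
      using desc[of "N - i"] i by (simp add: longest_perm_def)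
  qed
  then have "w \<circ> (longest_perm N \<circ> longest_perm N) = longest_perm N"
    by (metis comp_assoc id_comp)
  then show ?thesis by (simp add: longest_perm_involutory)
qed

lemma lehmer_code_longest_perm: "i \<in> {1..N} \<Longrightarrow> lehmer_code (longest_perm N) i = N - i"
proof -
  assume "i \<in> {1..N}"
  then have "{j. i < j \<and> longest_perm N j < longest_perm N i} = {i<..N}"
    by (auto simp: longest_perm_def)
  then show ?thesis by (simp only: lehmer_code_def card_greaterThanAtMost)
qed

lemma dominant_longest_perm: "dominant (longest_perm N)"
proof (rule dominant_increasing_afterI)
  show "longest_perm N \<in> increasing_after N"
    by (rule permutes_increasing_after[OF longest_perm_permutes]) simp
qed (simp add: lehmer_code_longest_perm)

lemma schubert_in_permutes: "schubert_in N w f \<Longrightarrow> w permutes {1..N}"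
proof (induction rule: schubert_in.induct)
  case (descent w f i)
  then show ?case by (intro permutes_comp_adj_transp)
qed (rule longest_perm_permutes)

lemma schubert_in_ascent:
  assumes "schubert_in N (w \<circ> adj_transp i) f" "1 \<le> i" "i < N" "w i < w (Suc i)"
  shows "schubert_in N w (divided_diff i f)"
  using schubert_in.descent[OF assms(1-3)] assms(4) by simp

lemma schubert_in_exists: "w permutes {1..N} \<Longrightarrow> \<exists>f. schubert_in N w f"
proof (induction rule: permutes_ascent_induct)
  case (step w)
  show ?case
  proof (cases "\<exists>i. 1 \<le> i \<and> i < N \<and> w i < w (Suc i)")
    case True
    then show ?thesis using step.IH schubert_in_ascent by blast
  next
    case False
    then have "w = longest_perm N"
      using inj_neq_Suc[OF permutes_inj[OF step.hyps]]
      by (intro permutes_no_ascent[OF step.hyps]) (metis nat_neq_iff)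
    then show ?thesis using schubert_in.longest by blast
  qed
qed

lemma schubert_in_cases:
  assumes "schubert_in N w f"
  obtains (longest) "w = longest_perm N" "f = (\<Prod>i = 1..N. X i ^ (N - i))"
  | (ascent) i g where "1 \<le> i" "i < N" "w i < w (Suc i)" "schubert_in N (w \<circ> adj_transp i) g"
      "f = divided_diff i g"
  using assms
proof (cases rule: schubert_in.cases)
  case (descent u g i)
  then show ?thesis using ascent[of i g] by simp
qed (use longest in blast)

lemma schubert_in_diamond:
  assumes w: "w permutes {1..N}" and ij: "1 \<le> i" "i < j" "j < N"
    and ascents: "w i < w (Suc i)" "w j < w (Suc j)"
  obtains f g where "schubert_in N (w \<circ> adj_transp i) f" "schubert_in N (w \<circ> adj_transp j) g"
    "divided_diff i f = divided_diff j g"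
proof (cases "j = Suc i")
  case False
  let ?u = "w \<circ> adj_transp i \<circ> adj_transp j"
  have "?u permutes {1..N}" using ij by (intro permutes_comp_adj_transp w) auto
  then obtain q where q: "schubert_in N ?u q" using schubert_in_exists by blast
  have "?u = w \<circ> adj_transp j \<circ> adj_transp i"
    using ij False by (auto simp: fun_eq_iff transpose_def)
  then have "schubert_in N (w \<circ> adj_transp j) (divided_diff i q)"
    using q ij ascents False by (intro schubert_in_ascent) (auto simp: transpose_def)
  moreover have "schubert_in N (w \<circ> adj_transp i) (divided_diff j q)"
    using q ij ascents False by (intro schubert_in_ascent) (auto simp: transpose_def)
  ultimately show ?thesis
    using divided_diff_commute[of i j q] ij False by (intro that[of "divided_diff j q"]) auto
next
  case True
  let ?u = "w \<circ> adj_transp i \<circ> adj_transp j \<circ> adj_transp i"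
  have "?u permutes {1..N}" using ij by (intro permutes_comp_adj_transp w) auto
  then obtain q where q: "schubert_in N ?u q" using schubert_in_exists by blast
  have "?u = w \<circ> adj_transp j \<circ> adj_transp i \<circ> adj_transp j"
    using True by (auto simp: fun_eq_iff transpose_def)
  then have "schubert_in N (w \<circ> adj_transp j) (divided_diff i (divided_diff j q))"
    using q ij ascents True by (intro schubert_in_ascent) (auto simp: transpose_def)
  moreover have "schubert_in N (w \<circ> adj_transp i) (divided_diff j (divided_diff i q))"
    using q ij ascents True by (intro schubert_in_ascent) (auto simp: transpose_def)
  ultimately show ?thesis
    using divided_diff_braid[of i q] True by (intro that) auto
qed

lemma schubert_in_unique:
  assumes "schubert_in N w f" "schubert_in N w g"
  shows "f = g"
  using schubert_in_permutes[OF assms(1)] assms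
proof (induction arbitrary: f g rule: permutes_ascent_induct)
  case (step w)
  have confluent: "divided_diff i f' = divided_diff j g'"
    if "1 \<le> i" "i < j" "j < N" "w i < w (Suc i)" "w j < w (Suc j)"
      "schubert_in N (w \<circ> adj_transp i) f'" "schubert_in N (w \<circ> adj_transp j) g'" for i j f' g'
    using step.hyps that(1-5)
  proof (rule schubert_in_diamond)
    fix p q
    assume "schubert_in N (w \<circ> adj_transp i) p" "schubert_in N (w \<circ> adj_transp j) q"
      "divided_diff i p = divided_diff j q"
    then show ?thesis using step.IH[of i f' p] step.IH[of j g' q] that by (simp del: o_apply)
  qed
  have no_ascent: "\<not> longest_perm N i < longest_perm N (Suc i)" if "1 \<le> i" "i < N" for i
    using that by (simp add: longest_perm_def)
  from step.prems(1) show ?case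
  proof (cases rule: schubert_in_cases)
    case longest
    from step.prems(2) show ?thesis
      by (cases rule: schubert_in_cases) (use longest no_ascent in auto)
  next
    case f: (ascent i f')
    from step.prems(2) show ?thesis
    proof (cases rule: schubert_in_cases)
      case longest
      then show ?thesis using f no_ascent by auto
    next
      case g: (ascent j g')
      then show ?thesis
        using f confluent[of i j f' g'] confluent[of j i g' f'] step.IH[of i f' g']
        by (cases i j rule: linorder_cases) (auto simp del: o_apply)
    qed
  qed
qed

lemma dominant_flat_exchange:
  assumes w: "inj w" "dominant w"
    and flat: "\<exists>i. 1 \<le> i \<and> i < N \<and> lehmer_code w i = lehmer_code w (Suc i)"
  obtains i where "1 \<le> i" "i < N" "lehmer_code w i = lehmer_code w (Suc i)" "w i < w (Suc i)"
    "dominant (w \<circ> adj_transp i)"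
proof -
  define i where "i = (LEAST i. 1 \<le> i \<and> i < N \<and> lehmer_code w i = lehmer_code w (Suc i))"
  have i: "1 \<le> i" "i < N" "lehmer_code w i = lehmer_code w (Suc i)"
    using LeastI_ex[OF flat] by (simp_all add: i_def)
  have strict: "lehmer_code w (Suc m) < lehmer_code w m" if "1 \<le> m" "m < i" for m
    using w(2) not_less_Least[OF that(2)[unfolded i_def]] that i
    by (metis dominant_def le_neq_implies_less less_trans)
  have asc: "w i < w (Suc i)" using lehmer_code_ascent_iff[OF w(1), of i] i(3) by simp
  have "dominant (w \<circ> adj_transp i)"
    unfolding dominant_def
  proof (intro allI impI)
    fix m :: nat assume m: "1 \<le> m"
    have "lehmer_code w (Suc m) \<le> lehmer_code w m" using w(2) m by (simp add: dominant_def)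
    then show "lehmer_code (w \<circ> adj_transp i) (Suc m) \<le> lehmer_code (w \<circ> adj_transp i) m"
      using strict[of m] m i(3) by (auto simp: lehmer_code_comp_adj_transp[OF w(1) asc])
  qed
  with i asc show thesis by (rule that)
qed

lemma schubert_in_dominant:
  assumes "w permutes {1..N}" "dominant w"
  shows "schubert_in N w (\<Prod>i=1..N. X i ^ lehmer_code w i)"
  using assms
proof (induction rule: permutes_ascent_induct)
  case (step w)
  note inj = permutes_inj[OF step.hyps]
  show ?case
  proof (cases "\<exists>i. 1 \<le> i \<and> i < N \<and> lehmer_code w i = lehmer_code w (Suc i)")
    case True
    then obtain i where i: "1 \<le> i" "i < N" and flat: "lehmer_code w i = lehmer_code w (Suc i)"
      and asc: "w i < w (Suc i)" and dominant: "dominant (w \<circ> adj_transp i)"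
      using dominant_flat_exchange[OF inj step.prems] by metis
    let ?u = "w \<circ> adj_transp i"
    note code = lehmer_code_comp_adj_transp[OF inj asc]
    have "schubert_in N ?u (\<Prod>m=1..N. X m ^ lehmer_code ?u m)"
      using step.IH i asc dominant by blast
    then have "schubert_in N w (divided_diff i (\<Prod>m=1..N. X m ^ lehmer_code ?u m))"
      using i asc by (intro schubert_in_ascent)
    also have "divided_diff i (\<Prod>m=1..N. X m ^ lehmer_code ?u m)
        = (\<Prod>m=1..N. X m ^ ((lehmer_code ?u)(i := lehmer_code ?u (Suc i))) m)"
      using i flat by (intro divided_diff_monomial_step) (auto simp: code)
    also have "\<dots> = (\<Prod>m=1..N. X m ^ lehmer_code w m)"
      using flat by (intro prod.cong) (auto simp: code)
    finally show ?thesis .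
  next
    case False
    then have "w (Suc i) < w i" if "1 \<le> i" "i < N" for i
      using that step.prems lehmer_code_ascent_iff[OF inj, of i] inj_neq_Suc[OF inj, of i]
      by (metis dominant_def le_neq_implies_less linorder_not_le nat_neq_iff)
    then have w: "w = longest_perm N" by (rule permutes_no_ascent[OF step.hyps])
    have "(\<Prod>i=1..N. X i ^ lehmer_code w i) = (\<Prod>i=1..N. X i ^ (N - i))"
      unfolding w by (intro prod.cong refl) (simp only: lehmer_code_longest_perm)
    then show ?thesis using schubert_in.longest w by metis
  qed
qed

lemma schubert_in_Suc: "schubert_in N w f \<Longrightarrow> schubert_in (Suc N) w f"
proof (induction rule: schubert_in.induct)
  case longest
  have "longest_perm N permutes {1..Suc N}"
    by (rule permutes_subset[OF longest_perm_permutes]) auto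
  then have "schubert_in (Suc N) (longest_perm N)
      (\<Prod>i=1..Suc N. X i ^ lehmer_code (longest_perm N) i)"
    by (rule schubert_in_dominant[OF _ dominant_longest_perm])
  moreover have "lehmer_code (longest_perm N) (Suc N) = 0"
    by (rule lehmer_code_increasing_after[OF
          permutes_increasing_after[where k = N, OF longest_perm_permutes]])
      simp_all
  then have "(\<Prod>i=1..Suc N. X i ^ lehmer_code (longest_perm N) i) = (\<Prod>i=1..N. X i ^ (N - i))"
    by (simp add: lehmer_code_longest_perm)
  ultimately show ?case by simp
next
  case (descent w f i)
  then show ?case by (intro schubert_in.descent) auto
qed

lemma schubert_in_mono: "N \<le> M \<Longrightarrow> schubert_in N w f \<Longrightarrow> schubert_in M w f"
  by (induction M rule: dec_induct) (auto intro: schubert_in_Suc)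

lemma schubert_eqI: "schubert_in N w f \<Longrightarrow> schubert w = f"
  unfolding schubert_def
proof (rule the_equality)
  fix g assume "schubert_in N w f" "\<exists>M. schubert_in M w g"
  then obtain M where "schubert_in M w g" by blast
  with \<open>schubert_in N w f\<close> have "schubert_in (max N M) w f" "schubert_in (max N M) w g"
    by (auto intro: schubert_in_mono[OF max.cobounded1] schubert_in_mono[OF max.cobounded2])
  then show "g = f" by (rule schubert_in_unique[symmetric])
qed blast

lemma schubert_in_schubert: "w permutes {1..N} \<Longrightarrow> schubert_in N w (schubert w)"
  using schubert_in_exists schubert_eqI by metis

theorem schubert_dominant:
  assumes w: "w \<in> increasing_after k" and "dominant w"
  shows "schubert w = (\<Prod>a=1..k. X a ^ lehmer_code w a)"
proof -
  obtain N where N: "k \<le> N" "w permutes {1..N}"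
    using finitary_perms_ge[OF increasing_after_finitary[OF w]] by blast
  have "schubert w = (\<Prod>a=1..N. X a ^ lehmer_code w a)"
    by (rule schubert_eqI[OF schubert_in_dominant[OF N(2) assms(2)]])
  also have "\<dots> = (\<Prod>a=1..k. X a ^ lehmer_code w a)"
    using N(1) by (intro prod.mono_neutral_right) (auto simp: lehmer_code_increasing_after[OF w])
  finally show ?thesis .
qed

corollary schubert_decreasing_front:
  assumes w: "w \<in> increasing_after k" and dec: "strict_antimono_on {1..k} w"
  shows "schubert w = (\<Prod>a=1..k. X a ^ (w a - 1))"
  unfolding schubert_dominant[OF w dominant_decreasing_front[OF assms]]
  by (intro prod.cong) (simp_all add: lehmer_code_decreasing_front[OF assms])

lemma schubert_id [simp]: "schubert id = 1"
proof -
  have "id \<in> increasing_after 0" by (simp add: increasing_after_def id_finitary_perms)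
  then show ?thesis by (simp add: schubert_decreasing_front monotone_on_def)
qed

lemma divided_diff_schubert_descent:
  assumes "w \<in> finitary_perms" "1 \<le> i" "w (Suc i) < w i"
  shows "divided_diff i (schubert w) = schubert (w \<circ> adj_transp i)"
proof -
  obtain N where "Suc i \<le> N" "w permutes {1..N}" using assms(1) finitary_perms_ge by blast
  then have "schubert_in N (w \<circ> adj_transp i) (divided_diff i (schubert w))"
    using assms by (intro schubert_in.descent schubert_in_schubert) auto
  then show ?thesis by (rule schubert_eqI[symmetric])
qed

lemma schubert_ascent:
  assumes "w \<in> finitary_perms" "1 \<le> i" "w i < w (Suc i)"
  shows "schubert w = divided_diff i (schubert (w \<circ> adj_transp i))"
  using divided_diff_schubert_descent[of "w \<circ> adj_transp i" i] assms
  by (simp add: finitary_perms_comp_transpose)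

lemma divided_diff_schubert_ascent:
  assumes "w \<in> finitary_perms" "1 \<le> i" "w i < w (Suc i)"
  shows "divided_diff i (schubert w) = 0"
  by (simp add: schubert_ascent[OF assms])

lemma divided_diff_schubert:
  assumes w: "w \<in> finitary_perms" and "1 \<le> i"
  shows "divided_diff i (schubert w)
    = (if w (Suc i) < w i then schubert (w \<circ> adj_transp i) else 0)"
  using divided_diff_schubert_descent[OF assms] divided_diff_schubert_ascent[OF assms]
    inj_neq_Suc[OF finitary_perms_inj[OF w], of i]
  by (auto simp: not_less_iff_gr_or_eq)

lemma schubert_nonzero: "w \<in> finitary_perms \<Longrightarrow> schubert w \<noteq> 0"
proof (induction rule: finitary_perms_induct)
  case id
  show ?case by (metis schubert_id zero_neq_one)
next
  case (descent w i)
  then show ?case using divided_diff_schubert_descent[of w i] by (auto simp del: o_apply)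
qed

lemma homogeneous_schubert:
  assumes "w \<in> finitary_perms"
  shows "\<exists>d. homogeneous d (schubert w)"
proof -
  have "\<exists>d. homogeneous d f" if "schubert_in N w f" for N w f
    using that
  proof (induction rule: schubert_in.induct)
    case longest
    have "homogeneous (\<Sum>i = 1..N. (N - i) * 1) (\<Prod>i = 1..N. X i ^ (N - i))"
      by (intro homogeneous_prod homogeneous_power homogeneous_X) auto
    then show ?case by blast
  next
    case (descent w f i)
    then show ?case using homogeneous_divided_diff by blast
  qed
  then show ?thesis
    using assms schubert_in_schubert unfolding finitary_perms_def by blast
qed

lemma schubert_constant_term:
  assumes w: "w \<in> finitary_perms" and "w \<noteq> id"
  shows "Poly_Mapping.lookup (schubert w) 0 = 0"
proof -
  obtain d where d: "homogeneous d (schubert w)" using homogeneous_schubert[OF w] by blast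
  obtain N where "w permutes {1..N}" using w by (auto simp: finitary_perms_def)
  then obtain i where "1 \<le> i" "\<not> w i < w (Suc i)" using permutes_no_descent \<open>w \<noteq> id\<close> by blast
  then have i: "1 \<le> i" "w (Suc i) < w i"
    using inj_neq_Suc[OF finitary_perms_inj[OF w], of i] by simp_all
  have "divided_diff i (schubert w) \<noteq> 0"
    using divided_diff_schubert_descent[OF w i] w i
    by (simp add: schubert_nonzero finitary_perms_comp_transpose)
  then show ?thesis
    using homogeneous_divided_diff[OF d] homogeneous_constant_term[OF d] by blast
qed

section \<open>Dual functionals\<close>

lemma dual_functional_exists:
  assumes "v \<in> finitary_perms"
  shows "\<exists>L :: zpoly \<Rightarrow> int. additive L \<and>
    (\<forall>w\<in>finitary_perms. L (schubert w) = (if w = v then 1 else 0))"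
  using assms
proof (induction rule: finitary_perms_induct)
  case id
  have "Poly_Mapping.lookup (schubert w) 0 = (if w = id then 1 else 0)"
    if "w \<in> finitary_perms" for w
    using schubert_constant_term[OF that] schubert_id lookup_one_zero by metis
  moreover have "additive (\<lambda>f :: zpoly. Poly_Mapping.lookup f 0)"
    by (simp add: additive_def lookup_add)
  ultimately show ?case by blast
next
  case (descent v i)
  then obtain L :: "zpoly \<Rightarrow> int" where L: "additive L"
    "\<And>w. w \<in> finitary_perms \<Longrightarrow> L (schubert w) = (if w = v \<circ> adj_transp i then 1 else 0)"
    by blast
  have "L (divided_diff i (schubert w)) = (if w = v then 1 else 0)" if w: "w \<in> finitary_perms" for w
  proof (cases "w (Suc i) < w i")
    case True
    then show ?thesis
      using w descent.hyps
      by (simp add: divided_diff_schubert L(2) finitary_perms_comp_transpose comp_transpose_eq_iff)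
  next
    case False
    then show ?thesis
      using w descent.hyps by (auto simp: divided_diff_schubert additive.zero[OF L(1)])
  qed
  then show ?case
    using L(1)
    by (intro exI[of _ "\<lambda>f. L (divided_diff i f)"]) (simp add: additive_def divided_diff_add)
qed

definition schubert_dual :: "(nat \<Rightarrow> nat) \<Rightarrow> zpoly \<Rightarrow> int" where
  "schubert_dual v = (if v \<in> finitary_perms
    then (SOME L. additive L \<and> (\<forall>w\<in>finitary_perms. L (schubert w) = (if w = v then 1 else 0)))
    else (\<lambda>_. 0))"

lemma schubert_dual_spec:
  assumes "v \<in> finitary_perms"
  shows "additive (schubert_dual v)"
    and "\<forall>w\<in>finitary_perms. schubert_dual v (schubert w) = (if w = v then 1 else 0)"
proof -
  have "schubert_dual v = (SOME L. additive L \<and>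
      (\<forall>w\<in>finitary_perms. L (schubert w) = (if w = v then 1 else 0)))"
    using assms by (simp add: schubert_dual_def)
  then show "additive (schubert_dual v)"
    "\<forall>w\<in>finitary_perms. schubert_dual v (schubert w) = (if w = v then 1 else 0)"
    using someI_ex[OF dual_functional_exists[OF assms]] by metis+
qed

interpretation schubert_dual: additive "schubert_dual v" for v
proof (cases "v \<in> finitary_perms")
  case True
  then show "additive (schubert_dual v)" by (rule schubert_dual_spec)
next
  case False
  then show "additive (schubert_dual v)" by (simp add: schubert_dual_def additive_def)
qed

lemma schubert_dual_schubert:
  assumes "w \<in> finitary_perms"
  shows "schubert_dual v (schubert w) = (if w = v then 1 else 0)"
proof (cases "v \<in> finitary_perms")
  case True
  then show ?thesis using schubert_dual_spec(2) assms by blast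
next
  case False
  then show ?thesis using assms by (auto simp: schubert_dual_def)
qed

lemma schubert_dual_of_int: "schubert_dual v (of_int c * f) = c * schubert_dual v f"
proof (induction c rule: int_induct[where k = 0])
  case base
  show ?case by (simp add: schubert_dual.zero)
next
  case (step1 i)
  then show ?case by (simp add: distrib_right schubert_dual.add)
next
  case (step2 i)
  then show ?case by (simp add: left_diff_distrib schubert_dual.diff)
qed

inductive_set schubert_span :: "(nat \<Rightarrow> nat) set \<Rightarrow> zpoly set" for S where
  zero: "0 \<in> schubert_span S"
| base: "w \<in> S \<Longrightarrow> schubert w \<in> schubert_span S"
| add: "f \<in> schubert_span S \<Longrightarrow> g \<in> schubert_span S \<Longrightarrow> f + g \<in> schubert_span S"
| uminus: "f \<in> schubert_span S \<Longrightarrow> - f \<in> schubert_span S"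

lemma schubert_span_diff:
  "f \<in> schubert_span S \<Longrightarrow> g \<in> schubert_span S \<Longrightarrow> f - g \<in> schubert_span S"
  using schubert_span.add[OF _ schubert_span.uminus] by fastforce

lemma schubert_span_sum:
  "(\<And>a. a \<in> A \<Longrightarrow> f a \<in> schubert_span S) \<Longrightarrow> sum f A \<in> schubert_span S"
  by (induction A rule: infinite_finite_induct) (auto intro: schubert_span.intros)

lemma schubert_span_mono: "f \<in> schubert_span S \<Longrightarrow> S \<subseteq> T \<Longrightarrow> f \<in> schubert_span T"
  by (induction rule: schubert_span.induct) (auto intro: schubert_span.intros)

lemma schubert_span_mult:
  assumes "f \<in> schubert_span S" and "\<And>w. w \<in> S \<Longrightarrow> schubert w * g \<in> schubert_span T"
  shows "f * g \<in> schubert_span T"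
  using assms(1)
  by (induction rule: schubert_span.induct)
     (auto intro: schubert_span.intros assms(2) simp: distrib_right)

lemma schubert_dual_not_in_support:
  assumes "f \<in> schubert_span S" "S \<subseteq> finitary_perms" "v \<notin> S"
  shows "schubert_dual v f = 0"
  using assms(1)
proof induction
  case (base w)
  then show ?case using assms(2,3) by (auto simp: schubert_dual_schubert)
qed (simp_all add: schubert_dual.zero schubert_dual.add schubert_dual.minus)

definition schubert_expands :: "zpoly \<Rightarrow> (nat \<Rightarrow> nat) set \<Rightarrow> bool" where
  "schubert_expands f T \<longleftrightarrow>
     (\<forall>U. finite U \<longrightarrow> T \<subseteq> U \<longrightarrow> f = (\<Sum>v\<in>U. of_int (schubert_dual v f) * schubert v))"

lemma schubert_expandsD:
  "schubert_expands f T \<Longrightarrow> finite U \<Longrightarrow> T \<subseteq> U \<Longrightarrow>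
    f = (\<Sum>v\<in>U. of_int (schubert_dual v f) * schubert v)"
  by (simp add: schubert_expands_def)

lemma schubert_expands_schubert:
  assumes "w \<in> finitary_perms"
  shows "schubert_expands (schubert w) {w}"
  unfolding schubert_expands_def
proof (intro allI impI)
  fix U assume U: "finite U" "{w} \<subseteq> U"
  have "(\<Sum>v\<in>U. of_int (schubert_dual v (schubert w)) * schubert v)
      = (\<Sum>v\<in>U. if v = w then schubert v else 0)"
    using assms by (intro sum.cong) (auto simp: schubert_dual_schubert)
  then show "schubert w = (\<Sum>v\<in>U. of_int (schubert_dual v (schubert w)) * schubert v)"
    using U by simp
qed

lemma schubert_expands_add:
  assumes f: "schubert_expands f T" and g: "schubert_expands g U"
  shows "schubert_expands (f + g) (T \<union> U)"
  unfolding schubert_expands_def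
proof (intro allI impI)
  fix V assume "finite V" "T \<union> U \<subseteq> V"
  then have "f + g = (\<Sum>v\<in>V. of_int (schubert_dual v f) * schubert v)
      + (\<Sum>v\<in>V. of_int (schubert_dual v g) * schubert v)"
    by (intro arg_cong2[where f = "(+)"] schubert_expandsD[OF f] schubert_expandsD[OF g]) auto
  also have "\<dots> = (\<Sum>v\<in>V. of_int (schubert_dual v (f + g)) * schubert v)"
    by (simp add: schubert_dual.add distrib_right sum.distrib)
  finally show "f + g = \<dots>" .
qed

lemma schubert_expands_uminus:
  assumes f: "schubert_expands f T"
  shows "schubert_expands (- f) T"
  unfolding schubert_expands_def
proof (intro allI impI)
  fix V assume "finite V" "T \<subseteq> V"
  then have "- f = - (\<Sum>v\<in>V. of_int (schubert_dual v f) * schubert v)"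
    by (intro arg_cong[where f = uminus] schubert_expandsD[OF f])
  also have "\<dots> = (\<Sum>v\<in>V. of_int (schubert_dual v (- f)) * schubert v)"
    by (simp add: schubert_dual.minus sum_negf)
  finally show "- f = \<dots>" .
qed

lemma schubert_span_expansion:
  assumes "f \<in> schubert_span S" "S \<subseteq> finitary_perms"
  shows "\<exists>T. finite T \<and> T \<subseteq> S \<and> schubert_expands f T"
  using assms(1)
proof induction
  case zero
  show ?case by (intro exI[of _ "{}"]) (simp add: schubert_expands_def schubert_dual.zero)
next
  case (base w)
  then show ?case
    using assms(2) by (intro exI[of _ "{w}"]) (auto intro: schubert_expands_schubert)
next
  case (add f g)
  then obtain T U where "finite T" "T \<subseteq> S" "schubert_expands f T"
    "finite U" "U \<subseteq> S" "schubert_expands g U"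
    by blast
  then show ?case by (intro exI[of _ "T \<union> U"]) (simp add: schubert_expands_add)
next
  case (uminus f)
  then show ?case using schubert_expands_uminus by blast
qed

lemma schubert_dual_expansion_unique:
  assumes "finite U" "U \<subseteq> finitary_perms" "{v. c v \<noteq> 0} \<subseteq> U"
    and "f = (\<Sum>v\<in>U. of_int (c v) * schubert v)"
  shows "schubert_dual v f = c v"
proof -
  have "schubert_dual v f = (\<Sum>u\<in>U. if u = v then c u else 0)"
    unfolding assms(4) using assms(2)
    by (auto simp: schubert_dual.sum schubert_dual_of_int schubert_dual_schubert intro!: sum.cong)
  also have "\<dots> = c v" using assms(1,3) by auto
  finally show ?thesis .
qed

theorem schubert_coeff_eq_schubert_dual:
  assumes f: "f \<in> schubert_span finitary_perms"
  shows "schubert_coeff f v = schubert_dual v f"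
proof -
  obtain T where T: "finite T" "T \<subseteq> finitary_perms"
    and "schubert_expands f T"
    using schubert_span_expansion[OF f order_refl] by blast
  then have expand: "f = (\<Sum>v\<in>T. of_int (schubert_dual v f) * schubert v)"
    by (intro schubert_expandsD) auto
  have "(\<Sum>v\<in>T. of_int (schubert_dual v f) * schubert v)
      = (\<Sum>v\<in>T. of_int (if v \<in> T then schubert_dual v f else 0) * schubert v)"
    by simp
  then have "schubert_dual v f = (if v \<in> T then schubert_dual v f else 0)" for v
    by (intro schubert_dual_expansion_unique[OF T] trans[OF expand]) auto
  then have support: "{v. schubert_dual v f \<noteq> 0} \<subseteq> T"
    by (metis (mono_tags) mem_Collect_eq subsetI)
  have "schubert_coeff f = (\<lambda>v. schubert_dual v f)"
    unfolding schubert_coeff_def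
  proof (rule the_equality, intro conjI)
    show "finite {v. schubert_dual v f \<noteq> 0}" "{v. schubert_dual v f \<noteq> 0} \<subseteq> finitary_perms"
      using support T finite_subset by auto
    have "(\<Sum>v\<in>T. of_int (schubert_dual v f) * schubert v)
        = (\<Sum>v | schubert_dual v f \<noteq> 0. of_int (schubert_dual v f) * schubert v)"
      using T support by (intro sum.mono_neutral_right) auto
    with expand show "f = (\<Sum>v | schubert_dual v f \<noteq> 0. of_int (schubert_dual v f) * schubert v)"
      by (rule trans)
  next
    fix c assume "finite {v. c v \<noteq> 0} \<and> {v. c v \<noteq> 0} \<subseteq> finitary_perms \<and>
      f = (\<Sum>v | c v \<noteq> 0. of_int (c v) * schubert v)"
    then have "c v = schubert_dual v f" for v
      by (intro schubert_dual_expansion_unique[symmetric]) auto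
    then show "c = (\<lambda>v. schubert_dual v f)" ..
  qed
  then show ?thesis by simp
qed

lemma schubert_dual_divided_diff:
  assumes f: "f \<in> schubert_span finitary_perms"
    and v: "v \<in> finitary_perms" "1 \<le> i" "v (Suc i) < v i"
  shows "schubert_dual v f = schubert_dual (v \<circ> adj_transp i) (divided_diff i f)"
  using f
proof induction
  case (base w)
  then show ?case
    using v finitary_perms_comp_transpose[OF base, of i "Suc i"]
    by (auto simp: divided_diff_schubert schubert_dual_schubert schubert_dual.zero
        comp_transpose_eq_iff)
qed (simp_all add: schubert_dual.zero schubert_dual.add schubert_dual.minus divided_diff_add
    divided_diff_uminus)

abbreviation front_schubert :: "nat \<Rightarrow> (nat \<Rightarrow> nat) \<Rightarrow> zpoly" where
  "front_schubert k f \<equiv> schubert (perm_of_front k f)"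

lemma perm_of_front_self: "w \<in> increasing_after k \<Longrightarrow> perm_of_front k w = w"
  by (rule perm_of_front_eqI) simp_all

lemma perm_of_front_finitary: "front k f \<Longrightarrow> perm_of_front k f \<in> finitary_perms"
  by (rule increasing_after_finitary[OF perm_of_front])

lemma divided_diff_front_schubert_beyond:
  "front k f \<Longrightarrow> k < i \<Longrightarrow> divided_diff i (front_schubert k f) = 0"
  using perm_of_front[of k f]
  by (intro divided_diff_schubert_ascent) (auto simp: increasing_after_def)

lemma divided_diff_front_schubert:
  assumes f: "front k f" and i: "1 \<le> i" "i < k"
  shows "divided_diff i (front_schubert k f)
    = (if f (Suc i) < f i then front_schubert k (f \<circ> adj_transp i) else 0)"
  using divided_diff_schubert[OF perm_of_front_finitary[OF f], of i] i
  by (simp add: perm_of_front_apply[OF f] perm_of_front_comp_adj_transp[OF f i])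

lemma front_schubert_decreasing:
  assumes f: "front k f" and dec: "strict_antimono_on {1..k} f"
  shows "front_schubert k f = (\<Prod>a=1..k. X a ^ (f a - 1))"
proof -
  have "strict_antimono_on {1..k} (perm_of_front k f)"
    using dec by (simp add: monotone_on_def perm_of_front_apply[OF f])
  then have "front_schubert k f = (\<Prod>a=1..k. X a ^ (perm_of_front k f a - 1))"
    by (rule schubert_decreasing_front[OF perm_of_front[OF f]])
  also have "\<dots> = (\<Prod>a=1..k. X a ^ (f a - 1))"
    by (intro prod.cong) (simp_all add: perm_of_front_apply[OF f])
  finally show ?thesis .
qed

lemma front_schubert_append_increasing_after:
  assumes "v \<in> increasing_after k" and z: "1 \<le> z" and "\<And>a. a \<in> {1..k} \<Longrightarrow> z < v a"
  shows "front_schubert (Suc k) (v(Suc k := z)) = schubert v * X (Suc k) ^ (z - 1)"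
  using assms(1,3)
proof (induction rule: increasing_after_sort_induct)
  case (decreasing v)
  have "front (Suc k) (v(Suc k := z))"
    using decreasing z by (intro front_extend increasing_after_front less_not_in_image)
  moreover have "strict_antimono_on {1..Suc k} (v(Suc k := z))"
    using decreasing by (auto simp: monotone_on_def le_Suc_eq)
  ultimately have "front_schubert (Suc k) (v(Suc k := z))
      = (\<Prod>a=1..Suc k. X a ^ ((v(Suc k := z)) a - 1))"
    by (rule front_schubert_decreasing)
  also have "\<dots> = schubert v * X (Suc k) ^ (z - 1)"
    by (simp add: schubert_decreasing_front[OF decreasing(1,2)])
  finally show ?case .
next
  case (ascent v i)
  let ?v = "v \<circ> adj_transp i" and ?u = "v(Suc k := z)"
  have less: "z < ?v a" if "a \<in> {1..k}" for a
    using ascent.prems[of "adj_transp i a"] adj_transp_in_front[OF ascent.hyps(2,3)] that by simp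
  have v: "?v \<in> increasing_after k" using ascent by (intro increasing_after_comp_adj_transp)
  have eq: "?u \<circ> adj_transp i = ?v(Suc k := z)"
    using ascent.hyps by (auto simp: fun_eq_iff transpose_def)
  have "front (Suc k) (?v(Suc k := z))"
    using v z less by (intro front_extend increasing_after_front less_not_in_image)
  then have "front_schubert (Suc k) ?u
      = divided_diff i (front_schubert (Suc k) (?v(Suc k := z)))"
    using divided_diff_front_schubert[of "Suc k" "?v(Suc k := z)" i] ascent.hyps
    by (simp add: eq[symmetric] del: o_apply) simp
  also have "front_schubert (Suc k) (?v(Suc k := z)) = schubert ?v * X (Suc k) ^ (z - 1)"
    by (rule ascent.IH[OF less])
  also have "divided_diff i \<dots> = divided_diff i (schubert ?v) * X (Suc k) ^ (z - 1)"
    using ascent.hyps by (intro divided_diff_mult_symmetric divided_diff_X_power) auto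
  also have "divided_diff i (schubert ?v) = schubert v"
    using ascent.hyps by (intro schubert_ascent[symmetric] increasing_after_finitary)
  finally show ?case .
qed

lemma front_schubert_append:
  assumes f: "front k f" and z: "1 \<le> z" "\<And>a. a \<in> {1..k} \<Longrightarrow> z < f a"
  shows "front_schubert (Suc k) (f(Suc k := z)) = front_schubert k f * X (Suc k) ^ (z - 1)"
proof -
  have "perm_of_front (Suc k) (f(Suc k := z))
      = perm_of_front (Suc k) ((perm_of_front k f)(Suc k := z))"
    by (rule perm_of_front_cong) (auto simp: perm_of_front_apply[OF f] le_Suc_eq)
  then show ?thesis
    using front_schubert_append_increasing_after[OF perm_of_front[OF f] z(1)] z(2)
    by (simp add: perm_of_front_apply[OF f])
qed

section \<open>Complete homogeneous symmetric polynomials\<close>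

fun hsym_nat :: "nat \<Rightarrow> nat \<Rightarrow> zpoly" where
  "hsym_nat k 0 = 1"
| "hsym_nat 0 (Suc m) = 0"
| "hsym_nat (Suc k) (Suc m) = hsym_nat k (Suc m) + X (Suc k) * hsym_nat (Suc k) m"

definition hsym :: "nat \<Rightarrow> int \<Rightarrow> zpoly" where
  "hsym k n = (if n < 0 then 0 else hsym_nat k (nat n))"

lemma hsym_neg [simp]: "n < 0 \<Longrightarrow> hsym k n = 0"
  by (simp add: hsym_def)

lemma hsym_0 [simp]: "hsym k 0 = 1"
  by (simp add: hsym_def)

lemma hsym_no_vars: "hsym 0 n = (if n = 0 then 1 else 0)"
  by (cases "nat n") (auto simp: hsym_def)

lemma hsym_Suc: "hsym (Suc k) n = hsym k n + X (Suc k) * hsym (Suc k) (n - 1)"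
proof (cases "n > 0")
  case True
  then have "nat n = Suc (nat (n - 1))" by simp
  then show ?thesis using True by (simp add: hsym_def)
qed (auto simp: hsym_def)

lemma hsym_Suc_iterate:
  "hsym (Suc k) n = (\<Sum>j<d. X (Suc k) ^ j * hsym k (n - int j))
    + X (Suc k) ^ d * hsym (Suc k) (n - int d)"
proof (induction d)
  case (Suc d)
  have "hsym (Suc k) (n - int d) = hsym k (n - int d) + X (Suc k) * hsym (Suc k) (n - int (Suc d))"
    by (subst hsym_Suc) (simp add: algebra_simps)
  then show ?case using Suc by (simp add: algebra_simps)
qed simp

lemma int_nonneg_induct [case_names neg step]:
  assumes "\<And>n::int. n < 0 \<Longrightarrow> P n" "\<And>n. 0 \<le> n \<Longrightarrow> P (n - 1) \<Longrightarrow> P n"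
  shows "P n"
proof (cases "n < 0")
  case False
  then have "- 1 \<le> n" by simp
  then show ?thesis
  proof (induction n rule: int_ge_induct)
    case (step i)
    then show ?case using assms(2)[of "i + 1"] by simp
  qed (use assms(1) in simp)
qed (use assms(1) in simp)

lemma divided_diff_hsym_beyond: "k < i \<Longrightarrow> divided_diff i (hsym k n) = 0"
proof (induction k arbitrary: n)
  case 0
  show ?case by (simp add: hsym_no_vars)
next
  case (Suc k)
  show ?case
  proof (induction n rule: int_nonneg_induct)
    case (step n)
    then show ?case using Suc
      by (subst hsym_Suc) (simp add: divided_diff_add divided_diff_mult divided_diff_X)
  qed simp
qed

lemma divided_diff_hsym_last:
  assumes "1 \<le> k"
  shows "divided_diff k (hsym k n) = hsym (Suc k) (n - 1)"
proof -
  obtain l where k: "k = Suc l" using assms by (cases k) auto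
  let ?s = "swap_vars k" and ?d = "X k - X (Suc k)"
  have invariant: "?s (hsym l n) = hsym l n" for n
    using divided_diff_hsym_beyond[of l k n] k by (simp add: divided_diff_eq_0_iff)
  have "hsym k n - ?s (hsym k n) = ?d * hsym (Suc k) (n - 1)" for n
  proof (induction n rule: int_nonneg_induct)
    case (step n)
    have swapped: "?s (hsym k n) = hsym l n + X (Suc k) * ?s (hsym k (n - 1))"
      by (simp add: k hsym_Suc[of l n] swap_vars_add swap_vars_mult invariant[unfolded k])
    have "hsym k n - ?s (hsym k n) = X k * hsym k (n - 1) - X (Suc k) * ?s (hsym k (n - 1))"
      unfolding swapped by (simp add: k hsym_Suc[of l n])
    also have "\<dots> = ?d * hsym k (n - 1) + X (Suc k) * (hsym k (n - 1) - ?s (hsym k (n - 1)))"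
      by (simp add: algebra_simps)
    also have "\<dots> = ?d * (hsym k (n - 1) + X (Suc k) * hsym (Suc k) (n - 1 - 1))"
      unfolding step by (simp add: algebra_simps)
    also have "\<dots> = ?d * hsym (Suc k) (n - 1)"
      by (simp add: hsym_Suc[of k "n - 1"])
    finally show ?case .
  qed simp
  then show ?thesis by (intro divided_diff_eqI) (simp add: mult.commute)
qed

lemma divided_diff_hsym_symmetric:
  assumes "1 \<le> i" "i < k"
  shows "divided_diff i (hsym k n) = 0"
proof -
  have "Suc i \<le> k" using assms by simp
  then show ?thesis
  proof (induction k arbitrary: n rule: nat_induct_at_least)
    case base
    have "hsym (Suc i) n = divided_diff i (hsym i (n + 1))"
      using divided_diff_hsym_last[OF assms(1), of "n + 1"] by simp
    then show ?case by simp
  next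
    case (Suc k)
    show ?case
    proof (induction n rule: int_nonneg_induct)
      case (step n)
      then show ?case using Suc
        by (subst hsym_Suc) (simp add: divided_diff_add divided_diff_mult divided_diff_X)
    qed simp
  qed
qed

section \<open>The Pieri rule\<close>

text \<open>
  The first \<open>k\<close> values of a permutation are regarded as particles moving to the right; in a Pieri
  step one of them may pass another only if the latter rests and stands at an earlier position.
\<close>

definition pieri_step :: "nat set \<Rightarrow> (nat \<Rightarrow> nat) \<Rightarrow> (nat \<Rightarrow> nat) \<Rightarrow> bool" where
  "pieri_step A V Y \<longleftrightarrow> (\<forall>a\<in>A. V a \<le> Y a) \<and>
     (\<forall>a\<in>A. \<forall>e\<in>A. V a < V e \<longrightarrow> Y a < V e \<or> (e < a \<and> Y e = V e \<and> V e < Y a))"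

definition hops :: "nat set \<Rightarrow> (nat \<Rightarrow> nat) \<Rightarrow> (nat \<Rightarrow> nat) \<Rightarrow> nat" where
  "hops A V Y = (\<Sum>a\<in>A. card ({V a<..Y a} - V ` A))"

definition pieri_targets :: "nat \<Rightarrow> (nat \<Rightarrow> nat) \<Rightarrow> int \<Rightarrow> (nat \<Rightarrow> nat) set" where
  "pieri_targets k V m
    = {Y \<in> extensional {1..k}. pieri_step {1..k} V Y \<and> int (hops {1..k} V Y) = m}"

lemma pieri_step_le: "pieri_step A V Y \<Longrightarrow> a \<in> A \<Longrightarrow> V a \<le> Y a"
  by (simp add: pieri_step_def)

lemma pieri_stepD:
  "pieri_step A V Y \<Longrightarrow> a \<in> A \<Longrightarrow> e \<in> A \<Longrightarrow> V a < V e \<Longrightarrow>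
    Y a < V e \<or> (e < a \<and> Y e = V e \<and> V e < Y a)"
  by (simp add: pieri_step_def)

lemma pieri_step_cong:
  "(\<And>a. a \<in> A \<Longrightarrow> V a = V' a) \<Longrightarrow> (\<And>a. a \<in> A \<Longrightarrow> Y a = Y' a) \<Longrightarrow>
    pieri_step A V Y \<longleftrightarrow> pieri_step A V' Y'"
  by (simp add: pieri_step_def)

lemma hops_cong:
  assumes "\<And>a. a \<in> A \<Longrightarrow> V a = V' a" "\<And>a. a \<in> A \<Longrightarrow> Y a = Y' a"
  shows "hops A V Y = hops A V' Y'"
proof -
  have "V ` A = V' ` A" using assms(1) by (rule image_cong[OF refl])
  then show ?thesis unfolding hops_def using assms by (intro sum.cong) auto
qed

lemma pieri_targets_cong:
  assumes "\<And>a. a \<in> {1..k} \<Longrightarrow> V a = V' a"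
  shows "pieri_targets k V m = pieri_targets k V' m"
proof -
  have "pieri_step {1..k} V Y = pieri_step {1..k} V' Y" for Y
    using assms by (intro pieri_step_cong) simp_all
  moreover have "hops {1..k} V Y = hops {1..k} V' Y" for Y
    using assms by (intro hops_cong) simp_all
  ultimately show ?thesis by (simp only: pieri_targets_def)
qed

lemma pieri_step_inj_on:
  assumes step: "pieri_step A V Y" and inj: "inj_on V A"
  shows "inj_on Y A"
proof (rule inj_onI)
  have neq: "Y a \<noteq> Y e" if "a \<in> A" "e \<in> A" "V a < V e" for a e
    using pieri_stepD[OF step that] pieri_step_le[OF step that(2)] by auto
  fix a e assume "a \<in> A" "e \<in> A" "Y a = Y e"
  then show "a = e" using neq[of a e] neq[of e a] inj by (metis inj_onD linorder_neqE_nat)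
qed

lemma pieri_step_front:
  assumes step: "pieri_step {1..k} f Y" and f: "front k f"
  shows "front k Y"
proof -
  have "1 \<le> Y a" if "a \<in> {1..k}" for a
    using front_pos[OF f that] pieri_step_le[OF step that] by linarith
  then show ?thesis
    using pieri_step_inj_on[OF step front_inj_on[OF f]] by (simp add: front_def)
qed

lemma pieri_targets_front: "Y \<in> pieri_targets k f m \<Longrightarrow> front k f \<Longrightarrow> front k Y"
  unfolding pieri_targets_def by (blast intro: pieri_step_front)

lemma pieri_targets_le: "Y \<in> pieri_targets k V m \<Longrightarrow> a \<in> {1..k} \<Longrightarrow> V a \<le> Y a"
  by (simp add: pieri_targets_def pieri_step_def)

lemma pieri_targets_extensional: "Y \<in> pieri_targets k V m \<Longrightarrow> Y \<in> extensional {1..k}"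
  by (simp add: pieri_targets_def)

lemma finite_pieri_targets: "finite (pieri_targets k V m)"
proof (rule finite_subset)
  let ?B = "(\<Sum>a\<in>{1..k}. V a) + nat m + k"
  show "pieri_targets k V m \<subseteq> {1..k} \<rightarrow>\<^sub>E {..?B}"
  proof
    fix Y assume Y: "Y \<in> pieri_targets k V m"
    have "Y a \<le> ?B" if a: "a \<in> {1..k}" for a
    proof -
      have "card ({V a<..Y a} - V ` {1..k}) \<le> hops {1..k} V Y"
        unfolding hops_def using a by (intro member_le_sum) auto
      moreover have "card {V a<..Y a} - card (V ` {1..k}) \<le> card ({V a<..Y a} - V ` {1..k})"
        by (rule diff_card_le_card_Diff) simp
      moreover have "card (V ` {1..k}) \<le> k" using card_image_le[of "{1..k}" V] by simp
      moreover have "V a \<le> (\<Sum>a\<in>{1..k}. V a)" using a by (intro member_le_sum) auto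
      moreover have "int (hops {1..k} V Y) = m" using Y by (simp add: pieri_targets_def)
      ultimately show ?thesis by simp
    qed
    then show "Y \<in> {1..k} \<rightarrow>\<^sub>E {..?B}" using Y by (auto simp: pieri_targets_def PiE_def)
  qed
qed (simp add: finite_PiE)

lemma pieri_step_insert_last:
  assumes "\<And>a. a \<in> A \<Longrightarrow> a < k"
  shows "pieri_step (insert k A) V Y \<longleftrightarrow> pieri_step A V Y \<and> V k \<le> Y k \<and>
    (\<forall>a\<in>A. V a < V k \<longrightarrow> Y a < V k) \<and>
    (\<forall>e\<in>A. V k < V e \<longrightarrow> Y k < V e \<or> (Y e = V e \<and> V e < Y k))"
proof -
  let ?P = "\<lambda>a e. V a < V e \<longrightarrow> Y a < V e \<or> (e < a \<and> Y e = V e \<and> V e < Y a)"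
  have passing_last: "(\<forall>a\<in>A. ?P a k) \<longleftrightarrow> (\<forall>a\<in>A. V a < V k \<longrightarrow> Y a < V k)"
    using assms less_asym by blast
  have last_passing: "(\<forall>e\<in>A. ?P k e)
      \<longleftrightarrow> (\<forall>e\<in>A. V k < V e \<longrightarrow> Y k < V e \<or> (Y e = V e \<and> V e < Y k))"
    using assms by blast
  have "(\<forall>a\<in>insert k A. \<forall>e\<in>insert k A. ?P a e)
      \<longleftrightarrow> (\<forall>a\<in>A. \<forall>e\<in>A. ?P a e) \<and> (\<forall>a\<in>A. ?P a k) \<and> (\<forall>e\<in>A. ?P k e)"
    by blast
  then show ?thesis
    unfolding pieri_step_def passing_last last_passing by blast
qed

lemma pieri_step_insert_lowest:
  assumes last: "\<And>a. a \<in> A \<Longrightarrow> a < k" and lowest: "\<And>a. a \<in> A \<Longrightarrow> V k < V a"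
  shows "pieri_step (insert k A) V Y \<longleftrightarrow> pieri_step A V Y \<and> V k \<le> Y k \<and>
    (\<forall>e\<in>A. Y k < V e \<or> (Y e = V e \<and> V e < Y k))"
  using pieri_step_insert_last[of A k V Y] last lowest less_asym by blast

subsection \<open>Decreasing fronts\<close>

lemma
  assumes below: "\<And>a. a \<in> {1..l} \<Longrightarrow> Y (Suc l) < V a"
  shows pieri_step_append_below:
      "pieri_step {1..Suc l} V Y \<longleftrightarrow> pieri_step {1..l} V Y \<and> V (Suc l) \<le> Y (Suc l)"
    and hops_append_below: "V (Suc l) \<le> Y (Suc l) \<Longrightarrow>
      hops {1..Suc l} V Y = hops {1..l} V Y + (Y (Suc l) - V (Suc l))"
proof -
  have ivl: "{1..Suc l} = insert (Suc l) {1..l}" by (simp add: atLeastAtMostSuc_conv)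
  show "pieri_step {1..Suc l} V Y \<longleftrightarrow> pieri_step {1..l} V Y \<and> V (Suc l) \<le> Y (Suc l)"
  proof (cases "V (Suc l) \<le> Y (Suc l)")
    case True
    then have "V (Suc l) < V a" if "a \<in> {1..l}" for a using below[OF that] by simp
    then show ?thesis
      unfolding ivl using True below by (subst pieri_step_insert_lowest) auto
  next
    case False
    then show ?thesis using pieri_step_le[of "{1..Suc l}" V Y "Suc l"] by auto
  qed
  assume le: "V (Suc l) \<le> Y (Suc l)"
  have "{V a<..Y a} - V ` insert (Suc l) {1..l} = {V a<..Y a} - V ` {1..l}" if "a \<in> {1..l}" for a
    using below[OF that] le by auto
  moreover have "{V (Suc l)<..Y (Suc l)} - V ` insert (Suc l) {1..l} = {V (Suc l)<..Y (Suc l)}"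
    using below by fastforce
  ultimately show "hops {1..Suc l} V Y = hops {1..l} V Y + (Y (Suc l) - V (Suc l))"
    unfolding ivl hops_def by simp
qed

context
  fixes l :: nat and V Y :: "nat \<Rightarrow> nat"
  assumes dec: "strict_antimono_on {1..Suc l} V" and l: "1 \<le> l" and gt: "V l < Y (Suc l)"
begin

lemma last_two_less: "V (Suc l) < V l"
  using monotone_onD[OF dec, of l "Suc l"] l by simp

lemma initial_greater: "a \<in> {1..<l} \<Longrightarrow> V l < V a"
  using monotone_onD[OF dec, of a l] by simp

lemma ivl_split_last: "{1..l} = insert l {1..<l}" "{1..Suc l} = insert (Suc l) {1..l}"
  using l by auto

lemma pieri_step_append_pass:
  "pieri_step {1..Suc l} V Y \<longleftrightarrow> pieri_step {1..l} V (Y(l := Y (Suc l))) \<and> Y l = V l"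
proof -
  let ?Z = "Y(l := Y (Suc l))"
  have step_l: "pieri_step {1..l} V U \<longleftrightarrow> pieri_step {1..<l} V U \<and> V l \<le> U l \<and>
      (\<forall>e\<in>{1..<l}. U l < V e \<or> (U e = V e \<and> V e < U l))" for U
    unfolding ivl_split_last using initial_greater by (intro pieri_step_insert_lowest) auto
  have step_Suc: "pieri_step {1..Suc l} V Y \<longleftrightarrow> pieri_step {1..l} V Y \<and> V (Suc l) \<le> Y (Suc l) \<and>
      (\<forall>e\<in>insert l {1..<l}. Y (Suc l) < V e \<or> (Y e = V e \<and> V e < Y (Suc l)))"
    unfolding ivl_split_last(2) ivl_split_last(1)[symmetric]
    using monotone_onD[OF dec, of _ "Suc l"]
    by (intro pieri_step_insert_lowest) simp_all
  have "pieri_step {1..<l} V ?Z \<longleftrightarrow> pieri_step {1..<l} V Y"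
    by (rule pieri_step_cong) simp_all
  then have step_Z: "pieri_step {1..l} V ?Z \<longleftrightarrow> pieri_step {1..<l} V Y \<and> V l \<le> Y (Suc l) \<and>
      (\<forall>e\<in>{1..<l}. Y (Suc l) < V e \<or> (Y e = V e \<and> V e < Y (Suc l)))"
    unfolding step_l by simp
  have "\<forall>e\<in>{1..<l}. Y l < V e" if "Y l = V l" using initial_greater that by simp
  moreover have "V (Suc l) \<le> Y (Suc l)" "V l \<le> Y (Suc l)" "\<not> Y (Suc l) < V l"
    using gt last_two_less by simp_all
  ultimately show ?thesis
    unfolding step_Suc step_l[of Y] step_Z using gt by (cases "Y l = V l") auto
qed

lemma hops_append_pass:
  assumes "Y l = V l"
  shows "hops {1..Suc l} V Y = hops {1..l} V (Y(l := Y (Suc l))) + (V l - V (Suc l) - 1)"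
proof -
  let ?Z = "Y(l := Y (Suc l))"
  have image: "V ` {1..Suc l} = insert (V (Suc l)) (V ` {1..l})"
    by (simp only: ivl_split_last(2) image_insert)
  have "{V a<..Y a} - V ` {1..Suc l} = {V a<..?Z a} - V ` {1..l}" if "a \<in> {1..<l}" for a
    unfolding image using initial_greater[OF that] last_two_less that by auto
  moreover have "V l \<in> V ` {1..l}" "\<forall>y\<in>V ` {1..l}. V l \<le> y"
    unfolding ivl_split_last(1) using initial_greater by (auto intro: less_imp_le)
  then have "{V (Suc l)<..Y (Suc l)} - V ` {1..Suc l}
      = {V (Suc l)<..<V l} \<union> ({V l<..Y (Suc l)} - V ` {1..l})"
    unfolding image using last_two_less gt
    by (intro equalityI subsetI) (auto simp: not_less dest: le_neq_implies_less)
  then have "card ({V (Suc l)<..Y (Suc l)} - V ` {1..Suc l})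
      = V l - V (Suc l) - 1 + card ({V l<..Y (Suc l)} - V ` {1..l})"
    by (simp add: card_Un_disjoint disjoint_iff)
  ultimately show ?thesis
    using assms unfolding hops_def ivl_split_last by simp
qed

end

lemma pieri_targets_restrict:
  "restrict Y {1..k} \<in> pieri_targets k V m \<longleftrightarrow> pieri_step {1..k} V Y \<and> int (hops {1..k} V Y) = m"
proof -
  have "pieri_step {1..k} V (restrict Y {1..k}) \<longleftrightarrow> pieri_step {1..k} V Y"
    by (rule pieri_step_cong) simp_all
  moreover have "hops {1..k} V (restrict Y {1..k}) = hops {1..k} V Y"
    by (rule hops_cong) simp_all
  ultimately show ?thesis by (simp add: pieri_targets_def)
qed

lemma pieri_targets_append_below:
  assumes "\<And>a. a \<in> {1..l} \<Longrightarrow> V (Suc l) + j < V a"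
    and "Y \<in> extensional {1..Suc l}" "Y (Suc l) = V (Suc l) + j"
  shows "Y \<in> pieri_targets (Suc l) V m \<longleftrightarrow> restrict Y {1..l} \<in> pieri_targets l V (m - int j)"
proof -
  have "Y (Suc l) < V a" if "a \<in> {1..l}" for a using assms(1)[OF that] assms(3) by simp
  then show ?thesis
    using pieri_step_append_below[of l Y V] hops_append_below[of l Y V] assms(2,3)
    by (auto simp: pieri_targets_restrict pieri_targets_def[of "Suc l"])
qed

lemma pieri_targets_append_pass:
  assumes "strict_antimono_on {1..Suc l} V" "1 \<le> l" "V l < Y (Suc l)" "Y \<in> extensional {1..Suc l}"
  shows "Y \<in> pieri_targets (Suc l) V m \<longleftrightarrow> Y l = V l \<and>
    restrict (Y(l := Y (Suc l))) {1..l} \<in> pieri_targets l V (m - int (V l - V (Suc l)) + 1)"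
  using pieri_step_append_pass[of l V Y] hops_append_pass[of l V Y] last_two_less[of l V Y] assms
  by (auto simp: pieri_targets_restrict pieri_targets_def[of "Suc l"])

lemma bij_betw_pieri_targets_below:
  assumes below: "\<And>a. a \<in> {1..l} \<Longrightarrow> f (Suc l) + d \<le> f a"
  shows "bij_betw (\<lambda>(j, Y). Y(Suc l := f (Suc l) + j))
    (SIGMA j:{..<d}. pieri_targets l f (m - int j))
    {Y \<in> pieri_targets (Suc l) f m. Y (Suc l) < f (Suc l) + d}" (is "bij_betw ?h ?T ?B")
proof -
  let ?K = "Suc l"
  let ?g = "\<lambda>Y. (Y ?K - f ?K, restrict Y {1..l})"
  have targets: "Y \<in> pieri_targets ?K f m \<longleftrightarrow> restrict Y {1..l} \<in> pieri_targets l f (m - int j)"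
    if "Y \<in> extensional {1..?K}" "Y ?K = f ?K + j" "j < d" for j Y
    using that below by (intro pieri_targets_append_below) force+
  have ext: "Y \<in> extensional {1..l}" if "(j, Y) \<in> ?T" for j Y
    using that by (auto dest: pieri_targets_extensional)
  then have restrict: "restrict (Y(?K := f ?K + j)) {1..l} = Y" if "(j, Y) \<in> ?T" for j Y
    using that by (intro extensionalityI[of _ "{1..l}"]) auto
  have B: "Z \<in> extensional {1..?K}" "f ?K \<le> Z ?K" if "Z \<in> ?B" for Z
    using that pieri_targets_le[of Z ?K f m ?K] by (auto dest: pieri_targets_extensional)
  have "Y(?K := f ?K + j) \<in> ?B" if T: "(j, Y) \<in> ?T" for j Y
  proof -
    have "Y(?K := f ?K + j) \<in> extensional {1..?K}" using ext[OF T] by (auto simp: extensional_def)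
    then show ?thesis using targets[of "Y(?K := f ?K + j)" j] restrict[OF T] T by simp
  qed
  then have "?h \<in> ?T \<rightarrow> ?B" by auto
  moreover have "?g \<in> ?B \<rightarrow> ?T"
  proof
    fix Z assume Z: "Z \<in> ?B"
    then have "Z ?K = f ?K + (Z ?K - f ?K)" "Z ?K - f ?K < d" using B(2)[OF Z] by auto
    then show "?g Z \<in> ?T" using targets[OF B(1)[OF Z]] Z by simp
  qed
  moreover have "?g (?h jY) = jY" if "jY \<in> ?T" for jY
    using that restrict by (cases jY) (simp del: restrict_apply)
  moreover have "?h (?g Z) = Z" if "Z \<in> ?B" for Z
    using B[OF that] by (intro extensionalityI[of _ "{1..?K}"]) (auto simp: extensional_def)
  ultimately show ?thesis by (rule bij_betwI)
qed

lemma sum_pieri_targets_below: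
  assumes f: "front (Suc l) f" and below: "\<And>a. a \<in> {1..l} \<Longrightarrow> f (Suc l) + d \<le> f a"
    and pieri: "\<And>n. front_schubert l f * hsym l n = (\<Sum>Y\<in>pieri_targets l f n. front_schubert l Y)"
  shows "(\<Sum>Y\<in>{Y \<in> pieri_targets (Suc l) f m. Y (Suc l) < f (Suc l) + d}. front_schubert (Suc l) Y)
    = (\<Sum>j<d. front_schubert l f * hsym l (m - int j) * X (Suc l) ^ (f (Suc l) - 1 + j))"
proof -
  let ?K = "Suc l"
  have fl: "front l f" using f by (auto simp: front_def inj_on_def)
  have fK: "1 \<le> f ?K" using front_pos[OF f, of ?K] by simp
  let ?T = "SIGMA j:{..<d}. pieri_targets l f (m - int j)"
  have append: "front_schubert ?K (Y(?K := f ?K + j)) = front_schubert l Y * X ?K ^ (f ?K - 1 + j)"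
    if "(j, Y) \<in> ?T" for j Y
  proof -
    have "f ?K + j < Y a" if "a \<in> {1..l}" for a
      using below[OF that] pieri_targets_le[of Y l f "m - int j" a] \<open>(j, Y) \<in> ?T\<close> that
      by auto
    then show ?thesis
      using pieri_targets_front[OF _ fl, of Y] that fK by (subst front_schubert_append) auto
  qed
  have "(\<Sum>Y\<in>{Y \<in> pieri_targets ?K f m. Y ?K < f ?K + d}. front_schubert ?K Y)
      = (\<Sum>(j, Y)\<in>?T. front_schubert ?K (Y(?K := f ?K + j)))"
    using sum.reindex_bij_betw[OF bij_betw_pieri_targets_below[of l f d m], of "front_schubert ?K"]
      below by (simp add: case_prod_unfold)
  also have "\<dots> = (\<Sum>(j, Y)\<in>?T. front_schubert l Y * X ?K ^ (f ?K - 1 + j))"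
    using append by (intro sum.cong) auto
  also have "\<dots> = (\<Sum>j<d. \<Sum>Y\<in>pieri_targets l f (m - int j).
      front_schubert l Y * X ?K ^ (f ?K - 1 + j))"
    by (rule sum.Sigma[symmetric]) (auto simp: finite_pieri_targets)
  also have "\<dots> = (\<Sum>j<d. front_schubert l f * hsym l (m - int j) * X ?K ^ (f ?K - 1 + j))"
    by (simp only: pieri sum_distrib_right)
  finally show ?thesis .
qed

lemma divided_diff_pieri_target_append:
  assumes f: "front l f" and dec: "strict_antimono_on {1..l} f" and l: "1 \<le> l"
    and Y: "Y \<in> pieri_targets l f n"
  shows "divided_diff l (X (Suc l) ^ (f l - 1) * front_schubert l Y)
    = (if f l < Y l then front_schubert (Suc l) (Y(l := f l, Suc l := Y l)) else 0)"
proof -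
  note front_Y = pieri_targets_front[OF Y f]
  have le: "f a \<le> Y a" if "a \<in> {1..l}" for a
    using pieri_targets_le[OF Y that] .
  have greater: "f l < Y a" if "a \<in> {1..<l}" for a
    using le[of a] monotone_onD[OF dec, of a l] that by simp
  have fl: "1 \<le> f l" using front_pos[OF f] l by simp
  show ?thesis
  proof (cases "f l < Y l")
    case True
    have above: "f l < Y a" if "a \<in> {1..l}" for a
      using greater[of a] True that by (cases "a = l") auto
    have "X (Suc l) ^ (f l - 1) * front_schubert l Y = front_schubert (Suc l) (Y(Suc l := f l))"
      by (simp only: front_schubert_append[OF front_Y fl above] mult.commute)
    moreover have "front (Suc l) (Y(Suc l := f l))"
      using front_Y fl above by (intro front_extend less_not_in_image)
    moreover have "Y(Suc l := f l) \<circ> adj_transp l = Y(l := f l, Suc l := Y l)"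
      by (auto simp: fun_eq_iff transpose_def)
    ultimately show ?thesis using True l by (simp add: divided_diff_front_schubert del: o_apply)
  next
    case False
    then have Yl: "Y l = f l" using le[of l] l by simp
    obtain m where m: "l = Suc m" using l by (cases l) auto
    have front_m: "front m Y" using front_Y by (auto simp: m front_def inj_on_def)
    have "f l < Y a" if "a \<in> {1..m}" for a using greater[of a] that by (simp add: m)
    then have "front_schubert l Y = front_schubert m Y * X l ^ (f l - 1)"
      using front_schubert_append[OF front_m fl] Yl by (simp add: m fun_upd_idem)
    then have "X (Suc l) ^ (f l - 1) * front_schubert l Y
        = front_schubert m Y * (X l * X (Suc l)) ^ (f l - 1)"
      by (simp add: power_mult_distrib mult_ac)
    moreover have "divided_diff l (front_schubert m Y) = 0"
      using front_m by (rule divided_diff_front_schubert_beyond) (simp add: m)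
    moreover have "divided_diff l ((X l * X (Suc l)) ^ (f l - 1)) = 0"
      by (simp add: divided_diff_eq_0_iff swap_vars_power swap_vars_mult mult.commute)
    ultimately show ?thesis using False by (simp add: divided_diff_mult_symmetric)
  qed
qed

lemma bij_betw_pieri_targets_pass:
  assumes dec: "strict_antimono_on {1..Suc l} f" and l: "1 \<le> l"
  shows "bij_betw (\<lambda>Y. Y(l := f l, Suc l := Y l))
    {Y \<in> pieri_targets l f (m - int (f l - f (Suc l)) + 1). f l < Y l}
    {Y \<in> pieri_targets (Suc l) f m. f l < Y (Suc l)}" (is "bij_betw ?h ?A ?B")
proof (rule bij_betwI[where g = "\<lambda>Y. restrict (Y(l := Y (Suc l))) {1..l}"])
  let ?K = "Suc l" and ?g = "\<lambda>Y. restrict (Y(l := Y (Suc l))) {1..l}"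
  have ext: "Y \<in> extensional {1..l}" if "Y \<in> ?A" for Y
    using that by (auto dest: pieri_targets_extensional)
  then show restrict: "?g (?h Y) = Y" if "Y \<in> ?A" for Y
    using that by (intro extensionalityI[of _ "{1..l}"]) auto
  show "?h \<in> ?A \<rightarrow> ?B"
  proof
    fix Y assume Y: "Y \<in> ?A"
    have "?h Y \<in> extensional {1..?K}" using ext[OF Y] l by (auto simp: extensional_def)
    then show "?h Y \<in> ?B"
      using pieri_targets_append_pass[OF dec l, of "?h Y" m] restrict[OF Y] Y
      by (simp del: restrict_apply)
  qed
  have pass: "?g Z \<in> pieri_targets l f (m - int (f l - f ?K) + 1)" "Z l = f l"
      "Z \<in> extensional {1..?K}" if "Z \<in> ?B" for Z
    using that pieri_targets_append_pass[OF dec l, of Z m]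
    by (auto dest: pieri_targets_extensional)
  then show "?g \<in> ?B \<rightarrow> ?A" using l by auto
  show "?h (?g Z) = Z" if "Z \<in> ?B" for Z
    using pass[OF that] l by (intro extensionalityI[of _ "{1..?K}"]) (auto simp: extensional_def)
qed

lemma sum_pieri_targets_pass:
  assumes f: "front (Suc l) f" and dec: "strict_antimono_on {1..Suc l} f" and l: "1 \<le> l"
    and pieri: "\<And>n. front_schubert l f * hsym l n = (\<Sum>Y\<in>pieri_targets l f n. front_schubert l Y)"
  shows "(\<Sum>Y\<in>{Y \<in> pieri_targets (Suc l) f m. f l < Y (Suc l)}. front_schubert (Suc l) Y)
    = front_schubert l f * X (Suc l) ^ (f l - 1) * hsym (Suc l) (m - int (f l - f (Suc l)))"
proof -
  let ?K = "Suc l"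
  define n where "n = m - int (f l - f ?K) + 1"
  let ?P = "\<lambda>Y. X ?K ^ (f l - 1) * front_schubert l Y"
  have fl: "front l f" and dec_l: "strict_antimono_on {1..l} f"
    using f dec by (auto simp: front_def inj_on_def monotone_on_def)
  have "?P f = (\<Prod>a=1..?K. X a ^ (if a = ?K then f l - 1 else f a - 1))"
    by (simp add: front_schubert_decreasing[OF fl dec_l] mult.commute)
  also have "divided_diff l \<dots> = 0" using l by (intro divided_diff_monomial_symmetric) auto
  finally have "divided_diff l (?P f) = 0" .
  then have "divided_diff l (?P f * hsym l n) = ?P f * hsym ?K (n - 1)"
    by (simp only: divided_diff_mult_symmetric divided_diff_hsym_last[OF l])
  then have "front_schubert l f * X ?K ^ (f l - 1) * hsym ?K (m - int (f l - f ?K))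
      = divided_diff l (X ?K ^ (f l - 1) * (front_schubert l f * hsym l n))"
    by (simp add: n_def mult_ac)
  also have "\<dots> = (\<Sum>Y\<in>pieri_targets l f n. divided_diff l (?P Y))"
    by (simp only: pieri sum_distrib_left divided_diff_sum)
  also have "\<dots> = (\<Sum>Y\<in>pieri_targets l f n.
      if f l < Y l then front_schubert ?K (Y(l := f l, ?K := Y l)) else 0)"
    by (rule sum.cong[OF refl divided_diff_pieri_target_append[OF fl dec_l l]])
  also have "\<dots> = (\<Sum>Y\<in>{Y \<in> pieri_targets l f n. f l < Y l}.
      front_schubert ?K (Y(l := f l, ?K := Y l)))"
    by (simp add: sum.inter_filter finite_pieri_targets)
  also have "\<dots> = (\<Sum>Y\<in>{Y \<in> pieri_targets ?K f m. f l < Y ?K}. front_schubert ?K Y)"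
    unfolding n_def by (rule sum.reindex_bij_betw[OF bij_betw_pieri_targets_pass[OF dec l]])
  finally show ?thesis ..
qed

lemma pieri_targets_1:
  assumes "Y \<in> pieri_targets 1 f m"
  shows "int (Y 1 - f 1) = m"
proof -
  have "{f 1<..Y 1} - f ` {1..1} = {f 1<..Y 1}" by auto
  then have "hops {1..1} f Y = Y 1 - f 1" by (simp add: hops_def)
  then show ?thesis using assms by (simp add: pieri_targets_def)
qed

lemma sum_pieri_targets_not_below:
  fixes f :: "nat \<Rightarrow> nat" and m :: int and l :: nat
  defines "d \<equiv> (if l = 0 then nat m + 1 else f l - f (Suc l))"
  assumes f: "front (Suc l) f" and dec: "strict_antimono_on {1..Suc l} f"
    and pieri: "\<And>n. front_schubert l f * hsym l n = (\<Sum>Y\<in>pieri_targets l f n. front_schubert l Y)"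
  shows "(\<Sum>Y\<in>{Y \<in> pieri_targets (Suc l) f m. \<not> Y (Suc l) < f (Suc l) + d}. front_schubert (Suc l) Y)
    = front_schubert l f * X (Suc l) ^ (f (Suc l) - 1 + d) * hsym (Suc l) (m - int d)"
proof (cases "l = 0")
  case True
  then have K: "Suc l = 1" by (simp add: One_nat_def)
  have "Y 1 < f 1 + d" if "Y \<in> pieri_targets 1 f m" for Y
    using pieri_targets_1[OF that] True by (simp add: d_def)
  then have "{Y \<in> pieri_targets (Suc l) f m. \<not> Y (Suc l) < f (Suc l) + d} = {}"
    unfolding K by blast
  moreover have "m - int d < 0" using True by (simp add: d_def)
  ultimately show ?thesis by (simp only: sum.empty hsym_neg mult_zero_right)
next
  case False
  then have less: "f (Suc l) < f l" using monotone_onD[OF dec, of l "Suc l"] by simp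
  have "1 \<le> f (Suc l)" using front_pos[OF f, of "Suc l"] by simp
  then have d: "f (Suc l) + d = f l" "f l - f (Suc l) = d" "f l - 1 = f (Suc l) - 1 + d"
    using False less by (simp_all add: d_def)
  have "Y (Suc l) \<noteq> f l" if "Y \<in> pieri_targets (Suc l) f m" for Y
    using that pieri_stepD[of "{1..Suc l}" f Y "Suc l" l] less False
    by (auto simp: pieri_targets_def)
  then have "{Y \<in> pieri_targets (Suc l) f m. \<not> Y (Suc l) < f (Suc l) + d}
      = {Y \<in> pieri_targets (Suc l) f m. f l < Y (Suc l)}"
    unfolding d(1) by (intro Collect_cong) (metis less_asym linorder_neqE_nat)
  then show ?thesis
    using sum_pieri_targets_pass[OF f dec _ pieri, of m] False by (simp add: d)
qed

lemma pieri_decreasing: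
  assumes "front k f" "strict_antimono_on {1..k} f"
  shows "front_schubert k f * hsym k m = (\<Sum>Y\<in>pieri_targets k f m. front_schubert k Y)"
  using assms
proof (induction k arbitrary: m)
  case 0
  have "pieri_targets 0 f m = (if m = 0 then {\<lambda>_. undefined} else {})"
    by (auto simp: pieri_targets_def pieri_step_def hops_def)
  moreover have "perm_of_front 0 f = perm_of_front 0 (\<lambda>_. undefined)"
    by (rule perm_of_front_cong) simp
  ultimately show ?case by (simp add: hsym_no_vars)
next
  case (Suc l)
  let ?K = "Suc l"
  have f: "front l f" and dec: "strict_antimono_on {1..l} f"
    using Suc.prems by (auto simp: front_def inj_on_def monotone_on_def)
  have fK: "1 \<le> f ?K" using front_pos[OF Suc.prems(1), of ?K] by simp
  have less: "f ?K < f a" if "a \<in> {1..l}" for a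
    using monotone_onD[OF Suc.prems(2), of a ?K] that by simp
  define c d where "c = f ?K - 1" and "d = (if l = 0 then nat m + 1 else f l - f ?K)"
  have d: "f ?K + d \<le> f a" if "a \<in> {1..l}" for a
    using monotone_onD[OF dec, of a l] less[of l] that by (cases "a = l") (auto simp: d_def)
  let ?below = "{Y \<in> pieri_targets ?K f m. Y ?K < f ?K + d}"
    and ?rest = "{Y \<in> pieri_targets ?K f m. \<not> Y ?K < f ?K + d}"
  have "front_schubert ?K f = front_schubert l f * X ?K ^ c"
    using front_schubert_append[OF f fK less] by (simp add: c_def fun_upd_triv)
  then have "front_schubert ?K f * hsym ?K m = front_schubert l f * X ?K ^ c *
      ((\<Sum>j<d. X ?K ^ j * hsym l (m - int j)) + X ?K ^ d * hsym ?K (m - int d))"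
    by (simp only: hsym_Suc_iterate[of l m d])
  also have "\<dots> = (\<Sum>j<d. front_schubert l f * hsym l (m - int j) * X ?K ^ (c + j))
      + front_schubert l f * X ?K ^ (c + d) * hsym ?K (m - int d)"
    by (simp add: distrib_left sum_distrib_left power_add mult_ac)
  also have "\<dots> = (\<Sum>Y\<in>?below. front_schubert ?K Y) + (\<Sum>Y\<in>?rest. front_schubert ?K Y)"
    using sum_pieri_targets_below[OF Suc.prems(1) d Suc.IH[OF f dec], of m]
      sum_pieri_targets_not_below[OF Suc.prems Suc.IH[OF f dec], of m]
    by (simp only: c_def d_def)
  also have "\<dots> = (\<Sum>Y\<in>?below \<union> ?rest. front_schubert ?K Y)"
    by (rule sum.union_disjoint[symmetric]) (auto simp: finite_pieri_targets)
  also have "?below \<union> ?rest = pieri_targets ?K f m" by blast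
  finally show ?case .
qed

subsection \<open>Arbitrary fronts\<close>

lemma pieri_step_comp_adj_transp:
  assumes i: "1 \<le> i" "i < k" and desc: "V (Suc i) < V i"
  shows "pieri_step {1..k} (V \<circ> adj_transp i) (Y \<circ> adj_transp i)
    \<longleftrightarrow> pieri_step {1..k} V Y \<and> Y (Suc i) < Y i"
proof -
  let ?s = "adj_transp i" and ?A = "{1..k}"
  define Q where
    "Q a e \<longleftrightarrow> (V a < V e \<longrightarrow> Y a < V e \<or> (?s e < ?s a \<and> Y e = V e \<and> V e < Y a))" for a e
  have reindex: "(\<forall>a\<in>?A. P (?s a)) \<longleftrightarrow> (\<forall>a\<in>?A. P a)" for P
    using adj_transp_image_front[OF i] by (metis image_iff)
  have order: "?s e < ?s a \<longleftrightarrow> e < a" if "V a < V e" "\<not> (a = Suc i \<and> e = i)" for a e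
    using that desc by (auto simp: transpose_def)
  have mem: "i \<in> ?A" "Suc i \<in> ?A" using i by auto
  have "pieri_step ?A (V \<circ> ?s) (Y \<circ> ?s)
      \<longleftrightarrow> (\<forall>a\<in>?A. V (?s a) \<le> Y (?s a)) \<and> (\<forall>a\<in>?A. \<forall>e\<in>?A. Q (?s a) (?s e))"
    by (simp add: pieri_step_def Q_def)
  also have "\<dots> \<longleftrightarrow> (\<forall>a\<in>?A. V a \<le> Y a) \<and> (\<forall>a\<in>?A. \<forall>e\<in>?A. Q a e)"
    by (simp only: reindex[of "\<lambda>a. V a \<le> Y a"] reindex[of "Q _"] reindex[of "\<lambda>a. \<forall>e\<in>?A. Q a e"])
  also have "\<dots> \<longleftrightarrow> pieri_step ?A V Y \<and> Y (Suc i) < Y i"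
  proof
    assume swapped: "(\<forall>a\<in>?A. V a \<le> Y a) \<and> (\<forall>a\<in>?A. \<forall>e\<in>?A. Q a e)"
    then have "Q (Suc i) i" "V i \<le> Y i" using mem by blast+
    then have "Y (Suc i) < V i" "Y (Suc i) < Y i" using desc by (simp_all add: Q_def)
    then show "pieri_step ?A V Y \<and> Y (Suc i) < Y i"
      using swapped order unfolding pieri_step_def Q_def by blast
  next
    assume step: "pieri_step ?A V Y \<and> Y (Suc i) < Y i"
    then have "Y (Suc i) < V i"
      using pieri_stepD[of ?A V Y "Suc i" i] mem desc by auto
    then show "(\<forall>a\<in>?A. V a \<le> Y a) \<and> (\<forall>a\<in>?A. \<forall>e\<in>?A. Q a e)"
      using step order unfolding pieri_step_def Q_def by blast
  qed
  finally show ?thesis .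
qed

lemma hops_comp_adj_transp:
  assumes "1 \<le> i" "i < k"
  shows "hops {1..k} (V \<circ> adj_transp i) (Y \<circ> adj_transp i) = hops {1..k} V Y"
proof -
  have "(\<Sum>a\<in>{1..k}. card ({V (adj_transp i a)<..Y (adj_transp i a)} - V ` {1..k}))
      = (\<Sum>a\<in>{1..k}. card ({V a<..Y a} - V ` {1..k}))"
    by (rule sum.reindex_bij_witness[where i = "adj_transp i" and j = "adj_transp i"])
       (use adj_transp_in_front[OF assms] in simp_all)
  then show ?thesis
    unfolding hops_def comp_adj_transp_image_front[OF assms] by simp
qed

lemma pieri_targets_comp_adj_transp:
  assumes i: "1 \<le> i" "i < k" and desc: "V (Suc i) < V i"
  shows "Y \<circ> adj_transp i \<in> pieri_targets k (V \<circ> adj_transp i) m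
    \<longleftrightarrow> Y \<in> pieri_targets k V m \<and> Y (Suc i) < Y i"
proof -
  have "Y \<circ> adj_transp i \<in> extensional {1..k} \<longleftrightarrow> Y \<in> extensional {1..k}"
    using adj_transp_in_front[OF i] unfolding extensional_def
    by (simp add: o_apply) (metis transpose_involutory)
  then show ?thesis
    using pieri_step_comp_adj_transp[OF i desc] hops_comp_adj_transp[OF i]
    by (auto simp: pieri_targets_def)
qed

theorem pieri:
  assumes "w \<in> increasing_after k"
  shows "schubert w * hsym k m = (\<Sum>Y\<in>pieri_targets k w m. front_schubert k Y)"
  using assms
proof (induction rule: increasing_after_sort_induct)
  case (decreasing w)
  then show ?case
    using pieri_decreasing[OF increasing_after_front, of w k k m] by (simp add: perm_of_front_self)
next
  case (ascent w i)
  let ?w = "w \<circ> adj_transp i"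
  have desc: "?w (Suc i) < ?w i" using ascent.hyps by simp
  have front: "front k ?w"
    using ascent.hyps by (intro increasing_after_front increasing_after_comp_adj_transp)
  have targets: "Y \<circ> adj_transp i \<in> pieri_targets k w m
      \<longleftrightarrow> Y \<in> pieri_targets k ?w m \<and> Y (Suc i) < Y i" for Y
    using pieri_targets_comp_adj_transp[OF ascent.hyps(2,3) desc, of Y m] by (simp del: o_apply)
  have "schubert w * hsym k m = divided_diff i (schubert ?w * hsym k m)"
    using ascent.hyps
    by (simp only: divided_diff_mult_symmetric divided_diff_hsym_symmetric
        schubert_ascent[OF increasing_after_finitary])
  also have "\<dots> = divided_diff i (\<Sum>Y\<in>pieri_targets k ?w m. front_schubert k Y)"
    by (simp only: ascent.IH)
  also have "\<dots> = (\<Sum>Y\<in>{Y \<in> pieri_targets k ?w m. Y (Suc i) < Y i}.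
      front_schubert k (Y \<circ> adj_transp i))"
    using ascent.hyps pieri_targets_front[OF _ front]
    by (simp add: divided_diff_sum divided_diff_front_schubert sum.inter_filter
        finite_pieri_targets del: o_apply)
  also have "\<dots> = (\<Sum>Y\<in>pieri_targets k w m. front_schubert k Y)"
  proof (rule sum.reindex_bij_witness[where i = "\<lambda>Y. Y \<circ> adj_transp i"
        and j = "\<lambda>Y. Y \<circ> adj_transp i"])
    fix Y assume "Y \<in> pieri_targets k w m"
    then show "Y \<circ> adj_transp i \<in> {Y \<in> pieri_targets k ?w m. Y (Suc i) < Y i}"
      using targets[of "Y \<circ> adj_transp i"] by simp
  qed (use targets in auto)
  finally show ?case .
qed

lemma schubert_span_hsym:
  "f \<in> schubert_span (increasing_after k) \<Longrightarrow> f * hsym k m \<in> schubert_span (increasing_after k)"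
proof (erule schubert_span_mult)
  fix w assume w: "w \<in> increasing_after k"
  show "schubert w * hsym k m \<in> schubert_span (increasing_after k)"
    unfolding pieri[OF w]
    by (intro schubert_span_sum schubert_span.base perm_of_front)
       (rule pieri_targets_front[OF _ increasing_after_front[OF w]])
qed

theorem schubert_dual_pieri_twice:
  assumes w: "w \<in> increasing_after k" and u: "u \<in> increasing_after k"
  shows "schubert_dual u (schubert w * hsym k p * hsym k q) = int (card {Y \<in> extensional {1..k}.
    pieri_step {1..k} w Y \<and> pieri_step {1..k} Y u \<and>
    int (hops {1..k} w Y) = p \<and> int (hops {1..k} Y u) = q})"
proof -
  let ?u = "restrict u {1..k}"
  have "schubert_dual u (front_schubert k Y * hsym k q)
      = (if ?u \<in> pieri_targets k Y q then 1 else 0)"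
    if Y: "Y \<in> pieri_targets k w p" for Y
  proof -
    have front_Y: "front k Y" using Y increasing_after_front[OF w] by (rule pieri_targets_front)
    have "schubert_dual u (front_schubert k Z) = (if Z = ?u then 1 else 0)"
      if Z: "Z \<in> pieri_targets k Y q" for Z
    proof -
      note front_Z = pieri_targets_front[OF Z front_Y]
      have "perm_of_front k Z = u \<longleftrightarrow> Z = ?u"
      proof
        assume "perm_of_front k Z = u"
        then show "Z = ?u"
          using perm_of_front_apply[OF front_Z] pieri_targets_extensional[OF Z]
          by (intro extensionalityI[of _ "{1..k}"]) auto
      qed (use u in \<open>auto intro: perm_of_front_eqI\<close>)
      then show ?thesis by (simp add: schubert_dual_schubert perm_of_front_finitary[OF front_Z])
    qed
    moreover have "pieri_targets k (perm_of_front k Y) q = pieri_targets k Y q"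
      by (rule pieri_targets_cong) (rule perm_of_front_apply[OF front_Y])
    ultimately show ?thesis
      by (simp add: pieri[OF perm_of_front[OF front_Y]] schubert_dual.sum finite_pieri_targets)
  qed
  then have "schubert_dual u (schubert w * hsym k p * hsym k q)
      = (\<Sum>Y\<in>pieri_targets k w p. if ?u \<in> pieri_targets k Y q then 1 else 0)"
    by (simp add: pieri[OF w] sum_distrib_right schubert_dual.sum)
  also have "\<dots> = int (card {Y \<in> pieri_targets k w p. ?u \<in> pieri_targets k Y q})"
    by (simp add: finite_pieri_targets flip: sum.inter_filter)
  also have "{Y \<in> pieri_targets k w p. ?u \<in> pieri_targets k Y q} = {Y \<in> extensional {1..k}.
      pieri_step {1..k} w Y \<and> pieri_step {1..k} Y u \<and>
      int (hops {1..k} w Y) = p \<and> int (hops {1..k} Y u) = q}"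
    unfolding pieri_targets_restrict by (auto simp: pieri_targets_def)
  finally show ?thesis .
qed

section \<open>Monk's rule for a maximum of the remaining front\<close>

definition next_free :: "nat \<Rightarrow> (nat \<Rightarrow> nat) \<Rightarrow> nat \<Rightarrow> nat" where
  "next_free k w r = (LEAST z. w r < z \<and> z \<notin> w ` {1..k})"

definition hop_at :: "nat \<Rightarrow> (nat \<Rightarrow> nat) \<Rightarrow> nat \<Rightarrow> nat \<Rightarrow> nat" where
  "hop_at k w r = perm_of_front k (w(r := next_free k w r))"

definition monk_covers :: "(nat \<Rightarrow> nat) \<Rightarrow> nat \<Rightarrow> nat set" where
  "monk_covers w r = {a \<in> {1..<r}. w a < w r \<and> w ` {a<..<r} \<inter> {w a<..<w r} = {}}"

lemma next_free:
  shows next_free_greater: "w r < next_free k w r"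
    and next_free_notin: "next_free k w r \<notin> w ` {1..k}"
    and below_next_free: "w r < z \<Longrightarrow> z < next_free k w r \<Longrightarrow> z \<in> w ` {1..k}"
proof -
  have "infinite ({w r<..} - w ` {1..k})"
    by (rule Diff_infinite_finite) (auto simp: infinite_Ioi)
  then have "\<exists>z. w r < z \<and> z \<notin> w ` {1..k}"
    by (metis Diff_iff finite.emptyI greaterThan_iff ex_in_conv)
  from LeastI_ex[OF this] show "w r < next_free k w r" "next_free k w r \<notin> w ` {1..k}"
    by (auto simp: next_free_def)
  show "w r < z \<Longrightarrow> z < next_free k w r \<Longrightarrow> z \<in> w ` {1..k}"
    unfolding next_free_def using not_less_Least by blast
qed

lemma front_hop:
  assumes "front k w"
  shows "front k (w(r := next_free k w r))"
  using next_free_greater[of w r k] next_free_notin[of k w r] by (intro front_upd assms) auto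

lemma hop_at_increasing_after: "w \<in> increasing_after k \<Longrightarrow> hop_at k w r \<in> increasing_after k"
  unfolding hop_at_def by (intro perm_of_front front_hop increasing_after_front)

lemma hop_at_apply:
  "w \<in> increasing_after k \<Longrightarrow> a \<in> {1..k} \<Longrightarrow> hop_at k w r a = (w(r := next_free k w r)) a"
  unfolding hop_at_def by (intro perm_of_front_apply front_hop increasing_after_front)

lemma monk_covers_less: "a \<in> monk_covers w r \<Longrightarrow> 1 \<le> a \<and> a < r"
  by (simp add: monk_covers_def)

lemma finite_monk_covers: "finite (monk_covers w r)"
  by (simp add: monk_covers_def)

subsection \<open>Decreasing fronts\<close>

lemma lehmer_code_hop_at:
  assumes w: "w \<in> increasing_after k" and dec: "strict_antimono_on {1..k} w"
    and r: "r \<in> {1..k}" and a: "a \<in> {1..k}"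
  shows "lehmer_code (hop_at k w r) a = (if a = r then w r else w a - 1)"
proof -
  let ?z = "next_free k w r"
  define v where "v = hop_at k w r"
  have v: "v b = (w(r := ?z)) b" if "b \<in> {1..k}" for b
    unfolding v_def by (rule hop_at_apply[OF w that])
  have less: "w y < w x" if "x \<in> {1..k}" "y \<in> {1..k}" "x < y" for x y
    using monotone_onD[OF dec that] .
  have code: "lehmer_code v a + card {b \<in> {1..<a}. v b < v a} = v a - 1"
    using a hop_at_increasing_after[OF w]
    by (intro lehmer_code_add_earlier_smaller increasing_after_finitary) (simp_all add: v_def)
  show ?thesis
  proof (cases "a = r")
    case True
    have "w ` {b \<in> {1..<r}. v b < v r} = {w r<..<?z}"
    proof (intro equalityI subsetI)
      fix y assume "y \<in> {w r<..<?z}"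
      then obtain b where b: "b \<in> {1..k}" "y = w b" "w r < w b" "w b < ?z"
        using below_next_free[of w r y k] by auto
      then have "b < r" using less[of r b] r by (metis less_asym linorder_neqE_nat)
      then show "y \<in> w ` {b \<in> {1..<r}. v b < v r}" using b r by (auto simp: v)
    qed (use r less in \<open>auto simp: v\<close>)
    then have "card {b \<in> {1..<r}. v b < v r} = ?z - w r - 1"
      using card_image[OF increasing_after_inj_on[OF w], of "{b \<in> {1..<r}. v b < v r}"] by simp
    then show ?thesis
      using code True r next_free_greater[of w r k] by (simp add: v flip: v_def)
  next
    case False
    have "\<not> v b < v a" if "b \<in> {1..<a}" for b
      using that a False less[of b a] next_free_greater[of w r k] by (auto simp: v)
    then have "{b \<in> {1..<a}. v b < v a} = {}" by blast
    then have "lehmer_code v a = v a - 1" using code by (simp only: card.empty)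
    then show ?thesis using False a by (simp add: v flip: v_def)
  qed
qed

lemma monk_decreasing:
  assumes w: "w \<in> increasing_after k" and dec: "strict_antimono_on {1..k} w" and r: "r \<in> {1..k}"
  shows "X r * schubert w = schubert (hop_at k w r)"
proof -
  note v = hop_at_increasing_after[OF w, of r] and code = lehmer_code_hop_at[OF w dec r]
  have pos: "1 \<le> w r" using front_pos[OF increasing_after_front[OF w] r] .
  have "dominant (hop_at k w r)"
  proof (rule dominant_increasing_afterI[OF v])
    fix i assume i: "1 \<le> i" "i < k"
    then have "w (Suc i) < w i" using monotone_onD[OF dec, of i "Suc i"] by simp
    then show "lehmer_code (hop_at k w r) (Suc i) \<le> lehmer_code (hop_at k w r) i"
      using i by (auto simp: code)
  qed
  then have "schubert (hop_at k w r) = (\<Prod>a=1..k. X a ^ lehmer_code (hop_at k w r) a)"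
    by (rule schubert_dominant[OF v])
  also have "\<dots> = (\<Prod>a=1..k. X a ^ (if a = r then Suc (w a - 1) else w a - 1))"
    using pos by (intro prod.cong) (auto simp: code)
  also have "\<dots> = X r * (\<Prod>a=1..k. X a ^ (w a - 1))"
    using r by (simp add: prod.remove[of "{1..k}" r] mult.assoc)
  finally show ?thesis by (simp add: schubert_decreasing_front[OF w dec])
qed

subsection \<open>Arbitrary fronts\<close>

lemma divided_diff_hop_at:
  assumes v: "front k v" and i: "1 \<le> i" "i < k" and desc: "v (Suc i) < v i" and "r \<noteq> Suc i"
  shows "divided_diff i (schubert (hop_at k v r))
    = schubert (hop_at k (v \<circ> adj_transp i) (adj_transp i r))"
proof -
  let ?z = "next_free k v r"
  have "next_free k (v \<circ> adj_transp i) (adj_transp i r) = ?z"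
    unfolding next_free_def comp_adj_transp_image_front[OF i] by simp
  moreover have "v(r := ?z) \<circ> adj_transp i = (v \<circ> adj_transp i)(adj_transp i r := ?z)"
    by (auto simp: fun_eq_iff transpose_def)
  moreover have "(v(r := ?z)) (Suc i) < (v(r := ?z)) i"
    using desc assms(5) next_free_greater[of v r k] by auto
  ultimately show ?thesis
    unfolding hop_at_def
    by (simp add: divided_diff_front_schubert[OF front_hop[OF v] i] del: o_apply)
qed

lemma comp_transpose_comp_adj_transp:
  "v \<circ> transpose a r \<circ> adj_transp i
    = v \<circ> adj_transp i \<circ> transpose (adj_transp i a) (adj_transp i r)"
  by (rule ext) (auto simp: transpose_def)

definition monk_descent_covers :: "(nat \<Rightarrow> nat) \<Rightarrow> nat \<Rightarrow> nat \<Rightarrow> nat set" where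
  "monk_descent_covers v r i
    = {a \<in> monk_covers v r. (v \<circ> transpose a r) (Suc i) < (v \<circ> transpose a r) i}"

lemma divided_diff_sum_monk_covers:
  assumes "v \<in> finitary_perms" "1 \<le> i" "1 \<le> r"
  shows "divided_diff i (\<Sum>a\<in>monk_covers v r. schubert (v \<circ> transpose a r))
    = (\<Sum>a\<in>monk_descent_covers v r i.
        schubert (v \<circ> adj_transp i \<circ> transpose (adj_transp i a) (adj_transp i r)))"
proof -
  have "v \<circ> transpose a r \<in> finitary_perms" if "a \<in> monk_covers v r" for a
    using assms monk_covers_less[OF that] by (intro finitary_perms_comp_transpose) auto
  then have "divided_diff i (\<Sum>a\<in>monk_covers v r. schubert (v \<circ> transpose a r))
      = (\<Sum>a\<in>monk_covers v r. if (v \<circ> transpose a r) (Suc i) < (v \<circ> transpose a r) i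
          then schubert (v \<circ> transpose a r \<circ> adj_transp i) else 0)"
    unfolding divided_diff_sum by (intro sum.cong refl divided_diff_schubert assms(2))
  then show ?thesis
    by (simp only: monk_descent_covers_def sum.inter_filter[OF finite_monk_covers]
        comp_transpose_comp_adj_transp)
qed

lemma monk_covers_ascent_before:
  assumes w: "inj w" and i: "1 \<le> i" "Suc i < r" and asc: "w i < w (Suc i)"
  defines "v \<equiv> w \<circ> adj_transp i"
  shows "adj_transp i a \<in> monk_covers w r \<longleftrightarrow>
    a \<in> monk_covers v r \<and> (v \<circ> transpose a r) (Suc i) < (v \<circ> transpose a r) i"
proof -
  have vr: "v r = w r" using i by (simp add: v_def transpose_def)
  have image: "v ` {b<..<r} = w ` {b<..<r}" if "b \<noteq> i" for b
    unfolding v_def image_comp[symmetric] using that i by (subst transpose_image_eq) auto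
  have split: "{i<..<r} = insert (Suc i) {Suc i<..<r}" using i by auto
  have neq: "w (Suc i) \<noteq> w r" using inj_eq[OF w] i by simp
  consider (left) "a = i" | (right) "a = Suc i" | (other) "a \<noteq> i" "a \<noteq> Suc i" by blast
  then show ?thesis
  proof cases
    case left
    have "v ` {i<..<r} = insert (w i) (w ` {Suc i<..<r})"
      using image[of "Suc i"] by (simp add: split v_def)
    then show ?thesis
      using left i asc vr by (auto simp: monk_covers_def v_def transpose_def)
  next
    case right
    have "w ` {i<..<r} = insert (w (Suc i)) (w ` {Suc i<..<r})" by (simp add: split)
    then show ?thesis
      using right i asc vr neq image[of "Suc i"] by (auto simp: monk_covers_def v_def transpose_def)
  next
    case other
    then show ?thesis
      using i asc vr image[of a] by (auto simp: monk_covers_def v_def transpose_def)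
  qed
qed

lemma monk_covers_ascent_at:
  assumes w: "inj w" and i: "1 \<le> i" and asc: "w i < w (Suc i)"
  shows "monk_covers w (Suc i) = insert i (monk_descent_covers (w \<circ> adj_transp i) i i)"
proof -
  let ?v = "w \<circ> adj_transp i"
  have "a \<in> monk_covers w (Suc i) \<longleftrightarrow> a \<in> monk_covers ?v i \<and> w i < w a" if "a < i" for a
  proof -
    have "{a<..<Suc i} = insert i {a<..<i}" using that by auto
    moreover have "?v ` {a<..<i} = w ` {a<..<i}" by (intro image_cong) auto
    moreover have "w a \<noteq> w i" using inj_eq[OF w] that by simp
    ultimately show ?thesis using that asc by (auto simp: monk_covers_def)
  qed
  moreover have "i \<in> monk_covers w (Suc i)"
    using i asc by (auto simp: monk_covers_def)
  moreover have "(?v \<circ> transpose a i) (Suc i) < (?v \<circ> transpose a i) i \<longleftrightarrow> w i < w a" if "a < i" for a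
    using that by simp
  ultimately show ?thesis
    using monk_covers_less[of _ w "Suc i"] monk_covers_less[of _ ?v i]
    by (auto simp: monk_descent_covers_def less_Suc_eq simp del: o_apply)
qed

lemma monk_covers_cong: "(\<And>a. a \<le> r \<Longrightarrow> v a = w a) \<Longrightarrow> monk_covers v r = monk_covers w r"
proof -
  assume eq: "\<And>a. a \<le> r \<Longrightarrow> v a = w a"
  then have "v ` {a<..<r} = w ` {a<..<r}" for a by (intro image_cong) auto
  then show ?thesis using eq by (auto simp: monk_covers_def)
qed

lemma monk_covers_ascent_after:
  assumes asc: "w i < w (Suc i)" and "r < i"
  shows "monk_descent_covers (w \<circ> adj_transp i) r i = monk_covers w r"
proof -
  let ?v = "w \<circ> adj_transp i"
  have "(?v \<circ> transpose a r) (Suc i) < (?v \<circ> transpose a r) i" if "a < r" for a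
    using that assms by (simp add: transpose_def)
  moreover have "monk_covers ?v r = monk_covers w r"
    using assms(2) by (intro monk_covers_cong) simp
  ultimately show ?thesis
    using monk_covers_less[of _ w r] by (auto simp: monk_descent_covers_def simp del: o_apply)
qed

lemma sum_monk_covers_ascent:
  assumes w: "inj w" and i: "1 \<le> i" and asc: "w i < w (Suc i)" and "r \<noteq> i" "r \<noteq> Suc i"
  shows "(\<Sum>a\<in>monk_descent_covers (w \<circ> adj_transp i) r i. f (adj_transp i a))
    = sum f (monk_covers w r)"
proof (cases "Suc i < r")
  case True
  show ?thesis
    using monk_covers_ascent_before[OF w i True asc]
    by (intro sum.reindex_bij_witness[where i = "adj_transp i" and j = "adj_transp i"])
       (simp_all add: monk_descent_covers_def del: o_apply, metis transpose_involutory)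
next
  case False
  then have "r < i" using assms(4,5) by simp
  then show ?thesis
    unfolding monk_covers_ascent_after[OF asc \<open>r < i\<close>]
    by (intro sum.cong) (auto dest: monk_covers_less)
qed

text \<open>
  When \<open>w r\<close> exceeds all later values of the front, Monk's rule has a single positive term.
\<close>

definition monk_rule :: "nat \<Rightarrow> (nat \<Rightarrow> nat) \<Rightarrow> nat \<Rightarrow> bool" where
  "monk_rule k w r \<longleftrightarrow> X r * schubert w
    = schubert (hop_at k w r) - (\<Sum>a\<in>monk_covers w r. schubert (w \<circ> transpose a r))"

lemma divided_diff_monk_rule:
  assumes v: "v \<in> increasing_after k" and i: "1 \<le> i" "i < k" and desc: "v (Suc i) < v i"
    and r: "r \<in> {1..k}" "r \<noteq> Suc i" and monk: "monk_rule k v r"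
  shows "divided_diff i (X r * schubert v)
    = schubert (hop_at k (v \<circ> adj_transp i) (adj_transp i r))
      - (\<Sum>a\<in>monk_descent_covers v r i.
          schubert (v \<circ> adj_transp i \<circ> transpose (adj_transp i a) (adj_transp i r)))"
  using r(1) divided_diff_hop_at[OF increasing_after_front[OF v] i desc r(2)]
    divided_diff_sum_monk_covers[OF increasing_after_finitary[OF v] i(1), of r]
  by (simp add: monk[unfolded monk_rule_def] divided_diff_diff del: o_apply)

lemma monk_rule_ascent_at:
  assumes w: "w \<in> increasing_after k" and i: "1 \<le> i" "i < k" and asc: "w i < w (Suc i)"
    and monk: "monk_rule k (w \<circ> adj_transp i) i"
  shows "monk_rule k w (Suc i)"
proof -
  let ?v = "w \<circ> adj_transp i"
  have v: "?v \<in> increasing_after k" by (intro increasing_after_comp_adj_transp w i)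
  have "divided_diff i (X i * schubert ?v) = schubert (hop_at k w (Suc i))
      - (\<Sum>a\<in>monk_descent_covers ?v i i. schubert (w \<circ> transpose (adj_transp i a) (Suc i)))"
    using divided_diff_monk_rule[OF v i _ _ _ monk] i asc by (simp del: o_apply) simp
  moreover have "(\<Sum>a\<in>monk_descent_covers ?v i i. schubert (w \<circ> transpose (adj_transp i a) (Suc i)))
      = (\<Sum>a\<in>monk_descent_covers ?v i i. schubert (w \<circ> transpose a (Suc i)))"
    by (intro sum.cong) (auto simp: monk_descent_covers_def dest: monk_covers_less)
  moreover have "i \<notin> monk_descent_covers ?v i i" "finite (monk_descent_covers ?v i i)"
    using monk_covers_less[of i ?v i] by (auto simp: monk_descent_covers_def finite_monk_covers)
  then have "(\<Sum>a\<in>monk_covers w (Suc i). schubert (w \<circ> transpose a (Suc i)))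
      = schubert ?v + (\<Sum>a\<in>monk_descent_covers ?v i i. schubert (w \<circ> transpose a (Suc i)))"
    by (simp add: monk_covers_ascent_at[OF increasing_after_inj[OF w] i(1) asc] del: o_apply)
  moreover have "divided_diff i (X i * schubert ?v) = schubert ?v + X (Suc i) * schubert w"
    using schubert_ascent[OF increasing_after_finitary[OF w] i(1) asc]
    by (simp add: divided_diff_mult divided_diff_X)
  ultimately show ?thesis by (simp add: monk_rule_def algebra_simps del: o_apply)
qed

lemma monk_rule_ascent:
  assumes w: "w \<in> increasing_after k" and i: "1 \<le> i" "i < k" and asc: "w i < w (Suc i)"
    and r: "r \<in> {1..k}" "r \<noteq> i" "r \<noteq> Suc i" and monk: "monk_rule k (w \<circ> adj_transp i) r"
  shows "monk_rule k w r"
proof -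
  let ?v = "w \<circ> adj_transp i"
  have v: "?v \<in> increasing_after k" by (intro increasing_after_comp_adj_transp w i)
  have "divided_diff i (X r * schubert ?v) = schubert (hop_at k w r)
      - (\<Sum>a\<in>monk_covers w r. schubert (w \<circ> transpose a r))"
    using divided_diff_monk_rule[OF v i _ r(1,3) monk] r asc
      sum_monk_covers_ascent[OF increasing_after_inj[OF w] i(1) asc r(2,3),
        of "\<lambda>a. schubert (w \<circ> transpose a r)"]
    by (simp del: o_apply) simp
  moreover have "divided_diff i (X r * schubert ?v) = X r * schubert w"
    using schubert_ascent[OF increasing_after_finitary[OF w] i(1) asc] r
    by (simp add: divided_diff_mult divided_diff_X)
  ultimately show ?thesis by (simp add: monk_rule_def del: o_apply)
qed

theorem monk:
  assumes "w \<in> increasing_after k" "r \<in> {1..k}" "\<And>b. b \<in> {r<..k} \<Longrightarrow> w b < w r"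
  shows "monk_rule k w r"
  using assms
proof (induction arbitrary: r rule: increasing_after_sort_induct)
  case (decreasing w)
  have "\<not> w a < w r" if "a \<in> {1..<r}" for a
    using monotone_onD[OF decreasing(2), of a r] that decreasing(3) by simp
  then have "monk_covers w r = {}" by (auto simp: monk_covers_def)
  then show ?case by (simp add: monk_rule_def monk_decreasing[OF decreasing(1-3)])
next
  case (ascent w i)
  have "i \<noteq> r" using ascent.prems(2)[of "Suc r"] ascent.hyps by auto
  show ?case
  proof (cases "r = Suc i")
    case True
    have "(w \<circ> adj_transp i) b < (w \<circ> adj_transp i) i" if "b \<in> {i<..k}" for b
      using ascent.prems(2)[of b] ascent.hyps(4) that True by (cases "b = Suc i") auto
    then have "monk_rule k (w \<circ> adj_transp i) i" using ascent.hyps by (intro ascent.IH) auto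
    then show ?thesis unfolding True by (rule monk_rule_ascent_at[OF ascent.hyps])
  next
    case False
    have "(w \<circ> adj_transp i) b < (w \<circ> adj_transp i) r" if "b \<in> {r<..k}" for b
      using ascent.prems(2)[of "adj_transp i b"] ascent.hyps(2,3) False \<open>i \<noteq> r\<close> that
      by (auto simp: transpose_def split: if_splits)
    then have "monk_rule k (w \<circ> adj_transp i) r" using ascent.prems(1) by (intro ascent.IH) auto
    then show ?thesis
      using False \<open>i \<noteq> r\<close> ascent.prems(1) by (intro monk_rule_ascent[OF ascent.hyps]) auto
  qed
qed

section \<open>Two-row Schur polynomials\<close>

definition jacobi_trudi2 :: "nat \<Rightarrow> nat \<Rightarrow> int \<Rightarrow> int \<Rightarrow> zpoly" where
  "jacobi_trudi2 k l p q = hsym k p * hsym l q - hsym k (p + 1) * hsym l (q - 1)"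

lemma jacobi_trudi2_Suc_first:
  "jacobi_trudi2 (Suc k) l p q
    = jacobi_trudi2 k l p q + X (Suc k) * jacobi_trudi2 (Suc k) l (p - 1) q"
  using hsym_Suc[of k p] hsym_Suc[of k "p + 1"]
  by (simp add: jacobi_trudi2_def) (simp add: algebra_simps)

lemma jacobi_trudi2_Suc_second:
  "jacobi_trudi2 k (Suc l) p q
    = jacobi_trudi2 k l p q + X (Suc l) * jacobi_trudi2 k (Suc l) p (q - 1)"
  by (simp add: jacobi_trudi2_def hsym_Suc[of l q] hsym_Suc[of l "q - 1"] algebra_simps)

lemma jacobi_trudi2_square: "jacobi_trudi2 (Suc k) (Suc k) p p = jacobi_trudi2 k (Suc k) p p"
proof -
  have peel: "hsym k n = hsym (Suc k) n - X (Suc k) * hsym (Suc k) (n - 1)" for n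
    by (simp add: hsym_Suc[of k n])
  show ?thesis by (simp add: jacobi_trudi2_def peel[of p] peel[of "p + 1"] ring_distribs)
qed

definition row_words :: "nat \<Rightarrow> nat \<Rightarrow> nat list set" where
  "row_words k m = {xs. sorted xs \<and> set xs \<subseteq> {1..k} \<and> length xs = m}"

definition row_pairs :: "nat \<Rightarrow> nat \<Rightarrow> nat \<Rightarrow> nat \<Rightarrow> (nat list \<times> nat list) set" where
  "row_pairs k l p q = {(xs, ys) \<in> row_words k p \<times> row_words l q. \<forall>c<q. xs ! c < ys ! c}"

definition row_weight :: "nat list \<Rightarrow> zpoly" where
  "row_weight xs = (\<Prod>x\<leftarrow>xs. X x)"

definition flagged_schur2 :: "nat \<Rightarrow> nat \<Rightarrow> nat \<Rightarrow> nat \<Rightarrow> zpoly" where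
  "flagged_schur2 k l p q = (\<Sum>(xs, ys)\<in>row_pairs k l p q. row_weight xs * row_weight ys)"

lemma row_words_length: "xs \<in> row_words k m \<Longrightarrow> length xs = m"
  by (simp add: row_words_def)

lemma row_words_nth: "xs \<in> row_words k m \<Longrightarrow> c < m \<Longrightarrow> xs ! c \<in> {1..k}"
  using nth_mem[of c xs] by (auto simp: row_words_def simp del: nth_mem)

lemma finite_row_pairs: "finite (row_pairs k l p q)"
proof (rule finite_subset)
  show "row_pairs k l p q \<subseteq> row_words k p \<times> row_words l q" by (auto simp: row_pairs_def)
  have "finite (row_words i m)" for i m
    by (rule finite_subset[OF _ finite_lists_length_eq[of "{1..i}" m]]) (auto simp: row_words_def)
  then show "finite (row_words k p \<times> row_words l q)" by simp
qed

lemma row_words_Suc: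
  "row_words (Suc k) (Suc m) = row_words k (Suc m) \<union> (\<lambda>xs. xs @ [Suc k]) ` row_words (Suc k) m"
proof (intro equalityI subsetI)
  fix xs assume xs: "xs \<in> row_words (Suc k) (Suc m)"
  then have "xs \<noteq> []" by (auto simp: row_words_def)
  then obtain ys y where "xs = ys @ [y]" by (metis append_butlast_last_id)
  then show "xs \<in> row_words k (Suc m) \<union> (\<lambda>xs. xs @ [Suc k]) ` row_words (Suc k) m"
    using xs by (cases "y = Suc k") (force simp: row_words_def sorted_append)+
qed (fastforce simp: row_words_def sorted_append)

lemma row_pairs_Suc_first:
  assumes "q \<le> p"
  shows "row_pairs (Suc k) l (Suc p) q
    = row_pairs k l (Suc p) q \<union> (\<lambda>(xs, ys). (xs @ [Suc k], ys)) ` row_pairs (Suc k) l p q"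
  using assms by (force simp: row_pairs_def row_words_Suc nth_append dest: row_words_length)

lemma row_pairs_Suc_second:
  assumes "k \<le> l" "q < p"
  shows "row_pairs k (Suc l) p (Suc q)
    = row_pairs k l p (Suc q) \<union> (\<lambda>(xs, ys). (xs, ys @ [Suc l])) ` row_pairs k (Suc l) p q"
  using assms row_words_nth[of _ k p q]
  by (force simp: row_pairs_def row_words_Suc nth_append less_Suc_eq dest: row_words_length)

lemma row_pairs_square:
  "row_pairs (Suc k) (Suc k) (Suc p) (Suc p) = row_pairs k (Suc k) (Suc p) (Suc p)"
proof (intro equalityI subsetI)
  fix z assume "z \<in> row_pairs (Suc k) (Suc k) (Suc p) (Suc p)"
  then obtain xs ys where z: "z = (xs, ys)" "xs \<in> row_words (Suc k) (Suc p)"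
      "ys \<in> row_words (Suc k) (Suc p)" "\<forall>c<Suc p. xs ! c < ys ! c"
    by (auto simp: row_pairs_def)
  then have "xs ! p < Suc k" using row_words_nth[OF z(3), of p] by fastforce
  then have "xs \<in> row_words k (Suc p)"
    using z(2) by (auto simp: row_words_Suc nth_append dest: row_words_length)
  then show "z \<in> row_pairs k (Suc k) (Suc p) (Suc p)" using z by (simp add: row_pairs_def)
qed (auto simp: row_pairs_def row_words_Suc)

lemma sum_Un_image:
  fixes g :: "'a \<Rightarrow> 'b :: semiring_0"
  assumes "finite A" "finite B" "A \<inter> h ` B = {}" "inj_on h B" "\<And>b. b \<in> B \<Longrightarrow> g (h b) = c * g b"
  shows "sum g (A \<union> h ` B) = sum g A + c * sum g B"
  using assms by (simp add: sum.union_disjoint sum.reindex sum_distrib_left)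

lemma flagged_schur2_Suc_first:
  assumes "q \<le> p"
  shows "flagged_schur2 (Suc k) l (Suc p) q
    = flagged_schur2 k l (Suc p) q + X (Suc k) * flagged_schur2 (Suc k) l p q"
  unfolding flagged_schur2_def row_pairs_Suc_first[OF assms]
  by (rule sum_Un_image[OF finite_row_pairs finite_row_pairs])
    (auto simp: inj_on_def row_weight_def row_pairs_def row_words_def mult_ac)

lemma flagged_schur2_Suc_second:
  assumes "k \<le> l" "q < p"
  shows "flagged_schur2 k (Suc l) p (Suc q)
    = flagged_schur2 k l p (Suc q) + X (Suc l) * flagged_schur2 k (Suc l) p q"
  unfolding flagged_schur2_def row_pairs_Suc_second[OF assms]
  by (rule sum_Un_image[OF finite_row_pairs finite_row_pairs])
    (auto simp: inj_on_def row_weight_def row_pairs_def row_words_def mult_ac)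

theorem flagged_schur2_jacobi_trudi:
  "k \<le> l \<Longrightarrow> q \<le> p \<Longrightarrow> flagged_schur2 k l p q = jacobi_trudi2 k l (int p) (int q)"
proof (induction "k + l + p + q" arbitrary: k l p q rule: less_induct)
  case less
  consider (empty) "p = 0" | (no_letters) "k = 0" "1 \<le> p"
    | (first) k' p' where "k = Suc k'" "p = Suc p'" "q \<le> p'"
    | (second) l' q' where "l = Suc l'" "k \<le> l'" "q = Suc q'" "q' < p"
    | (square) k' p' where "k = Suc k'" "l = Suc k'" "p = Suc p'" "q = Suc p'"
    using less.prems by (cases k; cases l; cases p; cases q; force simp: le_Suc_eq)
  then show ?case
  proof cases
    case empty
    then have "row_pairs k l p q = {([], [])}"
      using less.prems by (auto simp: row_pairs_def row_words_def)
    then show ?thesis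
      using empty less.prems by (simp add: flagged_schur2_def jacobi_trudi2_def row_weight_def)
  next
    case no_letters
    then have "row_pairs k l p q = {}" by (auto simp: row_pairs_def row_words_def)
    then show ?thesis
      using no_letters by (simp add: flagged_schur2_def jacobi_trudi2_def hsym_no_vars)
  next
    case first
    then show ?thesis
      using less.hyps[of k' l p q] less.hyps[of k l p' q] less.prems
      by (simp add: flagged_schur2_Suc_first jacobi_trudi2_Suc_first[of k' l "1 + int p'"])
  next
    case second
    then show ?thesis
      using less.hyps[of k l' p q] less.hyps[of k l p q'] less.prems
      by (simp add: flagged_schur2_Suc_second
          jacobi_trudi2_Suc_second[of k l' "int p" "1 + int q'"])
  next
    case square
    then show ?thesis
      using less.hyps[of k' l p q]
      by (simp add: flagged_schur2_def row_pairs_square jacobi_trudi2_square)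
  qed
qed

lemma young_diagram_two_rows_iff [simp]:
  "(r, c) \<in> young_diagram [p, q] \<longleftrightarrow> r = 0 \<and> c < p \<or> r = 1 \<and> c < q"
  by (auto simp: young_diagram_def less_Suc_eq One_nat_def)

lemma young_diagram_two_rows:
  "young_diagram [p, q] = (\<lambda>c. (0, c)) ` {..<p} \<union> (\<lambda>c. (1, c)) ` {..<q}"
  by auto

definition tableau_row :: "(nat \<times> nat \<Rightarrow> nat) \<Rightarrow> nat \<Rightarrow> nat \<Rightarrow> nat list" where
  "tableau_row T r m = map (\<lambda>c. T (r, c)) [0..<m]"

lemma tableau_row_in_row_words:
  "tableau_row T r m \<in> row_words k m \<longleftrightarrow>
    (\<forall>c<m. T (r, c) \<in> {1..k}) \<and> (\<forall>c c'. c < c' \<and> c' < m \<longrightarrow> T (r, c) \<le> T (r, c'))"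
  by (auto simp: row_words_def tableau_row_def sorted_iff_nth_mono_less image_subset_iff)

lemma ssyt_two_rows:
  assumes "q \<le> p"
  shows "T \<in> ssyt [p, q] k \<longleftrightarrow> T \<in> extensional (young_diagram [p, q]) \<and>
    (tableau_row T 0 p, tableau_row T 1 q) \<in> row_pairs k k p q"
proof -
  have "(\<forall>c<q. tableau_row T 0 p ! c < tableau_row T 1 q ! c) \<longleftrightarrow> (\<forall>c<q. T (0, c) < T (1, c))"
    using assms by (simp add: tableau_row_def)
  then show ?thesis
    using assms
    by (auto simp: ssyt_def PiE_iff row_pairs_def tableau_row_in_row_words)
qed

lemma tableau_weight_two_rows:
  assumes "T \<in> young_diagram [p, q] \<rightarrow>\<^sub>E {1..k}"
  shows "(\<Prod>i = 1..k. X i ^ card {b \<in> young_diagram [p, q]. T b = i})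
    = row_weight (tableau_row T 0 p) * row_weight (tableau_row T 1 q)"
proof -
  let ?D = "young_diagram [p, q]"
  have fin: "finite ?D" by (simp add: young_diagram_two_rows)
  have "(\<Prod>i = 1..k. X i ^ card {b \<in> ?D. T b = i}) = (\<Prod>i = 1..k. \<Prod>b\<in>{b \<in> ?D. T b = i}. X (T b))"
    by (intro prod.cong) auto
  also have "\<dots> = (\<Prod>b\<in>?D. X (T b))"
    using assms by (intro prod.group fin) auto
  also have "\<dots> = (\<Prod>b\<in>(\<lambda>c. (0, c)) ` {..<p}. X (T b)) * (\<Prod>b\<in>(\<lambda>c. (1, c)) ` {..<q}. X (T b))"
    unfolding young_diagram_two_rows by (intro prod.union_disjoint) auto
  also have "\<dots> = row_weight (tableau_row T 0 p) * row_weight (tableau_row T 1 q)"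
    by (simp add: prod.reindex inj_on_def row_weight_def tableau_row_def comp_def
        prod.list_conv_set_nth atLeast0LessThan)
  finally show ?thesis .
qed

lemma schur_two_rows:
  assumes "q \<le> p"
  shows "schur [p, q] k = jacobi_trudi2 k k (int p) (int q)"
proof -
  let ?D = "young_diagram [p, q]"
  let ?rows = "\<lambda>T. (tableau_row T 0 p, tableau_row T 1 q)"
  let ?filling = "\<lambda>(xs, ys). \<lambda>(r, c)\<in>?D. if r = 0 then xs ! c else ys ! c :: nat"
  have rows_filling: "?rows (?filling z) = z" if "z \<in> row_pairs k k p q" for z
    using that by (auto simp: tableau_row_def row_pairs_def row_words_def intro!: nth_equalityI)
  have filling_rows: "?filling (?rows T) = T" if "T \<in> extensional ?D" for T
    by (rule extensionalityI[OF _ that]) (auto simp: tableau_row_def)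
  have "schur [p, q] k = flagged_schur2 k k p q"
    unfolding schur_def flagged_schur2_def
  proof (rule sum.reindex_bij_witness[of _ ?filling ?rows])
    fix T assume T: "T \<in> ssyt [p, q] k"
    then show "?filling (?rows T) = T" "?rows T \<in> row_pairs k k p q"
      using filling_rows ssyt_two_rows[OF assms] by auto
    show "(case ?rows T of (xs, ys) \<Rightarrow> row_weight xs * row_weight ys)
        = (\<Prod>i = 1..k. X i ^ card {b \<in> ?D. T b = i})"
      using T by (simp add: ssyt_def tableau_weight_two_rows)
  next
    fix z assume z: "z \<in> row_pairs k k p q"
    then show "?rows (?filling z) = z" by (rule rows_filling)
    then show "?filling z \<in> ssyt [p, q] k"
      using z ssyt_two_rows[OF assms] by (auto split: prod.splits)
  qed
  then show ?thesis by (simp add: flagged_schur2_jacobi_trudi assms)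
qed

lemma grassmannian_shape_decreasing:
  assumes "grassmannian k n \<tau>"
  shows "sorted_wrt (\<ge>) (grassmannian_shape k \<tau>)"
proof -
  have growth: "\<tau> i + (j - i) \<le> \<tau> j" if "1 \<le> i" "i \<le> j" "j \<le> k" for i j
    using that(2,3)
  proof (induction j rule: dec_induct)
    case (step j)
    have "\<tau> j < \<tau> (Suc j)"
      using assms step that(1) unfolding grassmannian_def
      by (intro strict_mono_onD[of "{1..k}" \<tau>]) auto
    then show ?case using step by auto
  qed simp
  have "\<tau> i - i \<le> \<tau> j - j" if "1 \<le> i" "i < j" "j \<le> k" for i j
    using growth[of i j] that by linarith
  then have "sorted_wrt (\<lambda>i j. \<tau> j - j \<le> \<tau> i - i) (rev [1..<k+1])"
    unfolding sorted_wrt_rev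
    by (intro sorted_wrt_mono_rel[OF _ sorted_wrt_upt]) auto
  then have "sorted_wrt (\<ge>) (map (\<lambda>j. \<tau> j - j) (rev [1..<k+1]))"
    by (simp add: sorted_wrt_map)
  then show ?thesis unfolding grassmannian_shape_def by (rule sorted_wrt_filter)
qed

lemma grassmannian_shape_two_rows:
  assumes "grassmannian k n \<tau>" and "length (grassmannian_shape k \<tau>) = 2"
  obtains p q where "grassmannian_shape k \<tau> = [p, q]" "1 \<le> q" "q \<le> p"
proof -
  obtain p q where pq: "grassmannian_shape k \<tau> = [p, q]"
    using assms(2) by (auto simp: length_Suc_conv numeral_2_eq_2)
  moreover have "q \<le> p" using grassmannian_shape_decreasing[OF assms(1)] pq by simp
  moreover have "q \<in> set (grassmannian_shape k \<tau>)" using pq by simp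
  then have "1 \<le> q" by (simp add: grassmannian_shape_def Suc_le_eq)
  ultimately show ?thesis using that by blast
qed

section \<open>Two Pieri steps\<close>

definition q_number :: "nat \<Rightarrow> int poly" where
  "q_number n = (\<Sum>s<n. monom 1 s)"

lemma q_number_Suc: "q_number (Suc n) = q_number n + monom 1 n"
  by (simp add: q_number_def)

lemma prod_monom: "(\<Prod>a\<in>S. monom (1 :: int) (f a)) = monom 1 (\<Sum>a\<in>S. f a)"
  by (induction S rule: infinite_finite_induct) (auto simp: mult_monom)

lemma sum_monom_consecutive:
  fixes J :: "nat set" and g :: "nat \<Rightarrow> nat"
  assumes "finite J" "J \<noteq> {}"
    and "\<And>P P'. P \<in> J \<Longrightarrow> P' \<in> J \<Longrightarrow> P < P' \<Longrightarrow> J \<inter> {P<..<P'} = {} \<Longrightarrow> g P' = g P + 1"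
  shows "(\<Sum>P\<in>J. monom (1 :: int) (g P)) = monom 1 (g (Min J)) * q_number (card J) \<and>
    g (Max J) + 1 = g (Min J) + card J"
  using assms
proof (induction J rule: finite_linorder_max_induct)
  case (insert b J)
  show ?case
  proof (cases "J = {}")
    case True
    then show ?thesis by (simp add: q_number_def mult_monom)
  next
    case False
    have max: "Max J \<in> J" "Max J < b" and min: "Min J < b" using insert.hyps(1,2) False by auto
    have "Min (insert b J) = Min J" "Max (insert b J) = b"
      using Min_insert[OF insert.hyps(1) False, of b] Max_insert[OF insert.hyps(1) False, of b]
        min_absorb2[OF less_imp_le[OF min]] max_absorb1[OF less_imp_le[OF max(2)]] by simp_all
    moreover
    have "(\<Sum>P\<in>J. monom (1 :: int) (g P)) = monom 1 (g (Min J)) * q_number (card J) \<and>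
        g (Max J) + 1 = g (Min J) + card J"
    proof (rule insert.IH[OF False])
      fix P P' assume P: "P \<in> J" "P' \<in> J" "P < P'" "J \<inter> {P<..<P'} = {}"
      then have "insert b J \<inter> {P<..<P'} = {}" using insert.hyps(2) by auto
      then show "g P' = g P + 1" using P by (intro insert.prems(2)) auto
    qed
    moreover have "insert b J \<inter> {Max J<..<b} = {}"
      by (auto dest!: Max_ge[OF insert.hyps(1)])
    then have "g b = g (Max J) + 1" using max by (intro insert.prems(2)) auto
    moreover have "b \<notin> J" using insert.hyps(2) by blast
    ultimately show ?thesis
      using insert.hyps(1) by (simp add: q_number_Suc distrib_left mult_monom add.commute)
  qed
qed simp

locale two_pieri_steps =
  fixes A :: "nat set" and V u :: "nat \<Rightarrow> nat"
  assumes finite_A: "finite A" and inj_V: "inj_on V A"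
begin

definition midpoints :: "(nat \<Rightarrow> nat) set" where
  "midpoints = {Y \<in> extensional A. pieri_step A V Y \<and> pieri_step A Y u}"

definition overtakes :: "nat \<Rightarrow> nat \<Rightarrow> bool" where
  "overtakes a e \<longleftrightarrow> a \<in> A \<and> e \<in> A \<and> V a < V e \<and> u e < u a"

definition stays_below :: "(nat \<Rightarrow> nat) \<Rightarrow> nat \<Rightarrow> nat \<Rightarrow> bool" where
  "stays_below Y a e \<longleftrightarrow> u a < u e \<and> Y a < V e \<and> u a < Y e"

definition jumps_over :: "(nat \<Rightarrow> nat) \<Rightarrow> nat \<Rightarrow> nat \<Rightarrow> bool" where
  "jumps_over Y a e \<longleftrightarrow>
    u e < u a \<and> e < a \<and> (Y e = u e \<and> Y a < V e \<or> Y e = V e \<and> u e < Y a)"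

definition moved :: "nat set" where
  "moved = {a \<in> A. V a < u a}"

text \<open>
  A moved particle that is overtaken rests in one of the two steps, and the landing place of the
  overtaking particle decides in which. So a midpoint is determined by the places of those
  particles that nobody overtakes.
\<close>

definition leaders :: "nat set" where
  "leaders = {a \<in> moved. \<forall>b. \<not> overtakes b a}"

definition cluster :: "nat \<Rightarrow> nat set" where
  "cluster a = {e \<in> moved. e = a \<or> overtakes a e}"

definition landings :: "nat \<Rightarrow> nat set" where
  "landings a = (\<lambda>Y. Y a) ` midpoints"

definition vacancies :: "nat \<Rightarrow> nat \<Rightarrow> nat set" where
  "vacancies e y = {V e<..y} - V ` A"

definition cluster_hops :: "nat \<Rightarrow> nat \<Rightarrow> nat" where
  "cluster_hops a P = card (vacancies a P)
    + (\<Sum>e\<in>{e \<in> cluster a - {a}. P < V e}. card (vacancies e (u e)))"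

lemma moved_A: "a \<in> moved \<Longrightarrow> a \<in> A"
  by (simp add: moved_def)

lemma leaders_A: "a \<in> leaders \<Longrightarrow> a \<in> A"
  by (simp add: leaders_def moved_A)

lemma overtakes_trans: "overtakes a b \<Longrightarrow> overtakes b c \<Longrightarrow> overtakes a c"
  by (auto simp: overtakes_def)

lemma leader_in_cluster: "a \<in> leaders \<Longrightarrow> a \<in> cluster a"
  by (simp add: leaders_def cluster_def)

lemma leader_in_cluster_eq: "b \<in> leaders \<Longrightarrow> b \<in> cluster a \<Longrightarrow> b = a"
  by (auto simp: leaders_def cluster_def)

lemma in_cluster_iff: "e \<in> cluster a - {a} \<longleftrightarrow> e \<in> moved \<and> overtakes a e"
  by (auto simp: cluster_def overtakes_def)

lemma finite_leaders: "finite leaders"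
  using finite_A by (auto simp: leaders_def moved_def)

lemma finite_cluster: "finite (cluster a)"
  using finite_A by (auto simp: cluster_def moved_def)

subsection \<open>Midpoints\<close>

lemma midpointsI:
  assumes ext: "Y \<in> extensional A" and le: "\<And>a. a \<in> A \<Longrightarrow> V a \<le> Y a \<and> Y a \<le> u a"
    and pairs: "\<And>a e. a \<in> A \<Longrightarrow> e \<in> A \<Longrightarrow> V a < V e \<Longrightarrow> stays_below Y a e \<or> jumps_over Y a e"
  shows "Y \<in> midpoints"
proof -
  have "pieri_step A V Y"
    unfolding pieri_step_def
  proof (intro conjI ballI impI)
    fix a e assume "a \<in> A" "e \<in> A" "V a < V e"
    then show "Y a < V e \<or> e < a \<and> Y e = V e \<and> V e < Y a"
      using pairs[of a e] le[of e] by (auto simp: stays_below_def jumps_over_def)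
  qed (use le in blast)
  moreover have "pieri_step A Y u"
    unfolding pieri_step_def
  proof (intro conjI ballI impI)
    fix a e assume ae: "a \<in> A" "e \<in> A" "Y a < Y e"
    then have "V a \<noteq> V e" using inj_onD[OF inj_V] by blast
    then consider "V a < V e" | "V e < V a" by linarith
    then show "u a < Y e \<or> e < a \<and> u e = Y e \<and> Y e < u a"
      using pairs[of a e] pairs[of e a] le[of a] le[of e] ae
      by cases (auto simp: stays_below_def jumps_over_def)
  qed (use le in blast)
  ultimately show ?thesis using ext by (simp add: midpoints_def)
qed

lemma midpoints_extensional: "Y \<in> midpoints \<Longrightarrow> Y \<in> extensional A"
  by (simp add: midpoints_def)

lemma midpoints_le: "Y \<in> midpoints \<Longrightarrow> a \<in> A \<Longrightarrow> V a \<le> Y a \<and> Y a \<le> u a"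
  by (simp add: midpoints_def pieri_step_def)

lemma midpoints_pair:
  assumes Y: "Y \<in> midpoints" and a: "a \<in> A" and e: "e \<in> A" and less: "V a < V e"
  shows "stays_below Y a e \<or> jumps_over Y a e"
proof -
  have first: "pieri_step A V Y" and second: "pieri_step A Y u"
    using Y by (simp_all add: midpoints_def)
  note le = midpoints_le[OF Y a] midpoints_le[OF Y e]
  from pieri_stepD[OF first a e less] show ?thesis
  proof
    assume "Y a < V e"
    then show ?thesis
      using pieri_stepD[OF second a e] le by (auto simp: stays_below_def jumps_over_def)
  next
    assume "e < a \<and> Y e = V e \<and> V e < Y a"
    then show ?thesis using pieri_stepD[OF second e a] le by (auto simp: jumps_over_def)
  qed
qed

lemma midpoints_stays_below:
  "Y \<in> midpoints \<Longrightarrow> a \<in> A \<Longrightarrow> e \<in> A \<Longrightarrow> V a < V e \<Longrightarrow> \<not> overtakes a e \<Longrightarrow> stays_below Y a e"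
  using midpoints_pair[of Y a e] by (auto simp: overtakes_def jumps_over_def)

lemma midpoints_jumps_over: "Y \<in> midpoints \<Longrightarrow> overtakes a e \<Longrightarrow> jumps_over Y a e"
  using midpoints_pair[of Y a e] by (auto simp: overtakes_def stays_below_def)

lemma midpoints_unmoved: "Y \<in> midpoints \<Longrightarrow> a \<in> A \<Longrightarrow> a \<notin> moved \<Longrightarrow> u a = V a \<and> Y a = V a"
  using midpoints_le[of Y a] by (auto simp: moved_def)

lemma finite_midpoints: "finite midpoints"
proof (rule finite_subset)
  show "midpoints \<subseteq> PiE A (\<lambda>a. {..u a})"
    using midpoints_le midpoints_extensional by (auto simp: PiE_def)
qed (use finite_A in \<open>auto intro!: finite_PiE\<close>)

lemma overtakes_moved: "Y \<in> midpoints \<Longrightarrow> overtakes a e \<Longrightarrow> a \<in> moved"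
  using midpoints_le[of Y e] by (auto simp: moved_def overtakes_def)

lemma leaders_stay_below:
  assumes "Y \<in> midpoints" "b \<in> A" "a \<in> leaders" "V b < V a"
  shows "stays_below Y b a"
  using assms by (intro midpoints_stays_below) (auto simp: leaders_def moved_A)

lemma landing_vacant:
  assumes Y: "Y \<in> midpoints" and a: "a \<in> A" "V a < Y a"
  shows "Y a \<notin> V ` A"
proof
  assume "Y a \<in> V ` A"
  then obtain e where e: "e \<in> A" "Y a = V e" by auto
  then show False
    using midpoints_pair[OF Y a(1) e(1)] midpoints_le[OF Y e(1)] a(2)
    by (auto simp: stays_below_def jumps_over_def)
qed

subsection \<open>Clusters\<close>

lemma cluster_cover:
  assumes Y: "Y \<in> midpoints" and e: "e \<in> moved"
  shows "\<exists>a\<in>leaders. e \<in> cluster a"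
proof (cases "\<exists>b. overtakes b e")
  case False
  then show ?thesis using e by (auto simp: leaders_def cluster_def)
next
  case True
  let ?B = "{b. overtakes b e}"
  have fin: "finite ?B" by (rule finite_subset[OF _ finite_A]) (auto simp: overtakes_def)
  have "Max (u ` ?B) \<in> u ` ?B" using True fin by (intro Max_in) auto
  then obtain a where a: "overtakes a e" "u a = Max (u ` ?B)" by auto
  have "\<not> overtakes b a" for b
  proof
    assume b: "overtakes b a"
    then have "u b \<le> u a" using a fin overtakes_trans[OF b a(1)] by simp
    then show False using b by (simp add: overtakes_def)
  qed
  then have "a \<in> leaders" using overtakes_moved[OF Y a(1)] by (simp add: leaders_def)
  then show ?thesis using a e by (auto simp: cluster_def)
qed

text \<open>
  A moved particle overtaken by two leaders would have to move in the second step only (because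
  of the upper one) and in the first step only (because of the lower one).
\<close>

lemma cluster_unique:
  assumes Y: "Y \<in> midpoints" and a: "a \<in> leaders" "e \<in> cluster a"
    and b: "b \<in> leaders" "e \<in> cluster b"
  shows "a = b"
proof -
  have e: "e \<in> moved" using a by (simp add: cluster_def)
  have impossible: False
    if "a \<in> leaders" "b \<in> leaders" "overtakes a e" "overtakes b e" "V a < V b" for a b
    using leaders_stay_below[OF Y leaders_A[OF that(1)] that(2,5)]
      midpoints_jumps_over[OF Y that(3)] midpoints_jumps_over[OF Y that(4)] that e
    by (auto simp: stays_below_def jumps_over_def overtakes_def moved_def)
  consider (leader) "e = a \<or> e = b" | (overtaken) "overtakes a e" "overtakes b e"
    using a b by (auto simp: cluster_def)
  then show ?thesis
  proof cases
    case leader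
    then show ?thesis using a b leader_in_cluster_eq by blast
  next
    case overtaken
    then have "V a = V b"
      using impossible[of a b] impossible[of b a] a b by (meson linorder_neqE_nat)
    then show ?thesis using inj_onD[OF inj_V] a b leaders_A by blast
  qed
qed

lemma overtakes_same_cluster:
  assumes Y: "Y \<in> midpoints" and "overtakes b e" "e \<in> moved" "a \<in> leaders"
  shows "b \<in> cluster a \<longleftrightarrow> e \<in> cluster a"
proof
  assume "b \<in> cluster a"
  then show "e \<in> cluster a" using assms overtakes_trans by (auto simp: cluster_def)
next
  assume e: "e \<in> cluster a"
  obtain c where c: "c \<in> leaders" "b \<in> cluster c"
    using cluster_cover[OF Y overtakes_moved[OF Y assms(2)]] by blast
  then have "e \<in> cluster c" using assms overtakes_trans by (auto simp: cluster_def)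
  then show "b \<in> cluster a" using cluster_unique[OF Y assms(4) e c(1)] c by simp
qed

lemma overtakes_not_nested:
  assumes Y: "Y \<in> midpoints" and "overtakes a b" "overtakes b e" "b \<in> moved"
  shows "e \<notin> moved"
  using midpoints_jumps_over[OF Y assms(2)] midpoints_jumps_over[OF Y assms(3)]
    midpoints_jumps_over[OF Y overtakes_trans[OF assms(2,3)]] assms(2-4)
  by (auto simp: overtakes_def moved_def jumps_over_def)

lemma cluster_separated:
  assumes Y: "Y \<in> midpoints" and a: "a \<in> leaders" and e: "e \<in> cluster a - {a}" and f: "f \<in> A"
  shows "V e < V f \<Longrightarrow> u e < u f \<Longrightarrow> u e < V f"
    and "V f < V e \<Longrightarrow> u f < u e \<Longrightarrow> u f < V e"
proof -
  have over: "overtakes a e" and eA: "e \<in> A" "a \<in> A"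
    using e in_cluster_iff[of e a] by (auto simp: overtakes_def)
  note jump = midpoints_jumps_over[OF Y over]
  show "u e < V f" if less: "V e < V f" "u e < u f"
    using midpoints_pair[OF Y eA(1) f less(1)] midpoints_pair[OF Y eA(2) f] jump over less
    by (auto simp: stays_below_def jumps_over_def overtakes_def)
  show "u f < V e" if less: "V f < V e" "u f < u e"
  proof (cases "V f < V a")
    case True
    then show ?thesis
      using midpoints_pair[OF Y f eA(1) less(1)] leaders_stay_below[OF Y f a True] jump less
      by (auto simp: stays_below_def jumps_over_def)
  next
    case False
    then have "V a < V f"
      using inj_onD[OF inj_V _ eA(2) f] over less by (fastforce simp: overtakes_def)
    then show ?thesis
      using midpoints_pair[OF Y f eA(1) less(1)] midpoints_pair[OF Y eA(2) f] jump over less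
      by (auto simp: stays_below_def jumps_over_def overtakes_def)
  qed
qed

lemma midpoints_mix:
  assumes Y: "Y \<in> midpoints" and Y': "Y' \<in> midpoints" and a: "a \<in> leaders"
  shows "(\<lambda>e. if e \<in> cluster a then Y e else Y' e) \<in> midpoints" (is "?Z \<in> _")
proof (rule midpointsI)
  show "?Z \<in> extensional A"
    using midpoints_extensional[OF Y] midpoints_extensional[OF Y'] by (auto simp: extensional_def)
  show "V e \<le> ?Z e \<and> ?Z e \<le> u e" if "e \<in> A" for e
    using midpoints_le[OF Y that] midpoints_le[OF Y' that] by simp
next
  fix b e assume be: "b \<in> A" "e \<in> A" "V b < V e"
  show "stays_below ?Z b e \<or> jumps_over ?Z b e"
  proof (cases "overtakes b e")
    case False
    then show ?thesis
      using midpoints_stays_below[OF Y be] midpoints_stays_below[OF Y' be]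
      by (auto simp: stays_below_def)
  next
    case over: True
    have "jumps_over ?Z b e"
    proof (cases "e \<in> moved")
      case True
      then show ?thesis
        using overtakes_same_cluster[OF Y over True a]
          midpoints_jumps_over[OF Y over] midpoints_jumps_over[OF Y' over]
        by (simp add: jumps_over_def)
    next
      case False
      then have "e \<notin> cluster a" by (simp add: cluster_def)
      then show ?thesis
        using midpoints_jumps_over[OF Y over] midpoints_jumps_over[OF Y' over]
          midpoints_unmoved[OF Y be(2) False] midpoints_unmoved[OF Y' be(2) False]
        by (auto simp: jumps_over_def)
    qed
    then show ?thesis ..
  qed
qed

lemma midpoints_realize:
  assumes "midpoints \<noteq> {}" "S \<subseteq> leaders" "\<And>a. a \<in> S \<Longrightarrow> f a \<in> landings a"
  shows "\<exists>Y\<in>midpoints. \<forall>a\<in>S. Y a = f a"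
proof -
  have "finite S" using assms(2) finite_leaders finite_subset by blast
  then show ?thesis
    using assms(2,3)
  proof (induction S rule: finite_induct)
    case empty
    then show ?case using assms(1) by auto
  next
    case (insert a S)
    then obtain Y' where Y': "Y' \<in> midpoints" "\<forall>b\<in>S. Y' b = f b" by blast
    obtain Y where Y: "Y \<in> midpoints" "Y a = f a"
      using insert.prems(2)[of a] by (auto simp: landings_def)
    have a: "a \<in> leaders" using insert.prems by simp
    let ?Z = "\<lambda>e. if e \<in> cluster a then Y e else Y' e"
    have "?Z b = f b" if "b \<in> insert a S" for b
      using that Y(2) Y'(2) leader_in_cluster[OF a] leader_in_cluster_eq[of b a] insert.prems(1)
        insert.hyps(2) by auto
    then show ?case by (intro bexI[OF _ midpoints_mix[OF Y(1) Y'(1) a]] ballI)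
  qed
qed

lemma midpoints_determined:
  assumes Y: "Y \<in> midpoints" and Y': "Y' \<in> midpoints" and eq: "\<And>a. a \<in> leaders \<Longrightarrow> Y a = Y' a"
  shows "Y = Y'"
proof (rule extensionalityI[OF midpoints_extensional[OF Y] midpoints_extensional[OF Y']])
  fix e assume e: "e \<in> A"
  show "Y e = Y' e"
  proof (cases "e \<in> moved")
    case False
    then show ?thesis using midpoints_unmoved[OF Y e] midpoints_unmoved[OF Y' e] by simp
  next
    case True
    then obtain a where a: "a \<in> leaders" "e \<in> cluster a" using cluster_cover[OF Y] by blast
    show ?thesis
    proof (cases "e = a")
      case False
      then have over: "overtakes a e" using a in_cluster_iff by blast
      then show ?thesis
        using midpoints_jumps_over[OF Y over] midpoints_jumps_over[OF Y' over] eq[OF a(1)] True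
        by (auto simp: moved_def jumps_over_def)
    qed (use eq a in auto)
  qed
qed

lemma bij_betw_restrict_leaders:
  assumes ne: "midpoints \<noteq> {}" and J: "\<And>a. a \<in> leaders \<Longrightarrow> J a \<subseteq> landings a"
  shows "bij_betw (\<lambda>Y. restrict Y leaders)
    {Y \<in> midpoints. \<forall>a\<in>leaders. Y a \<in> J a} (PiE leaders J)"
  unfolding bij_betw_def
proof (intro conjI inj_onI equalityI subsetI)
  fix Y Y'
  assume "Y \<in> {Y \<in> midpoints. \<forall>a\<in>leaders. Y a \<in> J a}"
    "Y' \<in> {Y \<in> midpoints. \<forall>a\<in>leaders. Y a \<in> J a}"
    and eq: "restrict Y leaders = restrict Y' leaders"
  moreover have "Y a = Y' a" if "a \<in> leaders" for a using fun_cong[OF eq, of a] that by simp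
  ultimately show "Y = Y'" using midpoints_determined by blast
next
  fix f assume f: "f \<in> PiE leaders J"
  then have "f a \<in> landings a" if "a \<in> leaders" for a using J that by blast
  then obtain Y where Y: "Y \<in> midpoints" "\<forall>a\<in>leaders. Y a = f a"
    using midpoints_realize[OF ne, of leaders f] by blast
  then have "restrict Y leaders = f"
    using f by (intro extensionalityI[of _ leaders]) (auto simp: PiE_iff)
  then show "f \<in> (\<lambda>Y. restrict Y leaders) ` {Y \<in> midpoints. \<forall>a\<in>leaders. Y a \<in> J a}"
    using Y f by (intro image_eqI[of _ _ Y]) auto
qed auto

subsection \<open>Landing places of a leader\<close>

lemma finite_landings: "finite (landings a)"
  by (simp add: landings_def finite_midpoints)

definition reposition :: "nat \<Rightarrow> nat \<Rightarrow> (nat \<Rightarrow> nat) \<Rightarrow> nat \<Rightarrow> nat" where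
  "reposition a Q Y e =
    (if e = a then Q else if e \<in> cluster a then if Q < V e then u e else V e else Y e)"

lemma reposition_jumps_over:
  assumes Y: "Y \<in> midpoints" and a: "a \<in> leaders"
    and window: "\<And>e. overtakes a e \<Longrightarrow> Q < V e \<or> u e < Q" and over: "overtakes b e"
  shows "jumps_over (reposition a Q Y) b e"
proof -
  have "e \<noteq> a" using a over by (auto simp: leaders_def)
  note jump = midpoints_jumps_over[OF Y over]
  show ?thesis
  proof (cases "e \<in> moved")
    case False
    then have "e \<notin> cluster a" "e \<in> A" using over by (simp_all add: cluster_def overtakes_def)
    then show ?thesis
      using jump window[of e] over midpoints_unmoved[OF Y _ False] \<open>e \<noteq> a\<close>
      by (auto simp: jumps_over_def reposition_def overtakes_def)
  next
    case moved: True
    have same: "b \<in> cluster a \<longleftrightarrow> e \<in> cluster a"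
      by (rule overtakes_same_cluster[OF Y over moved a])
    show ?thesis
    proof (cases "e \<in> cluster a")
      case False
      then show ?thesis
        using jump same leader_in_cluster[OF a] \<open>e \<noteq> a\<close>
        by (auto simp: jumps_over_def reposition_def)
    next
      case in_cluster: True
      then have "b = a"
        using overtakes_not_nested[OF Y _ over] in_cluster_iff[of b a] same moved by blast
      then show ?thesis
        using jump window[of e] over in_cluster \<open>e \<noteq> a\<close>
        by (auto simp: jumps_over_def reposition_def)
    qed
  qed
qed

lemma reposition_stays_below:
  assumes Y: "Y \<in> midpoints" and a: "a \<in> leaders"
    and above: "\<And>e. e \<in> A \<Longrightarrow> V a < V e \<Longrightarrow> \<not> overtakes a e \<Longrightarrow> Q < V e"
    and below: "\<And>b. b \<in> A \<Longrightarrow> V b < V a \<Longrightarrow> u b < Q"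
    and be: "b \<in> A" "e \<in> A" "V b < V e" "\<not> overtakes b e"
  shows "stays_below (reposition a Q Y) b e"
proof -
  have stays: "stays_below Y b e" by (rule midpoints_stays_below[OF Y be])
  then have "u b < u e" by (simp add: stays_below_def)
  then have "u b < V e" if "b \<in> cluster a - {a} \<or> e \<in> cluster a - {a}"
    using cluster_separated[OF Y a] be that by blast
  then show ?thesis
    using stays above[of e] below[of b] be by (auto simp: stays_below_def reposition_def)
qed

lemma landings_iff:
  assumes Y: "Y \<in> midpoints" and a: "a \<in> leaders"
  shows "Q \<in> landings a \<longleftrightarrow> V a \<le> Q \<and> Q \<le> u a \<and>
    (\<forall>e\<in>A. V a < V e \<and> \<not> overtakes a e \<longrightarrow> Q < V e) \<and>
    (\<forall>b\<in>A. V b < V a \<longrightarrow> u b < Q) \<and>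
    (\<forall>e. overtakes a e \<longrightarrow> Q < V e \<or> u e < Q)" (is "_ \<longleftrightarrow> ?window")
proof
  assume "Q \<in> landings a"
  then obtain Z where Z: "Z \<in> midpoints" "Q = Z a" by (auto simp: landings_def)
  then show ?window
    using midpoints_le[OF Z(1) leaders_A[OF a]] midpoints_stays_below[OF Z(1) leaders_A[OF a]]
      leaders_stay_below[OF Z(1) _ a] midpoints_jumps_over[OF Z(1), of a]
    by (auto simp: stays_below_def jumps_over_def)
next
  assume window: ?window
  have "reposition a Q Y \<in> midpoints"
  proof (rule midpointsI)
    show "reposition a Q Y \<in> extensional A"
      using midpoints_extensional[OF Y] leaders_A[OF a]
      by (auto simp: extensional_def reposition_def cluster_def moved_def)
    show "V e \<le> reposition a Q Y e \<and> reposition a Q Y e \<le> u e" if "e \<in> A" for e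
      using midpoints_le[OF Y that] window by (auto simp: reposition_def)
    show "stays_below (reposition a Q Y) b e \<or> jumps_over (reposition a Q Y) b e"
      if "b \<in> A" "e \<in> A" "V b < V e" for b e
    proof (cases "overtakes b e")
      case True
      then show ?thesis using window by (blast intro: reposition_jumps_over[OF Y a])
    next
      case False
      then show ?thesis using window by (blast intro: reposition_stays_below[OF Y a _ _ that])
    qed
  qed
  moreover have "reposition a Q Y a = Q" by (simp add: reposition_def)
  ultimately show "Q \<in> landings a" unfolding landings_def by (metis imageI)
qed

subsection \<open>Counting hops\<close>

lemma cluster_hops_midpoint:
  assumes Y: "Y \<in> midpoints" and a: "a \<in> leaders"
  shows "(\<Sum>e\<in>cluster a. card (vacancies e (Y e))) = cluster_hops a (Y a)"
proof -
  have "(\<Sum>e\<in>cluster a. card (vacancies e (Y e)))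
      = card (vacancies a (Y a)) + (\<Sum>e\<in>cluster a - {a}. card (vacancies e (Y e)))"
    using leader_in_cluster[OF a] by (rule sum.remove[OF finite_cluster])
  also have "(\<Sum>e\<in>cluster a - {a}. card (vacancies e (Y e)))
      = (\<Sum>e\<in>cluster a - {a}. if Y a < V e then card (vacancies e (u e)) else 0)"
  proof (rule sum.cong[OF refl])
    fix e assume "e \<in> cluster a - {a}"
    then have "overtakes a e" "e \<in> moved" using in_cluster_iff by auto
    then show "card (vacancies e (Y e)) = (if Y a < V e then card (vacancies e (u e)) else 0)"
      using midpoints_jumps_over[OF Y, of a e]
      by (auto simp: moved_def vacancies_def jumps_over_def)
  qed
  finally show ?thesis
    by (simp only: cluster_hops_def sum.inter_filter[OF finite_Diff[OF finite_cluster]])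
qed

lemma hops_eq_cluster_hops:
  assumes Y: "Y \<in> midpoints"
  shows "hops A V Y = (\<Sum>a\<in>leaders. cluster_hops a (Y a))"
proof -
  have "hops A V Y = (\<Sum>e\<in>moved. card (vacancies e (Y e)))"
    unfolding hops_def vacancies_def
    by (rule sum.mono_neutral_right[OF finite_A])
       (use midpoints_unmoved[OF Y] in \<open>auto simp: moved_A\<close>)
  also have "moved = (\<Union>a\<in>leaders. cluster a)"
    using cluster_cover[OF Y] by (auto simp: cluster_def)
  also have "(\<Sum>e\<in>(\<Union>a\<in>leaders. cluster a). card (vacancies e (Y e)))
      = (\<Sum>a\<in>leaders. \<Sum>e\<in>cluster a. card (vacancies e (Y e)))"
    using cluster_unique[OF Y]
    by (intro sum.UNION_disjoint) (auto simp: finite_leaders finite_cluster)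
  also have "\<dots> = (\<Sum>a\<in>leaders. cluster_hops a (Y a))"
    by (intro sum.cong refl cluster_hops_midpoint[OF Y])
  finally show ?thesis .
qed

definition crossed :: "nat \<Rightarrow> nat \<Rightarrow> nat \<Rightarrow> nat set" where
  "crossed a P P' = {e \<in> cluster a - {a}. P < V e \<and> u e < P'}"

lemma card_crossed_vacancies:
  assumes Y: "Y \<in> midpoints" and a: "a \<in> leaders"
  shows "card (\<Union>e\<in>crossed a P P'. vacancies e (u e))
    = (\<Sum>e\<in>crossed a P P'. card (vacancies e (u e)))"
proof (rule card_UN_disjoint)
  have separated: "u e < V f" if "e \<in> cluster a - {a}" "f \<in> cluster a - {a}" "V e < V f" for e f
  proof (rule cluster_separated(1)[OF Y a that(1) _ that(3)])
    have over: "overtakes a e" and moved: "e \<in> moved" "f \<in> moved" using that in_cluster_iff by auto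
    then show "f \<in> A" by (simp add: moved_A)
    have "\<not> overtakes e f" using overtakes_not_nested[OF Y over _ moved(1)] moved(2) by blast
    then show "u e < u f"
      using midpoints_stays_below[OF Y _ _ that(3)] moved by (simp add: moved_A stays_below_def)
  qed
  show "\<forall>e\<in>crossed a P P'. \<forall>f\<in>crossed a P P'. e \<noteq> f \<longrightarrow>
      vacancies e (u e) \<inter> vacancies f (u f) = {}"
  proof (intro ballI impI)
    fix e f assume ef: "e \<in> crossed a P P'" "f \<in> crossed a P P'" "e \<noteq> f"
    then have "V e \<noteq> V f" using inj_onD[OF inj_V] by (auto simp: crossed_def cluster_def moved_A)
    then show "vacancies e (u e) \<inter> vacancies f (u f) = {}"
      using separated[of e f] separated[of f e] ef
      by (fastforce simp: nat_neq_iff crossed_def vacancies_def)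
  qed
qed (simp_all add: crossed_def vacancies_def finite_cluster)

lemma cluster_hops_diff:
  assumes Y: "Y \<in> midpoints" and a: "a \<in> leaders"
    and P: "P \<in> landings a" and P': "P' \<in> landings a" and "P < P'"
  shows "cluster_hops a P' + (\<Sum>e\<in>crossed a P P'. card (vacancies e (u e)))
    = cluster_hops a P + card ({P<..P'} - V ` A)"
proof -
  have "V a \<le> P" using P landings_iff[OF Y a] by blast
  then have "vacancies a P' = vacancies a P \<union> ({P<..P'} - V ` A)"
    using \<open>P < P'\<close> by (auto simp: vacancies_def)
  then have "card (vacancies a P') = card (vacancies a P) + card ({P<..P'} - V ` A)"
    by (simp add: card_Un_disjoint disjoint_iff vacancies_def)
  moreover have "{e \<in> cluster a - {a}. P < V e}
      = {e \<in> cluster a - {a}. P' < V e} \<union> crossed a P P'"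
  proof -
    have "V e < u e" "P' < V e \<or> u e < P'" if "e \<in> cluster a - {a}" for e
      using that P' landings_iff[OF Y a] in_cluster_iff by (auto simp: moved_def)
    then show ?thesis using \<open>P < P'\<close> unfolding crossed_def by fastforce
  qed
  moreover have "{e \<in> cluster a - {a}. P' < V e} \<inter> crossed a P P' = {}"
    by (auto simp: crossed_def cluster_def moved_def)
  ultimately show ?thesis
    by (simp add: cluster_hops_def sum.union_disjoint finite_cluster crossed_def)
qed

lemma vacant_between_consecutive_landings:
  assumes Y: "Y \<in> midpoints" and a: "a \<in> leaders"
    and P: "P \<in> landings a" and P': "P' \<in> landings a" and "P < P'"
    and consecutive: "landings a \<inter> {P<..<P'} = {}"
  shows "{P<..P'} - V ` A = insert P' (\<Union>e\<in>crossed a P P'. vacancies e (u e))"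
proof (intro equalityI subsetI)
  fix Q assume Q: "Q \<in> {P<..P'} - V ` A"
  show "Q \<in> insert P' (\<Union>e\<in>crossed a P P'. vacancies e (u e))"
  proof (rule ccontr)
    assume outside: "Q \<notin> insert P' (\<Union>e\<in>crossed a P P'. vacancies e (u e))"
    have "Q < V e \<or> u e < Q" if over: "overtakes a e" for e
    proof (rule ccontr)
      assume "\<not> (Q < V e \<or> u e < Q)"
      moreover have "Q \<noteq> V e" using Q over by (auto simp: overtakes_def)
      ultimately have "V e < Q" "Q \<le> u e" by auto
      moreover have "P < V e \<or> u e < P" "P' < V e \<or> u e < P'"
        using P P' over unfolding landings_iff[OF Y a] by blast+
      ultimately have "e \<in> crossed a P P'"
        using over Q in_cluster_iff[of e a] by (auto simp: crossed_def moved_def overtakes_def)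
      then show False using outside Q \<open>V e < Q\<close> \<open>Q \<le> u e\<close> by (auto simp: vacancies_def)
    qed
    moreover have "P < Q" "Q \<le> P'" using Q by auto
    ultimately have "Q \<in> landings a"
      using P P' unfolding landings_iff[OF Y a]
      by (meson le_less_trans less_imp_le less_le_trans order.trans)
    then show False using consecutive Q outside by auto
  qed
next
  obtain Z where Z: "Z \<in> midpoints" "Z a = P'" using P' by (auto simp: landings_def)
  have "V a \<le> P" using P landings_iff[OF Y a] by blast
  then have "P' \<notin> V ` A"
    using landing_vacant[OF Z(1) leaders_A[OF a]] Z(2) \<open>P < P'\<close> by simp
  then show "Q \<in> {P<..P'} - V ` A"
    if "Q \<in> insert P' (\<Union>e\<in>crossed a P P'. vacancies e (u e))" for Q
    using that \<open>P < P'\<close> by (auto simp: crossed_def vacancies_def)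
qed

lemma cluster_hops_consecutive:
  assumes a: "a \<in> leaders" and P: "P \<in> landings a" "P' \<in> landings a" "P < P'"
    and "landings a \<inter> {P<..<P'} = {}"
  shows "cluster_hops a P' = cluster_hops a P + 1"
proof -
  obtain Y where Y: "Y \<in> midpoints" using P by (auto simp: landings_def)
  have "P' \<notin> (\<Union>e\<in>crossed a P P'. vacancies e (u e))" by (auto simp: crossed_def vacancies_def)
  then have "card ({P<..P'} - V ` A) = (\<Sum>e\<in>crossed a P P'. card (vacancies e (u e))) + 1"
    using vacant_between_consecutive_landings[OF Y assms] card_crossed_vacancies[OF Y a, of P P']
    by (simp add: crossed_def vacancies_def finite_cluster)
  then show ?thesis using cluster_hops_diff[OF Y a P] by simp
qed

lemma sum_landings_monom:
  assumes "midpoints \<noteq> {}" "a \<in> leaders"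
  shows "(\<Sum>P\<in>landings a. monom (1 :: int) (cluster_hops a P))
      = monom 1 (cluster_hops a (Min (landings a))) * q_number (card (landings a))"
    and "cluster_hops a (Max (landings a)) + 1
      = cluster_hops a (Min (landings a)) + card (landings a)"
  using sum_monom_consecutive[OF finite_landings, of a "cluster_hops a"]
    cluster_hops_consecutive[OF assms(2)] assms(1)
  by (simp_all add: landings_def)

lemma card_landings_pos: "midpoints \<noteq> {} \<Longrightarrow> 0 < card (landings a)"
  using finite_landings by (auto simp: card_gt_0_iff landings_def)

lemma landings_less_leader:
  assumes "a \<in> leaders" "b \<in> leaders" "V a < V b" "P \<in> landings a"
  shows "P < V b"
proof -
  obtain Y where "Y \<in> midpoints" "Y a = P" using assms(4) by (auto simp: landings_def)
  then show ?thesis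
    using leaders_stay_below[of Y a b] leaders_A[OF assms(1)] assms(2,3)
    by (simp add: stays_below_def)
qed

lemma landings_disjoint:
  assumes "a \<in> leaders" "b \<in> leaders" "V a < V b"
  shows "landings a \<inter> landings b = {}"
proof -
  have "V b \<le> P" if "P \<in> landings b" for P
    using that midpoints_le leaders_A[OF assms(2)] by (auto simp: landings_def)
  then show ?thesis using landings_less_leader[OF assms] by fastforce
qed

lemma sum_landings_le:
  assumes t: "t \<in> leaders" and top: "\<And>a. a \<in> leaders \<Longrightarrow> a \<noteq> t \<Longrightarrow> V a < V t"
    and ne: "midpoints \<noteq> {}"
  shows "(\<Sum>a\<in>leaders - {t}. card (landings a) - 1) \<le> card ({1..<V t} - V ` A)"
proof -
  have "(\<Sum>a\<in>leaders - {t}. card (landings a) - 1) \<le> (\<Sum>a\<in>leaders - {t}. card (landings a - {V a}))"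
    by (intro sum_mono) (simp add: card_Diff_singleton_if)
  also have "\<dots> = card (\<Union>a\<in>leaders - {t}. landings a - {V a})"
  proof (rule card_UN_disjoint[symmetric])
    show "\<forall>a\<in>leaders - {t}. \<forall>b\<in>leaders - {t}. a \<noteq> b \<longrightarrow>
        (landings a - {V a}) \<inter> (landings b - {V b}) = {}"
    proof (intro ballI impI)
      fix a b assume ab: "a \<in> leaders - {t}" "b \<in> leaders - {t}" "a \<noteq> b"
      then have "V a < V b \<or> V b < V a"
        using inj_onD[OF inj_V] leaders_A
        by (meson DiffD1 linorder_neqE_nat)
      then show "(landings a - {V a}) \<inter> (landings b - {V b}) = {}"
        using landings_disjoint[of a b] landings_disjoint[of b a] ab by blast
    qed
  qed (auto simp: finite_leaders finite_landings)
  also have "\<dots> \<le> card ({1..<V t} - V ` A)"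
  proof (intro card_mono UN_least subsetI)
    fix a P assume a: "a \<in> leaders - {t}" and P: "P \<in> landings a - {V a}"
    then obtain Y where Y: "Y \<in> midpoints" "P = Y a" by (auto simp: landings_def)
    have "V a < Y a" using midpoints_le[OF Y(1)] leaders_A a P Y by fastforce
    then have "P \<notin> V ` A" "0 < P" using landing_vacant[OF Y(1)] leaders_A a Y by auto
    then show "P \<in> {1..<V t} - V ` A" using landings_less_leader[of a t P] top[of a] t a P by auto
  qed simp
  finally show ?thesis .
qed

end

section \<open>Symmetric unimodal coefficient sequences\<close>

definition icoeff :: "int poly \<Rightarrow> int \<Rightarrow> int" where
  "icoeff p s = (if s < 0 then 0 else coeff p (nat s))"

lemma icoeff_add: "icoeff (p + q) s = icoeff p s + icoeff q s"
  by (simp add: icoeff_def)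

lemma icoeff_monom: "icoeff (monom 1 n) s = (if int n = s then 1 else 0)"
  by (auto simp: icoeff_def)

lemma icoeff_sum: "icoeff (\<Sum>a\<in>S. f a) s = (\<Sum>a\<in>S. icoeff (f a) s)"
  by (simp add: icoeff_def coeff_sum)

lemma icoeff_monom_mult: "icoeff (monom 1 n * p) s = icoeff p (s - int n)"
  by (auto simp: icoeff_def coeff_monom_mult nat_diff_distrib' nat_le_iff)

lemma coeff_q_number: "coeff (q_number n) i = (if i < n then 1 else 0)"
  by (simp add: q_number_def coeff_sum)

lemma q_number_nonzero: "0 < n \<Longrightarrow> q_number n \<noteq> 0"
  using coeff_q_number[of n 0] by auto

lemma icoeff_mult_q_number: "icoeff (p * q_number n) s = (\<Sum>j<n. icoeff p (s - int j))"
proof (induction n)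
  case 0
  then show ?case by (simp add: q_number_def icoeff_def)
next
  case (Suc n)
  then show ?case
    by (simp add: q_number_Suc distrib_left icoeff_add icoeff_monom_mult
        mult.commute[of p "monom 1 n"])
qed

lemma icoeff_mult_q_number_diff:
  "icoeff (p * q_number (Suc m)) s - icoeff (p * q_number (Suc m)) (s + 1)
    = icoeff p (s - int m) - icoeff p (s + 1)"
  unfolding icoeff_mult_q_number sum.lessThan_Suc_shift[of "\<lambda>j. icoeff p (s + 1 - int j)"]
  by simp

definition symmetric_unimodal :: "int \<Rightarrow> int poly \<Rightarrow> bool" where
  "symmetric_unimodal d p \<longleftrightarrow> (\<forall>s. icoeff p (d - s) = icoeff p s) \<and>
    (\<forall>s. d \<le> 2 * s + 1 \<longrightarrow> icoeff p (s + 1) \<le> icoeff p s)"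

lemma symmetric_unimodal_le:
  assumes p: "symmetric_unimodal d p" and "\<bar>2 * s - d\<bar> \<le> \<bar>2 * t - d\<bar>"
  shows "icoeff p t \<le> icoeff p s"
proof -
  have antimono: "icoeff p t \<le> icoeff p s" if "s \<le> t" "d \<le> 2 * s" for s t
    using that(1)
  proof (induction t rule: int_ge_induct)
    case (step t)
    have "icoeff p (t + 1) \<le> icoeff p t"
      using p step that(2) by (simp add: symmetric_unimodal_def)
    then show ?case using step by linarith
  qed simp
  have reflect: "icoeff p (max x (d - x)) = icoeff p x" for x
    using p by (simp add: symmetric_unimodal_def max_def)
  have "icoeff p (max t (d - t)) \<le> icoeff p (max s (d - s))"
    using assms(2) by (intro antimono) (auto simp: max_def)
  then show ?thesis by (simp only: reflect)
qed

lemma symmetric_unimodal_mult_q_number: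
  assumes p: "symmetric_unimodal d p"
  shows "symmetric_unimodal (d + int m) (p * q_number (Suc m))"
  unfolding symmetric_unimodal_def
proof (intro conjI allI impI)
  fix s
  have "icoeff (p * q_number (Suc m)) (d + int m - s)
      = (\<Sum>j<Suc m. icoeff p (s - int (Suc m - Suc j)))"
    unfolding icoeff_mult_q_number
  proof (intro sum.cong refl)
    fix j assume "j \<in> {..<Suc m}"
    then have "d + int m - s - int j = d - (s - int (Suc m - Suc j))" by auto
    then show "icoeff p (d + int m - s - int j) = icoeff p (s - int (Suc m - Suc j))"
      using p by (simp only: symmetric_unimodal_def)
  qed
  also have "\<dots> = icoeff (p * q_number (Suc m)) s"
    unfolding icoeff_mult_q_number by (rule sum.nat_diff_reindex)
  finally show "icoeff (p * q_number (Suc m)) (d + int m - s) = icoeff (p * q_number (Suc m)) s" .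
next
  fix s assume "d + int m \<le> 2 * s + 1"
  then have "icoeff p (s + 1) \<le> icoeff p (s - int m)"
    by (intro symmetric_unimodal_le[OF p]) auto
  then show "icoeff (p * q_number (Suc m)) (s + 1) \<le> icoeff (p * q_number (Suc m)) s"
    using icoeff_mult_q_number_diff[of p m s] by linarith
qed

lemma symmetric_unimodal_prod_q_number:
  assumes "finite S" "\<And>a. a \<in> S \<Longrightarrow> 0 < n a"
  shows "symmetric_unimodal (int (\<Sum>a\<in>S. n a - 1)) (\<Prod>a\<in>S. q_number (n a))"
  using assms
proof (induction S rule: finite_induct)
  case empty
  then show ?case by (auto simp: symmetric_unimodal_def icoeff_def)
next
  case (insert a S)
  then have "Suc (n a - 1) = n a" by simp
  then have "symmetric_unimodal (int (\<Sum>a\<in>S. n a - 1) + int (n a - 1))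
      ((\<Prod>a\<in>S. q_number (n a)) * q_number (n a))"
    using symmetric_unimodal_mult_q_number[OF insert.IH, of "n a - 1"] insert.prems by simp
  then show ?case using insert.hyps by (simp add: mult.commute add.commute)
qed

lemma symmetric_center_unique:
  assumes "p \<noteq> 0" "\<And>s. icoeff p (d - s) = icoeff p s" "\<And>s. icoeff p (e - s) = icoeff p s"
  shows "d = e"
proof -
  have "d \<le> e" if sym: "\<And>s. icoeff p (d - s) = icoeff p s" "\<And>s. icoeff p (e - s) = icoeff p s"
    for d e
  proof (rule ccontr)
    assume less: "\<not> d \<le> e"
    have "icoeff p (int (degree p) + (d - e)) = icoeff p (int (degree p))"
      using sym(1)[of "e - int (degree p)"] sym(2) by (simp add: algebra_simps)
    moreover have "icoeff p (int (degree p) + (d - e)) = 0"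
      using less by (auto simp: icoeff_def intro!: coeff_eq_0)
    ultimately show False using assms(1) by (simp add: icoeff_def)
  qed
  from this[of d e] this[of e d] show ?thesis using assms(2,3) by fastforce
qed

lemma coeff_mult_mono:
  fixes p q :: "int poly"
  assumes "\<And>i. 0 \<le> coeff p i" "\<And>i. coeff p i \<le> coeff p' i"
    and "\<And>i. 0 \<le> coeff q i" "\<And>i. coeff q i \<le> coeff q' i"
  shows "0 \<le> coeff (p * q) s" "coeff (p * q) s \<le> coeff (p' * q') s"
proof -
  show "0 \<le> coeff (p * q) s" unfolding coeff_mult by (intro sum_nonneg mult_nonneg_nonneg assms)
  have "0 \<le> coeff p' i" for i using assms(1,2) order.trans by blast
  then show "coeff (p * q) s \<le> coeff (p' * q') s"
    unfolding coeff_mult by (intro sum_mono mult_mono assms) auto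
qed

lemma coeff_one_plus_power: "coeff ([:1, 1:] ^ n) i = int (n choose i)"
proof (cases "i \<le> n")
  case True
  then show ?thesis by (simp add: coeff_linear_poly_power)
next
  case False
  then show ?thesis by (simp add: coeff_eq_0 degree_linear_power)
qed

lemma coeff_prod_q_number_le:
  assumes "finite S" "\<And>a. a \<in> S \<Longrightarrow> 0 < n a"
  shows "0 \<le> coeff (\<Prod>a\<in>S. q_number (n a)) s \<and>
    coeff (\<Prod>a\<in>S. q_number (n a)) s \<le> coeff ([:1, 1:] ^ (\<Sum>a\<in>S. n a - 1)) s"
  using assms
proof (induction S arbitrary: s rule: finite_induct)
  case empty
  then show ?case by simp
next
  case (insert a S)
  have "coeff (q_number (n a)) i \<le> coeff ([:1, 1:] ^ (n a - 1)) i" for i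
  proof (cases "i < n a")
    case True
    then have "0 < (n a - 1) choose i" by (intro zero_less_binomial) simp
    then have "1 \<le> int ((n a - 1) choose i)" by linarith
    then show ?thesis using True by (simp only: coeff_q_number coeff_one_plus_power if_True)
  qed (simp add: coeff_q_number coeff_one_plus_power)
  then show ?case
    using coeff_mult_mono[of "q_number (n a)" "[:1, 1:] ^ (n a - 1)" "\<Prod>a\<in>S. q_number (n a)"
        "[:1, 1:] ^ (\<Sum>a\<in>S. n a - 1)" s] insert
    by (simp add: coeff_q_number power_add)
qed

lemma icoeff_prod_q_number_bounds:
  assumes "finite S" "\<And>a. a \<in> S \<Longrightarrow> 0 < n a" "(\<Sum>a\<in>S. n a - 1) \<le> r"
  shows "0 \<le> icoeff (\<Prod>a\<in>S. q_number (n a)) s"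
    and "icoeff (\<Prod>a\<in>S. q_number (n a)) s \<le> int (r choose (r div 2))"
proof -
  let ?e = "\<Sum>a\<in>S. n a - 1"
  have "?e choose i \<le> r choose (r div 2)" for i
    using binomial_right_mono[OF assms(3), of i] binomial_maximum[of r i] by linarith
  then have "coeff ([:1, 1:] ^ ?e) i \<le> int (r choose (r div 2))" for i
    by (simp add: coeff_one_plus_power)
  then show "0 \<le> icoeff (\<Prod>a\<in>S. q_number (n a)) s"
      "icoeff (\<Prod>a\<in>S. q_number (n a)) s \<le> int (r choose (r div 2))"
    using coeff_prod_q_number_le[of S n "nat s", OF assms(1,2)]
    by (auto simp: icoeff_def intro: order.trans)
qed

theorem coefficient_drop_bounds:
  fixes c :: "int \<Rightarrow> int \<Rightarrow> int"
  assumes coeff: "\<And>p q. c p q = (if p + q = D then icoeff P p else 0)"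
    and sym: "\<And>p q. c p q = c q p"
    and P: "P = monom 1 U * ((\<Prod>a\<in>S. q_number (n a)) * q_number (Suc m))"
    and S: "finite S" "\<And>a. a \<in> S \<Longrightarrow> 0 < n a" "(\<Sum>a\<in>S. n a - 1) \<le> r"
    and "q \<le> p"
  shows "c p q - c (p + 1) (q - 1) \<in> {0..int (r choose (r div 2))}"
proof (cases "p + q = D")
  case False
  then show ?thesis by (simp add: coeff)
next
  case True
  define Q where "Q = (\<Prod>a\<in>S. q_number (n a))"
  define e where "e = int (\<Sum>a\<in>S. n a - 1)"
  have Q: "symmetric_unimodal e Q"
    unfolding Q_def e_def by (rule symmetric_unimodal_prod_q_number[OF S(1,2)])
  have bounds: "0 \<le> icoeff Q s" "icoeff Q s \<le> int (r choose (r div 2))" for s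
    unfolding Q_def using icoeff_prod_q_number_bounds[of S n, OF S] by simp_all
  have "P \<noteq> 0" using S by (simp add: P monom_eq_0_iff q_number_nonzero)
  moreover have "icoeff P (D - s) = icoeff P s" for s
    using sym[of s "D - s"] by (simp add: coeff)
  moreover have "icoeff P (2 * int U + e + int m - s) = icoeff P s" for s
  proof -
    have "2 * int U + e + int m - s - int U = e + int m - (s - int U)" by simp
    then show ?thesis
      using symmetric_unimodal_mult_q_number[OF Q, of m]
      by (simp only: P Q_def[symmetric] icoeff_monom_mult symmetric_unimodal_def)
  qed
  ultimately have D: "D = 2 * int U + e + int m" by (rule symmetric_center_unique)
  define s where "s = p - int U"
  have "icoeff P x = icoeff (Q * q_number (Suc m)) (x - int U)" for x
    by (simp add: P Q_def icoeff_monom_mult)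
  then have "c p q - c (p + 1) (q - 1)
      = icoeff (Q * q_number (Suc m)) s - icoeff (Q * q_number (Suc m)) (s + 1)"
    using True by (simp add: coeff s_def algebra_simps)
  also have "\<dots> = icoeff Q (s - int m) - icoeff Q (s + 1)" by (rule icoeff_mult_q_number_diff)
  finally have "c p q - c (p + 1) (q - 1) = icoeff Q (s - int m) - icoeff Q (s + 1)" .
  moreover have "icoeff Q (s + 1) \<le> icoeff Q (s - int m)"
    using True D \<open>q \<le> p\<close> unfolding s_def by (intro symmetric_unimodal_le[OF Q]) auto
  ultimately show ?thesis using bounds[of "s + 1"] bounds[of "s - int m"] by simp
qed

section \<open>Counting midpoints by hops\<close>

lemma vacancies_add_passed:
  assumes inj: "inj_on V A" and step: "pieri_step A V Y" and a: "a \<in> A"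
  shows "card ({V a<..Y a} - V ` A) + card {e \<in> A. V a < V e \<and> Y e < Y a} = Y a - V a"
proof -
  have "V e \<le> Y a \<longleftrightarrow> Y e < Y a" if "e \<in> A" "V a < V e" for e
    using pieri_stepD[OF step a that] pieri_step_le[OF step that(1)] by auto
  then have "V ` {e \<in> A. V a < V e \<and> Y e < Y a} = {V a<..Y a} \<inter> V ` A" by auto
  moreover have "card (V ` {e \<in> A. V a < V e \<and> Y e < Y a}) = card {e \<in> A. V a < V e \<and> Y e < Y a}"
    by (intro card_image inj_on_subset[OF inj]) auto
  ultimately show ?thesis
    using card_Diff_subset_Int[of "{V a<..Y a}" "V ` A"]
      card_mono[of "{V a<..Y a}" "{V a<..Y a} \<inter> V ` A"]
    by simp
qed

lemma hops_add_inversions: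
  assumes "finite A" "inj_on V A" "pieri_step A V Y"
  shows "hops A V Y + card {(a, e) \<in> A \<times> A. V a < V e \<and> Y e < Y a} = (\<Sum>a\<in>A. Y a - V a)"
proof -
  have "{(a, e) \<in> A \<times> A. V a < V e \<and> Y e < Y a} = (SIGMA a:A. {e \<in> A. V a < V e \<and> Y e < Y a})"
    by auto
  then have "card {(a, e) \<in> A \<times> A. V a < V e \<and> Y e < Y a}
      = (\<Sum>a\<in>A. card {e \<in> A. V a < V e \<and> Y e < Y a})"
    using assms(1) by (simp add: card_SigmaI)
  then show ?thesis
    using vacancies_add_passed[OF assms(2,3)] by (simp add: hops_def sum.distrib[symmetric])
qed

context two_pieri_steps
begin

definition total_hops :: nat where
  "total_hops = (\<Sum>a\<in>A. u a - V a) - card {(a, e). overtakes a e}"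

lemma overtakes_inversion_cases:
  assumes Y: "Y \<in> midpoints"
  shows "overtakes a e \<longleftrightarrow>
    a \<in> A \<and> e \<in> A \<and> (V a < V e \<and> Y e < Y a \<or> Y a < Y e \<and> u e < u a)"
proof (cases "a \<in> A \<and> e \<in> A")
  case True
  then consider "V a < V e" | "V e < V a" | "a = e"
    using inj_onD[OF inj_V] by (meson linorder_neqE_nat)
  then show ?thesis
    using midpoints_pair[OF Y, of a e] midpoints_pair[OF Y, of e a] midpoints_le[OF Y, of a]
      midpoints_le[OF Y, of e] True
    by cases (auto simp: overtakes_def stays_below_def jumps_over_def)
qed (auto simp: overtakes_def)

lemma hops_total:
  assumes Y: "Y \<in> midpoints"
  shows "hops A V Y + hops A Y u = total_hops"
proof -
  have steps: "pieri_step A V Y" "pieri_step A Y u" using Y by (auto simp: midpoints_def)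
  let ?first = "{(a, e) \<in> A \<times> A. V a < V e \<and> Y e < Y a}"
  let ?second = "{(a, e) \<in> A \<times> A. Y a < Y e \<and> u e < u a}"
  have "{(a, e). overtakes a e} = ?first \<union> ?second"
    using overtakes_inversion_cases[OF Y] by auto
  moreover have "finite ?first" "finite ?second"
    by (rule finite_subset[of _ "A \<times> A"]; use finite_A in auto)+
  moreover have "?first \<inter> ?second = {}" by auto
  ultimately have "card {(a, e). overtakes a e} = card ?first + card ?second"
    by (simp only: card_Un_disjoint)
  moreover have "(\<Sum>a\<in>A. Y a - V a) + (\<Sum>a\<in>A. u a - Y a) = (\<Sum>a\<in>A. u a - V a)"
    using midpoints_le[OF Y] by (auto simp: sum.distrib[symmetric] intro!: sum.cong)
  ultimately show ?thesis
    using hops_add_inversions[OF finite_A inj_V steps(1)]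
      hops_add_inversions[OF finite_A pieri_step_inj_on[OF steps(1) inj_V] steps(2)]
    by (simp add: total_hops_def)
qed

definition hops_gf :: "(nat \<Rightarrow> nat) set \<Rightarrow> int poly" where
  "hops_gf M = (\<Sum>Y\<in>M. monom 1 (hops A V Y))"

lemma icoeff_hops_gf:
  "finite M \<Longrightarrow> icoeff (hops_gf M) s = int (card {Y \<in> M. int (hops A V Y) = s})"
  by (simp add: hops_gf_def icoeff_sum icoeff_monom flip: sum.inter_filter)

definition midpoint_count :: "int \<Rightarrow> int \<Rightarrow> int" where
  "midpoint_count p q
    = int (card {Y \<in> midpoints. int (hops A V Y) = p \<and> int (hops A Y u) = q})"

lemma midpoint_count_eq_icoeff:
  assumes "M \<subseteq> midpoints"
  shows "int (card {Y \<in> M. int (hops A V Y) = p \<and> int (hops A Y u) = q})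
    = (if p + q = int total_hops then icoeff (hops_gf M) p else 0)"
proof -
  have "int (hops A V Y) = p \<and> int (hops A Y u) = q \<longleftrightarrow>
      p + q = int total_hops \<and> int (hops A V Y) = p" if "Y \<in> M" for Y
    using hops_total[of Y] that assms by auto
  then have "{Y \<in> M. int (hops A V Y) = p \<and> int (hops A Y u) = q}
      = {Y \<in> M. p + q = int total_hops \<and> int (hops A V Y) = p}" by blast
  then show ?thesis
    using finite_subset[OF assms finite_midpoints] by (simp add: icoeff_hops_gf)
qed

lemma hops_gf_prod:
  assumes "midpoints \<noteq> {}" and J: "\<And>a. a \<in> leaders \<Longrightarrow> J a \<subseteq> landings a"
  shows "hops_gf {Y \<in> midpoints. \<forall>a\<in>leaders. Y a \<in> J a}
    = (\<Prod>a\<in>leaders. \<Sum>P\<in>J a. monom 1 (cluster_hops a P))"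
proof -
  have "(\<Prod>a\<in>leaders. \<Sum>P\<in>J a. monom (1 :: int) (cluster_hops a P))
      = (\<Sum>f\<in>PiE leaders J. \<Prod>a\<in>leaders. monom 1 (cluster_hops a (f a)))"
    using finite_subset[OF J finite_landings] by (intro prod_sum_PiE finite_leaders)
  also have "\<dots> = hops_gf {Y \<in> midpoints. \<forall>a\<in>leaders. Y a \<in> J a}"
    unfolding hops_gf_def
    by (subst sum.reindex_bij_betw[OF bij_betw_restrict_leaders[OF assms], symmetric])
       (auto intro!: sum.cong simp: prod_monom hops_eq_cluster_hops)
  finally show ?thesis by simp
qed

lemma hops_gf_leader:
  assumes ne: "midpoints \<noteq> {}" and t: "t \<in> leaders"
  obtains U where "\<And>B. hops_gf {Y \<in> midpoints. Y t \<in> B}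
    = (\<Sum>P\<in>landings t \<inter> B. monom 1 (cluster_hops t P)) *
      (monom 1 U * (\<Prod>a\<in>leaders - {t}. q_number (card (landings a))))"
proof
  fix B
  define J where "J a = (if a = t then landings t \<inter> B else landings a)" for a
  have "{Y \<in> midpoints. Y t \<in> B} = {Y \<in> midpoints. \<forall>a\<in>leaders. Y a \<in> J a}"
    using t by (auto simp: J_def landings_def)
  then have "hops_gf {Y \<in> midpoints. Y t \<in> B}
      = (\<Prod>a\<in>leaders. \<Sum>P\<in>J a. monom 1 (cluster_hops a P))"
    using hops_gf_prod[OF ne, of J] by (simp add: J_def)
  also have "\<dots> = (\<Sum>P\<in>landings t \<inter> B. monom 1 (cluster_hops t P)) *
      (\<Prod>a\<in>leaders - {t}. \<Sum>P\<in>landings a. monom 1 (cluster_hops a P))"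
    using t finite_leaders by (simp add: prod.remove[of leaders t] J_def)
  also have "(\<Prod>a\<in>leaders - {t}. \<Sum>P\<in>landings a. monom (1 :: int) (cluster_hops a P))
      = (\<Prod>a\<in>leaders - {t}. monom 1 (cluster_hops a (Min (landings a))) *
          q_number (card (landings a)))"
    using sum_landings_monom(1)[OF ne] by (intro prod.cong) auto
  also have "\<dots> = monom 1 (\<Sum>a\<in>leaders - {t}. cluster_hops a (Min (landings a))) *
      (\<Prod>a\<in>leaders - {t}. q_number (card (landings a)))"
    by (simp add: prod.distrib prod_monom)
  finally show "hops_gf {Y \<in> midpoints. Y t \<in> B}
    = (\<Sum>P\<in>landings t \<inter> B. monom 1 (cluster_hops t P)) *
      (monom 1 (\<Sum>a\<in>leaders - {t}. cluster_hops a (Min (landings a))) *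
        (\<Prod>a\<in>leaders - {t}. q_number (card (landings a))))" .
qed

lemma sum_landings_monom_extended:
  assumes ne: "midpoints \<noteq> {}" and t: "t \<in> leaders"
  shows "\<exists>m. (\<Sum>P\<in>landings t. monom 1 (cluster_hops t P))
      + monom 1 1 * (\<Sum>P\<in>landings t \<inter> {u t}. monom 1 (cluster_hops t P))
    = monom (1 :: int) (cluster_hops t (Min (landings t))) * q_number (Suc m)"
proof -
  obtain m where m: "card (landings t) = Suc m"
    using card_landings_pos[OF ne, of t] gr0_implies_Suc by blast
  define c where "c = cluster_hops t (Min (landings t))"
  have all: "(\<Sum>P\<in>landings t. monom (1 :: int) (cluster_hops t P)) = monom 1 c * q_number (Suc m)"
    using sum_landings_monom(1)[OF ne t] by (simp add: m c_def)
  show ?thesis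
  proof (cases "u t \<in> landings t")
    case True
    have "P \<le> u t" if "P \<in> landings t" for P
      using that midpoints_le leaders_A[OF t] by (auto simp: landings_def)
    then have "Max (landings t) = u t" using True finite_landings by (intro Max_eqI)
    then have "cluster_hops t (u t) = c + m"
      using sum_landings_monom(2)[OF ne t] by (simp add: m c_def)
    then have "monom 1 1 * (\<Sum>P\<in>landings t \<inter> {u t}. monom (1 :: int) (cluster_hops t P))
        = monom 1 c * monom 1 (Suc m)"
      using True by (simp add: mult_monom One_nat_def)
    then show ?thesis
      unfolding all c_def[symmetric]
      by (intro exI[of _ "Suc m"]) (simp only: q_number_Suc[of "Suc m"] distrib_left)
  next
    case False
    then show ?thesis unfolding all c_def[symmetric] by auto
  qed
qed

lemma hops_gf_factorization:
  assumes ne: "midpoints \<noteq> {}" and t: "t \<in> leaders"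
  defines "Q \<equiv> \<Prod>a\<in>leaders - {t}. q_number (card (landings a))"
  shows "\<exists>U m. hops_gf midpoints = monom 1 U * (Q * q_number (Suc m))"
    and "\<exists>U m. hops_gf midpoints + monom 1 1 * hops_gf {Y \<in> midpoints. Y t = u t}
      = monom 1 U * (Q * q_number (Suc m))"
proof -
  define L where "L B = (\<Sum>P\<in>landings t \<inter> B. monom (1 :: int) (cluster_hops t P))" for B
  obtain U where gf: "\<And>B. hops_gf {Y \<in> midpoints. Y t \<in> B} = L B * (monom 1 U * Q)"
    using hops_gf_leader[OF ne t] unfolding Q_def L_def by blast
  define c where "c = cluster_hops t (Min (landings t))"
  have shift: "monom (1 :: int) (c + U) = monom 1 c * monom 1 U" by (simp add: mult_monom)
  obtain m where "card (landings t) = Suc m"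
    using card_landings_pos[OF ne, of t] gr0_implies_Suc by blast
  then have "L UNIV = monom 1 c * q_number (Suc m)"
    using sum_landings_monom(1)[OF ne t] by (simp add: L_def c_def)
  then have "hops_gf midpoints = monom 1 (c + U) * (Q * q_number (Suc m))"
    using gf[of UNIV] by (simp add: shift mult_ac)
  then show "\<exists>U m. hops_gf midpoints = monom 1 U * (Q * q_number (Suc m))" by blast
  obtain m where "L UNIV + monom 1 1 * L {u t} = monom 1 c * q_number (Suc m)"
    using sum_landings_monom_extended[OF ne t] by (auto simp: L_def c_def)
  then have "(L UNIV + monom 1 1 * L {u t}) * (monom 1 U * Q)
      = monom 1 (c + U) * (Q * q_number (Suc m))"
    by (simp only: shift mult_ac)
  then show "\<exists>U m. hops_gf midpoints + monom 1 1 * hops_gf {Y \<in> midpoints. Y t = u t}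
      = monom 1 U * (Q * q_number (Suc m))"
    using gf[of UNIV] gf[of "{u t}"] by (auto simp: distrib_right mult.assoc)
qed

definition topmost :: "nat \<Rightarrow> bool" where
  "topmost t \<longleftrightarrow> t \<in> moved \<and> (\<forall>e\<in>moved. u e \<le> u t)"

lemma topmost_exists: "moved \<noteq> {} \<Longrightarrow> \<exists>t. topmost t"
proof -
  assume "moved \<noteq> {}"
  moreover have "finite moved" using finite_A by (simp add: moved_def)
  ultimately obtain t where "t \<in> moved" "Max (u ` moved) = u t" by (metis obtains_MAX)
  then show "\<exists>t. topmost t"
    using Max_ge[of "u ` moved"] \<open>finite moved\<close> by (fastforce simp: topmost_def)
qed

lemma topmost_leader:
  assumes Y: "Y \<in> midpoints" and t: "topmost t"
  shows "t \<in> leaders" and "\<And>a. a \<in> leaders \<Longrightarrow> a \<noteq> t \<Longrightarrow> V a < V t"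
proof -
  have "\<not> overtakes b t" for b
  proof
    assume over: "overtakes b t"
    then have "u b \<le> u t" using overtakes_moved[OF Y over] t by (simp add: topmost_def)
    then show False using over by (simp add: overtakes_def)
  qed
  then show leader: "t \<in> leaders" using t by (simp add: leaders_def topmost_def)
  fix a assume a: "a \<in> leaders" "a \<noteq> t"
  have "\<not> V t < V a"
  proof
    assume "V t < V a"
    then have "stays_below Y t a" using leaders_stay_below[OF Y leaders_A[OF leader] a(1)] by blast
    then show False using t a by (auto simp: stays_below_def topmost_def leaders_def not_less)
  qed
  then show "V a < V t" using inj_onD[OF inj_V] leaders_A a leader by (meson linorder_neqE_nat)
qed

lemma sum_landings_topmost_le:
  "Y \<in> midpoints \<Longrightarrow> topmost t \<Longrightarrow>
    (\<Sum>a\<in>leaders - {t}. card (landings a) - 1) \<le> card ({1..<V t} - V ` A)"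
  by (rule sum_landings_le) (use topmost_leader in auto)

theorem midpoint_count_drop:
  assumes sym: "\<And>p q. midpoint_count p q = midpoint_count q p" and "q \<le> p"
    and n: "V ` A \<subseteq> {..n}" "card ({1..n} - V ` A) \<le> r"
  shows "midpoint_count p q - midpoint_count (p + 1) (q - 1) \<in> {0..int (r choose (r div 2))}"
proof (cases "midpoints = {}")
  case True
  then show ?thesis by (simp add: midpoint_count_def)
next
  case False
  then obtain Y where Y: "Y \<in> midpoints" by blast
  have coeff: "midpoint_count p q =
      (if p + q = int total_hops then icoeff (hops_gf midpoints) p else 0)" for p q
    unfolding midpoint_count_def by (rule midpoint_count_eq_icoeff) simp
  show ?thesis
  proof (cases "moved = {}")
    case True
    then have "hops_gf midpoints = monom 1 0 * ((\<Prod>a\<in>{}. q_number 0) * q_number (Suc 0))"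
      using hops_gf_prod[OF False, of landings] by (simp add: leaders_def q_number_def)
    then show ?thesis by (rule coefficient_drop_bounds[OF coeff sym]) (use \<open>q \<le> p\<close> in auto)
  next
    case moved: False
    then obtain t where t: "topmost t" using topmost_exists by blast
    have "V t \<le> n" using n(1) t by (auto simp: topmost_def moved_def)
    then have "card ({1..<V t} - V ` A) \<le> card ({1..n} - V ` A)" by (intro card_mono) auto
    then have "(\<Sum>a\<in>leaders - {t}. card (landings a) - 1) \<le> r"
      using sum_landings_topmost_le[OF Y t] n(2) by linarith
    moreover obtain U m where gf: "hops_gf midpoints
        = monom 1 U * ((\<Prod>a\<in>leaders - {t}. q_number (card (landings a))) * q_number (Suc m))"
      using hops_gf_factorization(1)[OF False topmost_leader(1)[OF Y t]] by blast
    ultimately show ?thesis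
      using card_landings_pos[OF False] finite_leaders \<open>q \<le> p\<close>
      by (intro coefficient_drop_bounds[OF coeff sym gf]) auto
  qed
qed

end

section \<open>Structure constants as midpoint counts\<close>

lemma two_pieri_steps_increasing_after: "V \<in> increasing_after k \<Longrightarrow> two_pieri_steps {1..k} V"
  by (simp add: two_pieri_steps_def increasing_after_inj_on)

lemma schubert_dual_eq_midpoint_count:
  assumes "V \<in> increasing_after k" "u \<in> increasing_after k"
  shows "schubert_dual u (schubert V * hsym k p * hsym k q)
    = two_pieri_steps.midpoint_count {1..k} V u p q"
proof -
  interpret two_pieri_steps "{1..k}" V u by (rule two_pieri_steps_increasing_after[OF assms(1)])
  show ?thesis
    by (simp add: schubert_dual_pieri_twice[OF assms] midpoint_count_def midpoints_def conj_assoc)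
qed

lemma midpoint_count_commute:
  assumes "V \<in> increasing_after k" "u \<in> increasing_after k"
  shows "two_pieri_steps.midpoint_count {1..k} V u p q
    = two_pieri_steps.midpoint_count {1..k} V u q p"
  unfolding schubert_dual_eq_midpoint_count[OF assms, symmetric] by (simp add: mult_ac)

lemma schubert_span_hsym_hsym:
  "V \<in> increasing_after k \<Longrightarrow> schubert V * hsym k p * hsym k q \<in> schubert_span (increasing_after k)"
  by (intro schubert_span_hsym schubert_span.base)

lemma schubert_dual_no_midpoints:
  assumes V: "V \<in> increasing_after k" and none: "two_pieri_steps.midpoints {1..k} V u = {}"
  shows "schubert_dual u (schubert V * hsym k p * hsym k q) = 0"
proof (cases "u \<in> increasing_after k")
  case True
  interpret two_pieri_steps "{1..k}" V u by (rule two_pieri_steps_increasing_after[OF V])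
  show ?thesis
    using schubert_dual_eq_midpoint_count[OF V True] none by (simp add: midpoint_count_def)
next
  case False
  then show ?thesis
    by (intro schubert_dual_not_in_support[OF schubert_span_hsym_hsym[OF V]]
        increasing_after_subset)
qed

lemma schubert_dual_not_above:
  assumes V: "V \<in> increasing_after k" and e: "e \<in> {1..k}" "u e < V e"
  shows "schubert_dual u (schubert V * hsym k p * hsym k q) = 0"
proof (rule schubert_dual_no_midpoints[OF V])
  interpret two_pieri_steps "{1..k}" V u by (rule two_pieri_steps_increasing_after[OF V])
  show "midpoints = {}" using midpoints_le[of _ e] e by fastforce
qed

lemma schubert_mult_jacobi_trudi2:
  "schubert V * jacobi_trudi2 k k p q
    = schubert V * hsym k p * hsym k q - schubert V * hsym k (p + 1) * hsym k (q - 1)"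
  by (simp add: jacobi_trudi2_def algebra_simps)

theorem increasing_after_bound:
  assumes V: "V \<in> increasing_after k" and "q \<le> p"
    and n: "V ` {1..k} \<subseteq> {..n}" "card ({1..n} - V ` {1..k}) \<le> r"
  shows "schubert_dual u (schubert V * jacobi_trudi2 k k p q) \<in> {0..int (r choose (r div 2))}"
proof (cases "u \<in> increasing_after k")
  case True
  interpret two_pieri_steps "{1..k}" V u by (rule two_pieri_steps_increasing_after[OF V])
  show ?thesis
    unfolding schubert_mult_jacobi_trudi2 schubert_dual.diff
      schubert_dual_eq_midpoint_count[OF V True]
    by (rule midpoint_count_drop[OF midpoint_count_commute[OF V True] \<open>q \<le> p\<close> n])
next
  case False
  then have "schubert_dual u (schubert V * jacobi_trudi2 k k p q) = 0"
    unfolding schubert_mult_jacobi_trudi2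
    by (intro schubert_dual_not_in_support[OF _ increasing_after_subset[of k]]
        schubert_span_diff schubert_span_hsym_hsym V)
  then show ?thesis by simp
qed

section \<open>Multiplication by the last variable\<close>

definition hop_preds :: "nat \<Rightarrow> (nat \<Rightarrow> nat) \<Rightarrow> (nat \<Rightarrow> nat) set" where
  "hop_preds k u = {U \<in> increasing_after k. hop_at k U k = u}"

definition cover_preds :: "nat \<Rightarrow> (nat \<Rightarrow> nat) \<Rightarrow> nat set" where
  "cover_preds k u = {a \<in> {1..<k}. a \<in> monk_covers (u \<circ> transpose a k) k}"

lemma next_free_eqI:
  assumes "w r < z" "z \<notin> w ` {1..k}" "{w r<..<z} \<subseteq> w ` {1..k}"
  shows "next_free k w r = z"
  unfolding next_free_def using assms by (intro Least_equality) (auto simp: not_less[symmetric])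

lemma hop_preds_iff:
  assumes u: "u \<in> increasing_after k" and k: "1 \<le> k"
  shows "U \<in> hop_preds k u \<longleftrightarrow> U \<in> increasing_after k \<and> (\<forall>a\<in>{1..<k}. U a = u a) \<and>
    U k < u k \<and> {U k<..<u k} \<subseteq> u ` {1..<k}"
proof (cases "U \<in> increasing_after k \<and> (\<forall>a\<in>{1..<k}. U a = u a)")
  case True
  then have U: "U \<in> increasing_after k" and agree: "\<And>a. a \<in> {1..<k} \<Longrightarrow> U a = u a" by auto
  have ivl: "{1..k} = insert k {1..<k}" using k by auto
  have "U ` {1..<k} = u ` {1..<k}" by (intro image_cong agree refl)
  then have image: "U ` {1..k} = insert (U k) (u ` {1..<k})" by (simp only: ivl image_insert)
  have "hop_at k U k = u \<longleftrightarrow> (\<forall>a\<in>{1..k}. (U(k := next_free k U k)) a = u a)"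
    using hop_at_apply[OF U] increasing_after_eqI[OF hop_at_increasing_after[OF U] u] by metis
  also have "\<dots> \<longleftrightarrow> next_free k U k = u k" using agree by (auto simp: ivl)
  also have "\<dots> \<longleftrightarrow> U k < u k \<and> {U k<..<u k} \<subseteq> u ` {1..<k}"
  proof
    assume eq: "next_free k U k = u k"
    then show "U k < u k \<and> {U k<..<u k} \<subseteq> u ` {1..<k}"
      using next_free_greater[of U k k] below_next_free[of U k _ k] image by auto
  next
    assume range: "U k < u k \<and> {U k<..<u k} \<subseteq> u ` {1..<k}"
    have "u k \<notin> u ` {1..<k}" using increasing_after_eq_iff[OF u] by auto
    then show "next_free k U k = u k" using range image by (intro next_free_eqI) auto
  qed
  finally show ?thesis using True by (simp add: hop_preds_def)
next
  case False
  then show ?thesis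
    using hop_at_apply[of U k _ k] by (auto simp: hop_preds_def)
qed

lemma
  assumes "U \<in> hop_preds k u" "u \<in> increasing_after k" "1 \<le> k"
  shows hop_preds_increasing_after: "U \<in> increasing_after k"
    and hop_preds_agree: "a \<in> {1..<k} \<Longrightarrow> U a = u a"
    and hop_preds_less: "U k < u k"
    and hop_preds_between: "U k < z \<Longrightarrow> z < u k \<Longrightarrow> \<exists>b\<in>{1..<k}. u b = z"
  using assms(1) unfolding hop_preds_iff[OF assms(2,3)] by auto

lemma hop_preds_unique:
  assumes u: "u \<in> increasing_after k" and k: "1 \<le> k"
    and U: "U \<in> hop_preds k u" and U': "U' \<in> hop_preds k u"
  shows "U = U'"
proof -
  have "\<not> x k < y k" if x: "x \<in> hop_preds k u" and y: "y \<in> hop_preds k u" for x y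
  proof
    assume less: "x k < y k"
    have "{x k<..<u k} \<subseteq> u ` {1..<k}" using x by (simp add: hop_preds_iff[OF u k])
    moreover have y': "y \<in> increasing_after k" "y k < u k" and agree: "\<forall>a\<in>{1..<k}. y a = u a"
      using y by (simp_all add: hop_preds_iff[OF u k])
    ultimately have "y k \<in> u ` {1..<k}" using less by auto
    then obtain a where "a \<in> {1..<k}" "y k = u a" by blast
    then show False using agree increasing_after_eq_iff[OF y'(1), of k a] by auto
  qed
  then have "U k = U' k" using U U' by (meson linorder_neqE_nat)
  then show ?thesis
    using U U' unfolding hop_preds_iff[OF u k]
    by (intro increasing_after_eqI[of U k U']) (auto simp: le_less)
qed

lemma hop_preds_exists:
  assumes u: "u \<in> increasing_after k" and k: "1 \<le> k"
    and z: "1 \<le> z" "z < u k" "z \<notin> u ` {1..<k}"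
  shows "hop_preds k u \<noteq> {}"
proof -
  define m where "m = Max ({1..<u k} - u ` {1..<k})"
  have "m \<in> {1..<u k} - u ` {1..<k}" unfolding m_def using z by (intro Max_in) auto
  then have m: "1 \<le> m" "m < u k" "m \<notin> u ` {1..<k}" by auto
  have max: "{m<..<u k} \<subseteq> u ` {1..<k}"
  proof
    fix y assume y: "y \<in> {m<..<u k}"
    show "y \<in> u ` {1..<k}"
    proof (rule ccontr)
      assume "y \<notin> u ` {1..<k}"
      then have "y \<le> m" unfolding m_def using y by (intro Max_ge) auto
      then show False using y by simp
    qed
  qed
  have "{1..k} - {k} = {1..<k}" by auto
  then have front: "front k (u(k := m))"
    using m by (intro front_upd increasing_after_front[OF u]) simp_all
  have "perm_of_front k (u(k := m)) \<in> hop_preds k u"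
    using perm_of_front[OF front] m(2) max k
    by (simp add: hop_preds_iff[OF u k] perm_of_front_apply[OF front])
  then show ?thesis by blast
qed

lemma finite_hop_preds:
  assumes "u \<in> increasing_after k" "1 \<le> k"
  shows "finite (hop_preds k u)"
proof -
  have "hop_preds k u = {} \<or> (\<exists>U. hop_preds k u = {U})"
    using hop_preds_unique[OF assms] by blast
  then show ?thesis by auto
qed

lemma finite_cover_preds: "finite (cover_preds k u)"
  by (simp add: cover_preds_def)

lemma cover_preds_less:
  assumes "b \<in> cover_preds k u"
  shows "b \<in> {1..<k}" "u k < u b"
  using assms by (auto simp: cover_preds_def monk_covers_def)

lemma monk_last:
  assumes "w \<in> increasing_after k" "1 \<le> k"
  shows "X k * schubert w
    = schubert (hop_at k w k) - (\<Sum>a\<in>monk_covers w k. schubert (w \<circ> transpose a k))"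
  using monk[of w k k] assms by (simp add: monk_rule_def)

lemma schubert_span_X_last:
  assumes "f \<in> schubert_span (increasing_after k)" "1 \<le> k"
  shows "X k * f \<in> schubert_span (increasing_after k)"
proof -
  have "f * X k \<in> schubert_span (increasing_after k)"
    using assms(1)
  proof (rule schubert_span_mult)
    fix w assume w: "w \<in> increasing_after k"
    have "a \<in> {1..k}" if "a \<in> monk_covers w k" for a using monk_covers_less[OF that] by simp
    then have "schubert (hop_at k w k) - (\<Sum>a\<in>monk_covers w k. schubert (w \<circ> transpose a k))
        \<in> schubert_span (increasing_after k)"
      using assms(2)
      by (intro schubert_span_diff schubert_span_sum schubert_span.base
          hop_at_increasing_after increasing_after_comp_transpose w) auto
    then show "schubert w * X k \<in> schubert_span (increasing_after k)"
      by (simp add: monk_last[OF w assms(2)] mult.commute)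
  qed
  then show ?thesis by (simp add: mult.commute)
qed

theorem schubert_dual_X_last:
  assumes "f \<in> schubert_span (increasing_after k)" and u: "u \<in> increasing_after k" and k: "1 \<le> k"
  shows "schubert_dual u (X k * f) = (\<Sum>U\<in>hop_preds k u. schubert_dual U f)
    - (\<Sum>a\<in>cover_preds k u. schubert_dual (u \<circ> transpose a k) f)"
  using assms(1)
proof induction
  case (base U)
  note dual = schubert_dual_schubert[OF increasing_after_finitary]
  have "schubert_dual u (schubert (hop_at k U k)) = (if U \<in> hop_preds k u then 1 else 0)"
    using base by (simp add: dual[OF hop_at_increasing_after[OF base]] hop_preds_def)
  also have "\<dots> = (\<Sum>U'\<in>hop_preds k u. schubert_dual U' (schubert U))"
    by (simp add: dual[OF base] finite_hop_preds[OF u k])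
  finally have hops: "schubert_dual u (schubert (hop_at k U k)) = \<dots>" .
  have "schubert_dual u (schubert (U \<circ> transpose a k)) = (if U = u \<circ> transpose a k then 1 else 0)"
    if "a \<in> monk_covers U k" for a
    using monk_covers_less[OF that] k
    by (simp add: dual[OF increasing_after_comp_transpose[OF base]] comp_transpose_eq_iff)
  then have "schubert_dual u (\<Sum>a\<in>monk_covers U k. schubert (U \<circ> transpose a k))
      = (\<Sum>a\<in>monk_covers U k. if U = u \<circ> transpose a k then 1 else 0)"
    by (simp add: schubert_dual.sum)
  also have "\<dots> = int (card {a \<in> monk_covers U k. U = u \<circ> transpose a k})"
    by (simp add: finite_monk_covers flip: sum.inter_filter)
  also have "{a \<in> monk_covers U k. U = u \<circ> transpose a k}
      = {a \<in> cover_preds k u. U = u \<circ> transpose a k}"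
    using monk_covers_less[of _ U k] by (auto simp: cover_preds_def)
  also have "int (card \<dots>) = (\<Sum>a\<in>cover_preds k u. schubert_dual (u \<circ> transpose a k) (schubert U))"
    by (simp add: dual[OF base] finite_cover_preds flip: sum.inter_filter)
  finally show ?case using hops by (simp add: monk_last[OF base k] schubert_dual.diff del: o_apply)
qed (simp_all add: schubert_dual.zero schubert_dual.add schubert_dual.minus sum.distrib
    distrib_left sum_negf)

subsection \<open>Pieri steps into a predecessor\<close>

lemma pieri_step_target_eq:
  assumes step: "pieri_step A Y u" and inj: "inj_on Y A" and b: "b \<in> A" and e: "e \<in> A"
    and eq: "u b = Y e"
  shows "b = e"
proof (rule ccontr)
  assume "b \<noteq> e"
  then have "Y b < Y e"
    using pieri_step_le[OF step b] eq inj_onD[OF inj _ b e] by fastforce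
  then show False using pieri_stepD[OF step b e] eq by auto
qed

lemma pieri_step_last:
  assumes "1 \<le> k"
  shows "pieri_step {1..k} Y u \<longleftrightarrow> pieri_step {1..<k} Y u \<and> Y k \<le> u k \<and>
    (\<forall>a\<in>{1..<k}. Y a < Y k \<longrightarrow> u a < Y k) \<and>
    (\<forall>e\<in>{1..<k}. Y k < Y e \<longrightarrow> u k < Y e \<or> (u e = Y e \<and> Y e < u k))"
proof -
  have "{1..k} = insert k {1..<k}" using assms by auto
  then show ?thesis using pieri_step_insert_last[of "{1..<k}" k Y u] by (simp only:) simp
qed

lemma pieri_step_hop_preds_last:
  assumes "U \<in> hop_preds k u" "u \<in> increasing_after k" "1 \<le> k"
  shows "pieri_step {1..k} Y U \<longleftrightarrow> pieri_step {1..<k} Y u \<and> Y k \<le> U k \<and>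
    (\<forall>a\<in>{1..<k}. Y a < Y k \<longrightarrow> u a < Y k) \<and>
    (\<forall>e\<in>{1..<k}. Y k < Y e \<longrightarrow> U k < Y e \<or> (u e = Y e \<and> Y e < U k))"
proof -
  note agree = hop_preds_agree[OF assms]
  have "pieri_step {1..<k} Y U \<longleftrightarrow> pieri_step {1..<k} Y u"
    using agree by (intro pieri_step_cong) auto
  moreover have "(\<forall>a\<in>{1..<k}. Y a < Y k \<longrightarrow> U a < Y k) \<longleftrightarrow> (\<forall>a\<in>{1..<k}. Y a < Y k \<longrightarrow> u a < Y k)"
    using agree by (intro ball_cong) simp_all
  moreover have "(\<forall>e\<in>{1..<k}. Y k < Y e \<longrightarrow> U k < Y e \<or> (U e = Y e \<and> Y e < U k))
      \<longleftrightarrow> (\<forall>e\<in>{1..<k}. Y k < Y e \<longrightarrow> U k < Y e \<or> (u e = Y e \<and> Y e < U k))"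
    using agree by (intro ball_cong) simp_all
  ultimately show ?thesis unfolding pieri_step_last[OF assms(3), of Y U] by blast
qed

text \<open>
  All places between the two possible endpoints of the last particle are endpoints of other
  particles, so a particle that reaches such a place rests there.
\<close>

lemma hop_preds_rests:
  assumes U: "U \<in> hop_preds k u" and u: "u \<in> increasing_after k" and k: "1 \<le> k"
    and step: "pieri_step {1..<k} Y u" and inj: "inj_on Y {1..<k}"
    and resting: "u k < u e \<Longrightarrow> u e \<le> Y e" and e: "e \<in> {1..<k}" "U k < Y e"
  shows "u k < Y e \<or> (u e = Y e \<and> Y e < u k)"
proof (cases "u k < u e")
  case True
  then show ?thesis using resting by simp
next
  case False
  then have "Y e < u k"
    using pieri_step_le[OF step e(1)] increasing_after_eq_iff[OF u, of e k] e(1)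
    by (auto simp: not_less le_less)
  moreover obtain b where b: "b \<in> {1..<k}" "u b = Y e"
    using hop_preds_between[OF U u k e(2) calculation] by blast
  moreover have "b = e" by (rule pieri_step_target_eq[OF step inj b(1) e(1) b(2)])
  ultimately show ?thesis by simp
qed

lemma pieri_step_hop_preds:
  assumes U: "U \<in> hop_preds k u" and u: "u \<in> increasing_after k" and k: "1 \<le> k"
    and inj: "inj_on Y {1..k}" and resting: "\<And>a. a \<in> {1..<k} \<Longrightarrow> u k < u a \<Longrightarrow> u a \<le> Y a"
  shows "pieri_step {1..k} Y U \<longleftrightarrow> pieri_step {1..k} Y u \<and> Y k \<noteq> u k"
proof
  note less = hop_preds_less[OF U u k]
  assume step: "pieri_step {1..k} Y U"
  note last = step[unfolded pieri_step_hop_preds_last[OF U u k]]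
  have inj': "inj_on Y {1..<k}" using inj by (rule inj_on_subset) auto
  have "u k < Y e \<or> (u e = Y e \<and> Y e < u k)" if "e \<in> {1..<k}" "Y k < Y e" for e
  proof (cases "U k < Y e")
    case True
    then show ?thesis using hop_preds_rests[OF U u k _ inj' resting that(1)] last that(1) by blast
  next
    case False
    then show ?thesis using last that less by force
  qed
  then show "pieri_step {1..k} Y u \<and> Y k \<noteq> u k"
    using last less unfolding pieri_step_last[OF k, of Y u] by simp
next
  assume "pieri_step {1..k} Y u \<and> Y k \<noteq> u k"
  then have step: "pieri_step {1..k} Y u" and "Y k \<noteq> u k" by simp_all
  note last = step[unfolded pieri_step_last[OF k]]
  have "Y k \<le> U k"
  proof (rule ccontr)
    assume "\<not> Y k \<le> U k"
    then obtain b where b: "b \<in> {1..<k}" "u b = Y k"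
      using hop_preds_between[OF U u k, of "Y k"] last \<open>Y k \<noteq> u k\<close> by force
    then have "b = k" using pieri_step_target_eq[OF step inj _ _ b(2)] k by simp
    then show False using b(1) by simp
  qed
  moreover have "U k < Y e \<or> (u e = Y e \<and> Y e < U k)" if e: "e \<in> {1..<k}" "Y k < Y e" for e
  proof -
    have "u e \<noteq> U k"
      using e(1) hop_preds_agree[OF U u k e(1)]
        increasing_after_eq_iff[OF hop_preds_increasing_after[OF U u k], of e k] by auto
    then show ?thesis using last e hop_preds_less[OF U u k] by force
  qed
  ultimately show "pieri_step {1..k} Y U"
    using last unfolding pieri_step_hop_preds_last[OF U u k] by simp
qed

lemma hops_hop_preds:
  assumes U: "U \<in> hop_preds k u" and u: "u \<in> increasing_after k" and k: "1 \<le> k"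
    and inj: "inj_on Y {1..k}" and steps: "pieri_step {1..k} Y u" "pieri_step {1..k} Y U"
  shows "hops {1..k} Y u = Suc (hops {1..k} Y U)"
proof -
  note less = hop_preds_less[OF U u k]
  have last: "k \<in> {1..k}" and le: "Y k \<le> U k" using k pieri_step_le[OF steps(2), of k] by auto
  have "z \<in> Y ` {1..k}" if z: "U k < z" "z < u k" for z
  proof -
    obtain b where b: "b \<in> {1..<k}" "u b = z" using hop_preds_between[OF U u k z] by blast
    have "\<not> Y b < u b"
    proof
      assume "Y b < u b"
      moreover have "Y b \<noteq> Y k" using inj_onD[OF inj, of b k] b(1) by auto
      ultimately show False
        using steps(1) b z le unfolding pieri_step_last[OF k] by (force simp: nat_neq_iff)
    qed
    then have "Y b = u b" using pieri_step_le[OF steps(1), of b] b(1) by simp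
    then show ?thesis using b by (intro image_eqI[of _ _ b]) auto
  qed
  moreover have "u k \<notin> Y ` {1..k}"
  proof
    assume "u k \<in> Y ` {1..k}"
    then obtain e where e: "e \<in> {1..k}" "u k = Y e" by blast
    then have "k = e" by (intro pieri_step_target_eq[OF steps(1) inj last])
    then show False using e le less by simp
  qed
  ultimately have "{Y k<..u k} - Y ` {1..k} = insert (u k) ({Y k<..U k} - Y ` {1..k})"
    using le less by (auto simp: not_le le_less)
  moreover have "(\<Sum>a\<in>{1..k} - {k}. card ({Y a<..u a} - Y ` {1..k}))
      = (\<Sum>a\<in>{1..k} - {k}. card ({Y a<..U a} - Y ` {1..k}))"
    using hop_preds_agree[OF U u k] by (intro sum.cong) auto
  ultimately show ?thesis using less unfolding hops_def by (simp add: sum.remove[OF _ last])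
qed

section \<open>A front with one missing value\<close>

locale gapped_front =
  fixes k j :: nat and V :: "nat \<Rightarrow> nat"
  assumes k: "1 \<le> k" and V: "V \<in> increasing_after k"
    and image_V: "V ` {1..k} = {1..Suc k} - {j}" and j: "1 \<le> j" "j < V k"
begin

sublocale steps: two_pieri_steps "{1..k}" V u for u
  by (rule two_pieri_steps_increasing_after[OF V])

definition product :: "int \<Rightarrow> int \<Rightarrow> zpoly" where
  "product p q = schubert V * hsym k p * hsym k q"

text \<open>
  Dropping the last variable from both factors subtracts \<open>X k\<close> times this polynomial.
\<close>

definition cofactor :: "int \<Rightarrow> int \<Rightarrow> zpoly" where
  "cofactor p q = product (p - 1) q + product p (q - 1) - X k * product (p - 1) (q - 1)"

lemma product_commute: "product p q = product q p"
  by (simp add: product_def mult_ac)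

lemma cofactor_commute: "cofactor p q = cofactor q p"
  by (simp add: cofactor_def product_commute[of q] product_commute[of "q - 1"])

lemma product_span: "product p q \<in> schubert_span (increasing_after k)"
  unfolding product_def by (rule schubert_span_hsym_hsym[OF V])

lemma cofactor_span: "cofactor p q \<in> schubert_span (increasing_after k)"
  unfolding cofactor_def
  by (intro schubert_span_diff schubert_span.add schubert_span_X_last product_span k)

lemma V_le: "a \<in> {1..k} \<Longrightarrow> V a \<le> Suc k"
  using imageI[of a "{1..k}" V] unfolding image_V by simp

lemma V_neq_last: "a \<in> {1..<k} \<Longrightarrow> V a \<noteq> V k"
  using increasing_after_eq_iff[OF V, of a k] by simp

lemma beyond_gap: "V k < z \<Longrightarrow> z \<notin> V ` {1..k} \<Longrightarrow> Suc k < z"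
  using j unfolding image_V by auto

lemma product_no_midpoints: "steps.midpoints u = {} \<Longrightarrow> schubert_dual u (product p q) = 0"
  unfolding product_def by (rule schubert_dual_no_midpoints[OF V])

lemma product_not_above: "e \<in> {1..k} \<Longrightarrow> u e < V e \<Longrightarrow> schubert_dual u (product p q) = 0"
  unfolding product_def by (rule schubert_dual_not_above[OF V])

lemma card_missing_le:
  assumes "A \<subseteq> {1..Suc k}"
  shows "card (A - V ` {1..k}) \<le> 1"
proof -
  have "A - V ` {1..k} \<subseteq> {j}" using assms unfolding image_V by blast
  then have "card (A - V ` {1..k}) \<le> card {j}" by (rule card_mono[rotated]) simp
  then show ?thesis by simp
qed

lemma product_drop:
  assumes "q \<le> p"
  shows "schubert_dual u (product p q) - schubert_dual u (product (p + 1) (q - 1)) \<in> {0..1}"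
proof -
  have "V ` {1..k} \<subseteq> {..Suc k}" unfolding image_V by auto
  then show ?thesis
    using increasing_after_bound[OF V assms, of "Suc k" 1 u] card_missing_le[OF order_refl]
    by (simp add: schubert_mult_jacobi_trudi2 schubert_dual.diff product_def)
qed

lemma dual_cofactor:
  assumes "u \<in> increasing_after k"
  shows "schubert_dual u (cofactor p q)
    = schubert_dual u (product (p - 1) q) + schubert_dual u (product p (q - 1))
      - (\<Sum>U\<in>hop_preds k u. schubert_dual U (product (p - 1) (q - 1)))
      + (\<Sum>b\<in>cover_preds k u. schubert_dual (u \<circ> transpose b k) (product (p - 1) (q - 1)))"
  by (simp add: cofactor_def schubert_dual.add schubert_dual.diff
      schubert_dual_X_last[OF product_span assms k])

definition blocked :: "(nat \<Rightarrow> nat) \<Rightarrow> bool" where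
  "blocked u \<longleftrightarrow> (\<exists>c\<in>{1..<k}. V c < V k \<and> V k \<le> u c)"

lemma topmost_lastI:
  "V k < u k \<Longrightarrow> (\<And>e. e \<in> {1..<k} \<Longrightarrow> u e \<le> u k) \<Longrightarrow> steps.topmost u k"
  using k by (force simp: steps.topmost_def steps.moved_def le_less)

subsection \<open>Unblocked endpoints\<close>

lemma hop_no_midpoints:
  assumes unblocked: "\<not> blocked u" and not_top: "\<not> steps.topmost u k"
  shows "two_pieri_steps.midpoints {1..k} (hop_at k V k) u = {}"
proof (rule equals0I)
  let ?V = "hop_at k V k"
  interpret hop: two_pieri_steps "{1..k}" ?V u
    by (rule two_pieri_steps_increasing_after[OF hop_at_increasing_after[OF V]])
  have last: "k \<in> {1..k}" using k by simp
  have V_last: "?V k = next_free k V k" using hop_at_apply[OF V last] by simp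
  then have beyond: "Suc k < ?V k"
    using next_free_greater[of V k k] next_free_notin[of k V k] by (simp add: beyond_gap)
  have agree: "?V e = V e" if "e \<in> {1..<k}" for e using hop_at_apply[OF V, of e] that by simp
  fix Y assume Y: "Y \<in> hop.midpoints"
  have "?V k \<le> u k" using hop.midpoints_le[OF Y last] by simp
  then have "V k < u k" using V_le[OF last] beyond by simp
  then obtain e where e: "e \<in> {1..<k}" "u k < u e" using not_top topmost_lastI not_le by blast
  have "\<not> V e < V k" using unblocked e \<open>V k < u k\<close> by (force simp: blocked_def)
  then have "hop.overtakes e k"
    using e agree V_le[of e] beyond by (simp add: hop.overtakes_def)
  then show False using hop.midpoints_jumps_over[OF Y] e by (fastforce simp: hop.jumps_over_def)
qed

lemma dual_X_last_product_unblocked: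
  assumes "\<not> blocked u" "\<not> steps.topmost u k"
  shows "schubert_dual u (X k * product p q) = 0"
proof -
  have "schubert_dual u (schubert (hop_at k V k) * hsym k p * hsym k q) = 0"
    by (intro schubert_dual_no_midpoints hop_no_midpoints hop_at_increasing_after V assms)
  moreover have "schubert_dual u (schubert (V \<circ> transpose a k) * hsym k p * hsym k q) = 0"
    if a: "a \<in> monk_covers V k" for a
  proof (rule schubert_dual_not_above)
    have "a \<in> {1..<k}" "V a < V k" using a by (auto simp: monk_covers_def)
    then show "V \<circ> transpose a k \<in> increasing_after k" "a \<in> {1..k}" "u a < (V \<circ> transpose a k) a"
      using assms(1) V k by (auto simp: blocked_def not_le intro!: increasing_after_comp_transpose)
  qed
  moreover have "X k * product p q = schubert (hop_at k V k) * hsym k p * hsym k q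
      - (\<Sum>a\<in>monk_covers V k. schubert (V \<circ> transpose a k) * hsym k p * hsym k q)"
    unfolding product_def mult.assoc[symmetric] monk_last[OF V k]
    by (simp only: left_diff_distrib sum_distrib_right)
  ultimately show ?thesis by (simp add: schubert_dual.diff schubert_dual.sum del: o_apply)
qed

lemma cofactor_drop_unblocked:
  assumes "\<not> blocked u" "\<not> steps.topmost u k" and "q \<le> p"
  shows "schubert_dual u (cofactor p q) - schubert_dual u (cofactor (p + 1) (q - 1)) \<in> {0..2}"
proof -
  have cofactor: "schubert_dual u (cofactor p q)
      = schubert_dual u (product (p - 1) q) + schubert_dual u (product p (q - 1))" for p q
    using dual_X_last_product_unblocked[OF assms(1,2)]
    by (simp add: cofactor_def schubert_dual.add schubert_dual.diff)
  have "schubert_dual u (product (p - 1) q) - schubert_dual u (product p (q - 1)) \<in> {0..1}"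
  proof (cases "q = p")
    case True
    then show ?thesis by (simp add: product_commute[of "p - 1"])
  next
    case False
    then show ?thesis using product_drop[of q "p - 1" u] assms(3) by simp
  qed
  moreover have "schubert_dual u (product p (q - 1))
      - schubert_dual u (product (p + 1) (q - 1 - 1)) \<in> {0..1}"
    using assms(3) by (intro product_drop) simp
  ultimately show ?thesis by (simp add: cofactor)
qed

subsection \<open>Blocked endpoints\<close>

lemma blocked_last:
  assumes Y: "Y \<in> steps.midpoints s" and "blocked s"
  shows "V k < s k" and "\<And>e. e \<in> {1..<k} \<Longrightarrow> s e < s k"
proof -
  have last: "k \<in> {1..k}" using k by simp
  obtain c where c: "c \<in> {1..<k}" "V c < V k" "V k \<le> s c"
    using assms(2) by (auto simp: blocked_def)
  have stays: "steps.stays_below s Y e k" if "e \<in> {1..<k}" "V e < V k" for e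
    using steps.midpoints_pair[OF Y _ last that(2)] that by (auto simp: steps.jumps_over_def)
  then have jumped: "V k < Y k" using c by (force simp: steps.stays_below_def)
  then have beyond: "Suc k < Y k" using beyond_gap steps.landing_vacant[OF Y last] by blast
  have le: "Y k \<le> s k" using steps.midpoints_le[OF Y last] by simp
  then show "V k < s k" using jumped by simp
  fix e assume e: "e \<in> {1..<k}"
  consider (below) "V e < V k" | (above) "V k < V e" using V_neq_last[OF e] by linarith
  then have "s e < Y k"
  proof cases
    case below
    then show ?thesis using stays[OF e] by (simp add: steps.stays_below_def)
  next
    case above
    then show ?thesis
      using steps.midpoints_pair[OF Y last _ above] V_le[of e] beyond e
      by (auto simp: steps.stays_below_def steps.jumps_over_def)
  qed
  then show "s e < s k" using le by simp
qed

lemma blocked_topmost: "Y \<in> steps.midpoints s \<Longrightarrow> blocked s \<Longrightarrow> steps.topmost s k"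
  using blocked_last[of Y s] by (intro topmost_lastI) (auto intro: less_imp_le)

lemma blocked_cover_max:
  assumes b: "b \<in> cover_preds k u" and "steps.midpoints (u \<circ> transpose b k) \<noteq> {}"
    and "blocked (u \<circ> transpose b k)" and e: "e \<in> {1..<k}" "e \<noteq> b"
  shows "u e < u b"
  using assms(2) blocked_last(2)[OF _ assms(3) e(1)] e
  by (auto simp: transpose_def split: if_splits)

lemma blocked_cover_unique:
  assumes "blocked u"
    and b: "b \<in> cover_preds k u" "steps.midpoints (u \<circ> transpose b k) \<noteq> {}"
    and b': "b' \<in> cover_preds k u" "steps.midpoints (u \<circ> transpose b' k) \<noteq> {}"
  shows "b = b'"
proof (rule ccontr)
  assume neq: "b \<noteq> b'"
  obtain c where c: "c \<in> {1..<k}" "V c < V k" "V k \<le> u c" using assms(1) by (auto simp: blocked_def)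
  have still_blocked: "blocked (u \<circ> transpose a k)" if "a \<noteq> c" for a
    using c that by (force simp: blocked_def transpose_def)
  have contra: False
    if a: "a \<in> cover_preds k u" "steps.midpoints (u \<circ> transpose a k) \<noteq> {}" and "c \<noteq> a"
      and c': "c \<in> cover_preds k u" "steps.midpoints (u \<circ> transpose c k) \<noteq> {}" for a
  proof -
    note less = cover_preds_less[OF a(1)]
    have "u c < u a" using blocked_cover_max[OF a still_blocked] \<open>c \<noteq> a\<close> c(1) by blast
    obtain Z where "Z \<in> steps.midpoints (u \<circ> transpose a k)" using a(2) by blast
    then have "V a \<le> u k" using steps.midpoints_le[of Z "u \<circ> transpose a k" a] less by auto
    have "blocked (u \<circ> transpose c k)"
    proof (cases "V a < V k")
      case True
      then show ?thesis
        using less c \<open>u c < u a\<close> \<open>c \<noteq> a\<close> by (force simp: blocked_def transpose_def)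
    next
      case False
      then have "V k \<le> u k" using \<open>V a \<le> u k\<close> by simp
      then show ?thesis using c by (force simp: blocked_def transpose_def)
    qed
    then have "u a < u c" using blocked_cover_max[OF c' _ less(1)] \<open>c \<noteq> a\<close> by blast
    then show False using \<open>u c < u a\<close> by simp
  qed
  consider "c = b" | "c = b'" | (neither) "c \<noteq> b" "c \<noteq> b'" by blast
  then show False
  proof cases
    case neither
    then have "u b' < u b" "u b < u b'"
      using blocked_cover_max[OF b still_blocked] blocked_cover_max[OF b' still_blocked] neq
        cover_preds_less(1)[OF b(1)] cover_preds_less(1)[OF b'(1)] by blast+
    then show False by simp
  qed (use contra b b' neq in blast)+
qed

lemma hop_preds_blocked_no_midpoints:
  assumes u: "u \<in> increasing_after k" and "blocked u" and "\<not> steps.topmost u k"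
    and U: "U \<in> hop_preds k u"
  shows "steps.midpoints U = {}"
proof (rule equals0I)
  note agree = hop_preds_agree[OF U u k] and less = hop_preds_less[OF U u k]
  fix Y assume Y: "Y \<in> steps.midpoints U"
  have "blocked U" using assms(2) agree by (auto simp: blocked_def)
  note last = blocked_last[OF Y this]
  have "u e \<le> u k" if "e \<in> {1..<k}" for e using last(2)[OF that] agree[OF that] less by simp
  then show False using topmost_lastI[of u] last(1) less assms(3) by simp
qed

lemma cofactor_drop_blocked:
  assumes u: "u \<in> increasing_after k" and blocked: "blocked u"
    and not_top: "\<not> steps.topmost u k" and "q \<le> p"
  shows "schubert_dual u (cofactor p q) - schubert_dual u (cofactor (p + 1) (q - 1)) \<in> {0..1}"
proof -
  let ?C = "{b \<in> cover_preds k u. steps.midpoints (u \<circ> transpose b k) \<noteq> {}}"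
  have "schubert_dual u (product p q) = 0" for p q
    using blocked_topmost blocked not_top by (intro product_no_midpoints) blast
  moreover have "schubert_dual U (product p q) = 0" if "U \<in> hop_preds k u" for U p q
    by (intro product_no_midpoints hop_preds_blocked_no_midpoints[OF u blocked not_top that])
  moreover have "(\<Sum>b\<in>cover_preds k u. schubert_dual (u \<circ> transpose b k) (product p q))
      = (\<Sum>b\<in>?C. schubert_dual (u \<circ> transpose b k) (product p q))" for p q
    using product_no_midpoints
    by (intro sum.mono_neutral_right) (auto simp: finite_cover_preds simp del: o_apply)
  ultimately have cofactor: "schubert_dual u (cofactor p q)
      = (\<Sum>b\<in>?C. schubert_dual (u \<circ> transpose b k) (product (p - 1) (q - 1)))" for p q
    by (simp add: dual_cofactor[OF u] del: o_apply)
  have "?C = {} \<or> (\<exists>b. ?C = {b})" using blocked_cover_unique[OF blocked] by blast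
  then show ?thesis
  proof
    assume "?C = {}"
    then show ?thesis by (simp only: cofactor sum.empty) simp
  next
    assume "\<exists>b. ?C = {b}"
    then obtain b where "?C = {b}" by blast
    then have "schubert_dual u (cofactor p q)
        = schubert_dual (u \<circ> transpose b k) (product (p - 1) (q - 1))" for p q
      by (simp only: cofactor) simp
    then show ?thesis
      using product_drop[of "q - 1" "p - 1" "u \<circ> transpose b k"] \<open>q \<le> p\<close> by (simp del: o_apply)
  qed
qed

subsection \<open>Endpoints with the last position on top\<close>

context
  fixes u
  assumes u: "u \<in> increasing_after k" and top: "steps.topmost u k"
begin

lemma topmost_rests:
  assumes "a \<in> {1..<k}" "u k < u a"
  shows "u a \<le> V a"
  using top assms unfolding steps.topmost_def steps.moved_def by force

lemma topmost_cover_preds: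
  assumes "b \<in> cover_preds k u"
  shows "schubert_dual (u \<circ> transpose b k) (product p q) = 0"
proof (rule product_not_above)
  note b = cover_preds_less[OF assms]
  then show "b \<in> {1..k}" "(u \<circ> transpose b k) b < V b" using topmost_rests[OF b] by auto
qed

lemma midpoints_inj_on: "Y \<in> steps.midpoints s \<Longrightarrow> inj_on Y {1..k}"
  using pieri_step_inj_on[OF _ increasing_after_inj_on[OF V]] by (auto simp: steps.midpoints_def)

lemma topmost_hop_preds_midpoints:
  assumes U: "U \<in> hop_preds k u"
  shows "steps.midpoints U = {Y \<in> steps.midpoints u. Y k \<noteq> u k}"
proof -
  have "pieri_step {1..k} Y U \<longleftrightarrow> pieri_step {1..k} Y u \<and> Y k \<noteq> u k"
    if first: "pieri_step {1..k} V Y" for Y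
  proof (rule pieri_step_hop_preds[OF U u k])
    show "inj_on Y {1..k}" by (rule pieri_step_inj_on[OF first increasing_after_inj_on[OF V]])
    fix a assume a: "a \<in> {1..<k}" "u k < u a"
    then show "u a \<le> Y a" using pieri_step_le[OF first, of a] topmost_rests[OF a] by simp
  qed
  then show ?thesis by (auto simp: steps.midpoints_def)
qed

lemma topmost_hop_preds_exists:
  assumes Y: "Y \<in> steps.midpoints u" "Y k \<noteq> u k"
  shows "hop_preds k u \<noteq> {}"
proof (rule hop_preds_exists[OF u k])
  have last: "k \<in> {1..k}" using k by simp
  show "1 \<le> Y k" "Y k < u k" using steps.midpoints_le[OF Y(1) last] Y(2) j by auto
  have second: "pieri_step {1..k} Y u" using Y by (simp add: steps.midpoints_def)
  show "Y k \<notin> u ` {1..<k}"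
  proof
    assume "Y k \<in> u ` {1..<k}"
    then obtain b where b: "b \<in> {1..<k}" "u b = Y k" by auto
    then have "b = k"
      using pieri_step_target_eq[OF second midpoints_inj_on[OF Y(1)] _ last b(2)] by simp
    then show False using b(1) by simp
  qed
qed

lemma topmost_hop_preds_sum:
  "(\<Sum>U\<in>hop_preds k u. schubert_dual U (product p q)) = int (card {Y \<in> steps.midpoints u.
    Y k \<noteq> u k \<and> int (hops {1..k} V Y) = p \<and> int (hops {1..k} Y u) = q + 1})"
proof (cases "hop_preds k u = {}")
  case True
  then have "{Y \<in> steps.midpoints u.
      Y k \<noteq> u k \<and> int (hops {1..k} V Y) = p \<and> int (hops {1..k} Y u) = q + 1} = {}"
    using topmost_hop_preds_exists by blast
  then show ?thesis using True by (simp only: sum.empty card.empty of_nat_0)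
next
  case False
  then obtain U where U: "U \<in> hop_preds k u" by blast
  then have single: "hop_preds k u = {U}" using hop_preds_unique[OF u k] by blast
  have "int (hops {1..k} Y u) = q + 1 \<longleftrightarrow> int (hops {1..k} Y U) = q"
    if "Y \<in> steps.midpoints u" "Y k \<noteq> u k" for Y
  proof -
    have "Y \<in> steps.midpoints U" using topmost_hop_preds_midpoints[OF U] that by simp
    then have "hops {1..k} Y u = Suc (hops {1..k} Y U)"
      using that(1) midpoints_inj_on
      by (intro hops_hop_preds[OF U u k]) (auto simp: steps.midpoints_def)
    then show ?thesis by simp
  qed
  then have "{Y \<in> steps.midpoints U. int (hops {1..k} V Y) = p \<and> int (hops {1..k} Y U) = q}
      = {Y \<in> steps.midpoints u.
          Y k \<noteq> u k \<and> int (hops {1..k} V Y) = p \<and> int (hops {1..k} Y u) = q + 1}"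
    unfolding topmost_hop_preds_midpoints[OF U] by blast
  then show ?thesis
    using schubert_dual_eq_midpoint_count[OF V hop_preds_increasing_after[OF U u k]]
    by (simp add: single product_def steps.midpoint_count_def)
qed

lemma dual_cofactor_topmost:
  "schubert_dual u (cofactor p q) = (if p + q = int (steps.total_hops u) + 1
    then icoeff (steps.hops_gf (steps.midpoints u)
      + monom 1 1 * steps.hops_gf {Y \<in> steps.midpoints u. Y k = u k}) p
    else 0)"
proof -
  define count where
    "count M p q = int (card {Y \<in> M. int (hops {1..k} V Y) = p \<and> int (hops {1..k} Y u) = q})"
    for M p q
  define M where "M = steps.midpoints u"
  let ?at = "{Y \<in> M. Y k = u k}" and ?below = "{Y \<in> M. Y k \<noteq> u k}"
  have count: "count N p q =
      (if p + q = int (steps.total_hops u) then icoeff (steps.hops_gf N) p else 0)"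
    if "N \<subseteq> M" for N p q
    unfolding count_def using that by (intro steps.midpoint_count_eq_icoeff) (simp add: M_def)
  have dual: "schubert_dual u (product p q) = count M p q" for p q
    by (simp add: product_def schubert_dual_eq_midpoint_count[OF V u] steps.midpoint_count_def
        count_def M_def)
  have "M = ?at \<union> ?below" by blast
  then have "count M p q = count ?at p q + count ?below p q" for p q
    unfolding count_def of_nat_add[symmetric]
    by (subst card_Un_disjoint[symmetric])
       (auto simp: M_def steps.finite_midpoints intro!: arg_cong[of _ _ card])
  moreover have "(\<Sum>U\<in>hop_preds k u. schubert_dual U (product (p - 1) (q - 1)))
      = count ?below (p - 1) q"
    by (simp add: topmost_hop_preds_sum count_def M_def conj_assoc)
  ultimately have "schubert_dual u (cofactor p q) = count M p (q - 1) + count ?at (p - 1) q"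
    by (simp add: dual_cofactor[OF u] topmost_cover_preds dual del: o_apply)
  then show ?thesis
    using count[of M p "q - 1"] count[of ?at "p - 1" q]
    by (auto simp: icoeff_add icoeff_monom_mult M_def algebra_simps)
qed

lemma cofactor_drop_topmost:
  assumes "q \<le> p"
  shows "schubert_dual u (cofactor p q) - schubert_dual u (cofactor (p + 1) (q - 1)) \<in> {0..1}"
proof (cases "steps.midpoints u = {}")
  case True
  then show ?thesis by (simp add: dual_cofactor_topmost steps.hops_gf_def icoeff_def)
next
  case False
  then obtain Y where Y: "Y \<in> steps.midpoints u" by blast
  have sym: "schubert_dual u (cofactor p q) = schubert_dual u (cofactor q p)" for p q
    by (simp only: cofactor_commute)
  have "card ({1..<V k} - V ` {1..k}) \<le> 1"
    using V_le[of k] k by (intro card_missing_le) auto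
  then have "(\<Sum>a\<in>steps.leaders u - {k}. card (steps.landings u a) - 1) \<le> 1"
    using steps.sum_landings_topmost_le[OF Y top] by linarith
  moreover obtain U m where "steps.hops_gf (steps.midpoints u)
      + monom 1 1 * steps.hops_gf {Y \<in> steps.midpoints u. Y k = u k}
    = monom 1 U * ((\<Prod>a\<in>steps.leaders u - {k}. q_number (card (steps.landings u a))) *
      q_number (Suc m))"
    using steps.hops_gf_factorization(2)[OF False steps.topmost_leader(1)[OF Y top]] by blast
  ultimately have "schubert_dual u (cofactor p q) - schubert_dual u (cofactor (p + 1) (q - 1))
      \<in> {0..int (1 choose (1 div 2))}"
    using steps.card_landings_pos[OF False] steps.finite_leaders assms
    by (intro coefficient_drop_bounds[OF dual_cofactor_topmost sym]) auto
  then show ?thesis by simp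
qed

end

theorem cofactor_drop:
  assumes "u \<in> increasing_after k" and "q \<le> p"
  shows "schubert_dual u (cofactor p q) - schubert_dual u (cofactor (p + 1) (q - 1)) \<in> {0..2}"
  using cofactor_drop_topmost[OF assms(1) _ assms(2)]
    cofactor_drop_blocked[OF assms(1) _ _ assms(2)]
    cofactor_drop_unblocked[OF _ _ assms(2)]
  by (cases "steps.topmost u k"; cases "blocked u"; force)

end

section \<open>An ascent at the last position\<close>

lemma initial_segment_image:
  assumes k: "1 \<le> k" and v: "v \<in> increasing_after k" and asc: "v k < v (Suc k)"
  shows "v ` {e \<in> {1..k}. v e < v k} = {1..<v k}"
proof (intro equalityI subsetI)
  fix y assume "y \<in> v ` {e \<in> {1..k}. v e < v k}"
  then show "y \<in> {1..<v k}" using front_pos[OF increasing_after_front[OF v]] by force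
next
  fix y assume y: "y \<in> {1..<v k}"
  obtain e where e: "v e = y" using finitary_perms_surj[OF increasing_after_finitary[OF v]] by blast
  then have "0 < e" using y finitary_perms_pos[OF increasing_after_finitary[OF v], of e] by simp
  moreover have "v e < v (Suc k)" using e y asc by simp
  ultimately have "e \<in> {1..k}" by (rule increasing_after_least_tail[OF v])
  then show "y \<in> v ` {e \<in> {1..k}. v e < v k}" using e y by auto
qed

lemma initial_segment_image_below:
  assumes k: "1 \<le> k" and v: "v \<in> increasing_after k" and asc: "v k < v (Suc k)"
    and w: "w \<in> increasing_after k" and le: "\<And>e. e \<in> {1..k} \<Longrightarrow> w e \<le> s e"
    and s: "\<And>e. e \<in> {1..k} \<Longrightarrow> v e < v k \<Longrightarrow> s e = v e"
  shows "w ` {e \<in> {1..k}. v e < v k} = {1..<v k}"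
proof (rule card_subset_eq)
  let ?E = "{e \<in> {1..k}. v e < v k}"
  have "card (w ` ?E) = card ?E" "card (v ` ?E) = card ?E"
    by (intro card_image increasing_after_inj_on[OF w] increasing_after_inj_on[OF v])+
  then show "card (w ` ?E) = card {1..<v k}" using initial_segment_image[OF k v asc] by simp
  show "w ` ?E \<subseteq> {1..<v k}"
  proof (rule image_subsetI)
    fix e assume e: "e \<in> ?E"
    then have "w e \<le> v e" "v e < v k" using le[of e] s[of e] by auto
    then show "w e \<in> {1..<v k}" using front_pos[OF increasing_after_front[OF w], of e k] e by simp
  qed
qed simp

lemma initial_segment_next_value:
  assumes k: "1 \<le> k" and v: "v \<in> increasing_after k" and asc: "v k < v (Suc k)"
    and w: "w \<in> increasing_after k" and le: "\<And>e. e \<in> {1..k} \<Longrightarrow> w e \<le> s e"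
    and s: "\<And>e. e \<in> {1..k} \<Longrightarrow> v e < v k \<Longrightarrow> s e = v e"
    and a: "a \<in> {1..k}" "v k \<le> v a" "s a \<le> v k"
  shows "w a = v k"
proof -
  have "w a \<notin> w ` {e \<in> {1..k}. v e < v k}" using a(2) increasing_after_eq_iff[OF w] by auto
  then have "\<not> w a < v k"
    using initial_segment_image_below[OF k v asc w le s]
      front_pos[OF increasing_after_front[OF w] a(1)]
    by simp
  then show ?thesis using le[OF a(1)] a(3) by simp
qed

lemma hop_preds_ascent:
  assumes v: "v \<in> increasing_after k" and k: "1 \<le> k" and asc: "v k < v (Suc k)"
  shows "hop_preds k v = {}"
proof (rule equals0I)
  fix U assume U: "U \<in> hop_preds k v"
  note inc = hop_preds_increasing_after[OF U v k]
  have "U k \<in> {1..<v k}"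
    using hop_preds_less[OF U v k] front_pos[OF increasing_after_front[OF inc], of k k] k by simp
  then obtain e where e: "e \<in> {1..k}" "v e < v k" "U k = v e"
    unfolding initial_segment_image[OF k v asc, symmetric] by auto
  then have "e \<in> {1..<k}" by (auto simp: le_less)
  then show False
    using hop_preds_agree[OF U v k] e(3) increasing_after_eq_iff[OF inc, of k e] by auto
qed

context gapped_front
begin

lemma schubert_hsym_hsym_expansion:
  assumes "k = Suc l"
  shows "schubert V * hsym l p * hsym l q = product p q - X k * cofactor p q"
proof -
  have peel: "hsym l n = hsym k n - X k * hsym k (n - 1)" for n
    using hsym_Suc[of l n] assms by simp
  show ?thesis
    unfolding peel[of p] peel[of q] product_def cofactor_def by (simp add: algebra_simps)
qed

lemma schubert_jacobi_trudi2_span: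
  assumes "k = Suc l"
  shows "schubert V * jacobi_trudi2 l l p q \<in> schubert_span (increasing_after k)"
  unfolding schubert_mult_jacobi_trudi2 schubert_hsym_hsym_expansion[OF assms]
  by (intro schubert_span_diff schubert_span_X_last product_span cofactor_span k)

context
  fixes v
  assumes v: "v \<in> increasing_after k" and asc: "v k < v (Suc k)"
begin

lemma dual_product_ascent: "schubert_dual v (product p q) = 0"
proof (cases "\<exists>e\<in>{1..k}. v e < V e")
  case True
  then show ?thesis using product_not_above by blast
next
  case False
  then have le: "V e \<le> v e" if "e \<in> {1..k}" for e using that by (meson not_le)
  have "V k = v k"
    using k by (intro initial_segment_next_value[OF k v asc V le refl]) auto
  then have "j \<in> V ` {e \<in> {1..k}. v e < v k}"
    using initial_segment_image_below[OF k v asc V le refl] j by simp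
  then show ?thesis using image_V by blast
qed

lemma dual_product_swapped:
  assumes a: "a \<in> {1..<k}" "v k < v a" "V a \<noteq> v k"
    and s: "s a = v k" "\<And>e. e \<in> {1..k} \<Longrightarrow> v e < v k \<Longrightarrow> s e = v e"
  shows "schubert_dual s (product p q) = 0"
proof (cases "\<exists>e\<in>{1..k}. s e < V e")
  case True
  then show ?thesis using product_not_above by blast
next
  case False
  then have le: "V e \<le> s e" if "e \<in> {1..k}" for e using that by (meson not_le)
  have "V a = v k"
    using a s(1) by (intro initial_segment_next_value[OF k v asc V le s(2)]) auto
  then show ?thesis using a(3) by simp
qed

lemma dual_cofactor_swapped:
  assumes a: "a \<in> cover_preds k v" and neq: "V a \<noteq> v k"
  shows "schubert_dual (v \<circ> transpose a k) (cofactor p q) = 0"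
proof -
  note less = cover_preds_less[OF a]
  define u where "u = v \<circ> transpose a k"
  have u: "u \<in> increasing_after k"
    unfolding u_def using less k by (intro increasing_after_comp_transpose v) auto
  have u_a: "u a = v k" and u_k: "u k = v a" by (simp_all add: u_def)
  have small: "u e = v e \<and> e \<in> {1..<k} \<and> e \<noteq> a" if "e \<in> {1..k}" "v e < v k" for e
    using that less by (auto simp: u_def transpose_def le_less)
  note vanish = dual_product_swapped[OF less neq]
  have "schubert_dual u (product p q) = 0" for p q
    using small by (intro vanish u_a) simp
  moreover have "schubert_dual U (product p q) = 0" if U: "U \<in> hop_preds k u" for U p q
    using hop_preds_agree[OF U u k] small less(1) u_a by (intro vanish) simp_all
  moreover have "schubert_dual (u \<circ> transpose b k) (product p q) = 0"
    if b: "b \<in> cover_preds k u" for b p q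
  proof (rule vanish)
    note less_b = cover_preds_less[OF b]
    have "b \<noteq> a" using less_b(2) less(2) u_a u_k by auto
    then show "(u \<circ> transpose b k) a = v k" using less(1) u_a by simp
    fix e assume e: "e \<in> {1..k}" "v e < v k"
    have "b \<noteq> e" using less_b(2) small[OF e] e(2) u_k less(2) by auto
    then show "(u \<circ> transpose b k) e = v e" using small[OF e] by simp
  qed
  ultimately show ?thesis unfolding u_def[symmetric] dual_cofactor[OF u] by (simp del: o_apply)
qed

lemma dual_ascent:
  assumes "k = Suc l"
  shows "schubert_dual v (schubert V * hsym l p * hsym l q)
    = (\<Sum>a\<in>{a \<in> cover_preds k v. V a = v k}. schubert_dual (v \<circ> transpose a k) (cofactor p q))"
proof -
  have "schubert_dual v (schubert V * hsym l p * hsym l q)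
      = (\<Sum>a\<in>cover_preds k v. schubert_dual (v \<circ> transpose a k) (cofactor p q))"
    by (simp add: schubert_hsym_hsym_expansion[OF assms] schubert_dual.diff dual_product_ascent
        schubert_dual_X_last[OF cofactor_span v k] hop_preds_ascent[OF v k asc])
  also have "\<dots> = (\<Sum>a\<in>{a \<in> cover_preds k v. V a = v k}.
      schubert_dual (v \<circ> transpose a k) (cofactor p q))"
    using dual_cofactor_swapped
    by (intro sum.mono_neutral_right) (auto simp: finite_cover_preds simp del: o_apply)
  finally show ?thesis .
qed

lemma dual_ascent_bound:
  assumes "k = Suc l" and "q \<le> p"
  shows "schubert_dual v (schubert V * jacobi_trudi2 l l p q) \<in> {0..2}"
proof -
  let ?C = "{a \<in> cover_preds k v. V a = v k}"
  have dual: "schubert_dual v (schubert V * jacobi_trudi2 l l p q)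
      = (\<Sum>a\<in>?C. schubert_dual (v \<circ> transpose a k) (cofactor p q))
        - (\<Sum>a\<in>?C. schubert_dual (v \<circ> transpose a k) (cofactor (p + 1) (q - 1)))"
    by (simp add: schubert_mult_jacobi_trudi2 schubert_dual.diff dual_ascent[OF assms(1)]
        del: o_apply)
  have "a = b" if "V a = v k" "V b = v k" for a b
    using that increasing_after_eq_iff[OF V, of a b] by simp
  then have "?C = {} \<or> (\<exists>a. ?C = {a})" by blast
  then show ?thesis
  proof
    assume "?C = {}"
    then show ?thesis unfolding dual by (simp only: sum.empty) simp
  next
    assume "\<exists>a. ?C = {a}"
    then obtain a where a: "?C = {a}" by blast
    then have "a \<in> cover_preds k v" by blast
    then have "v \<circ> transpose a k \<in> increasing_after k"
      using cover_preds_less(1)[of a k v] k by (intro increasing_after_comp_transpose v) auto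
    then show ?thesis
      using cofactor_drop[OF _ assms(2)] unfolding dual a by simp
  qed
qed

end

end

section \<open>The coefficients\<close>

lemma schubert_dual_increasing_after:
  assumes w: "w permutes {1..n}" and inc: "\<And>i. k < i \<Longrightarrow> i < n \<Longrightarrow> w i < w (Suc i)"
    and k: "k \<le> n" "n \<le> k + r" and "q \<le> p"
  shows "schubert_dual v (schubert w * jacobi_trudi2 k k p q) \<in> {0..int (r choose (r div 2))}"
proof -
  have V: "w \<in> increasing_after k" by (rule permutes_increasing_after[OF w inc])
  have sub: "w ` {1..k} \<subseteq> {1..n}"
    using image_mono[of "{1..k}" "{1..n}" w] permutes_image[OF w] k(1) by simp
  then have "card ({1..n} - w ` {1..k}) = n - k"
    using card_Diff_subset[OF _ sub] card_image[OF increasing_after_inj_on[OF V, of "{1..k}"]]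
    by simp
  then show ?thesis
    using sub k(2) by (intro increasing_after_bound[OF V \<open>q \<le> p\<close>, of n]) auto
qed

lemma schubert_coeff_increasing_after:
  assumes w: "w permutes {1..n}" and inc: "\<And>i. k < i \<Longrightarrow> i < n \<Longrightarrow> w i < w (Suc i)"
    and "k \<le> n" "n \<le> k + r" "q \<le> p"
  shows "schubert_coeff (schubert w * jacobi_trudi2 k k p q) v \<in> {0..int (r choose (r div 2))}"
proof -
  have "schubert w * jacobi_trudi2 k k p q \<in> schubert_span finitary_perms"
    unfolding schubert_mult_jacobi_trudi2
    by (intro schubert_span_mono[OF _ increasing_after_subset[of k]] schubert_span_diff
        schubert_span_hsym_hsym permutes_increasing_after[OF w inc])
  then show ?thesis
    using schubert_dual_increasing_after[OF assms] by (simp add: schubert_coeff_eq_schubert_dual)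
qed

lemma gapped_front_permutes:
  assumes w: "w permutes {1..Suc k}" and "1 \<le> k" and desc: "w (Suc k) < w k"
  shows "gapped_front k (w (Suc k)) w"
proof
  show V: "w \<in> increasing_after k" by (rule permutes_increasing_after[OF w]) simp
  have "{1..k} = {1..Suc k} - {Suc k}" by auto
  then have "w ` {1..k} = w ` {1..Suc k} - w ` {Suc k}"
    using image_set_diff[OF permutes_inj[OF w]] by metis
  then show "w ` {1..k} = {1..Suc k} - {w (Suc k)}" using permutes_image[OF w] by simp
  show "1 \<le> w (Suc k)" using increasing_after_pos[OF V, of "Suc k"] by simp
qed (use assms in auto)

lemma schubert_dual_last_descent:
  assumes w: "w \<in> finitary_perms" "w (Suc i) < w i" and v: "v \<in> finitary_perms" "v (Suc i) < v i"
    and "k < i" and span: "schubert w * jacobi_trudi2 k k p q \<in> schubert_span finitary_perms"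
  shows "schubert_dual v (schubert w * jacobi_trudi2 k k p q)
    = schubert_dual (v \<circ> adj_transp i) (schubert (w \<circ> adj_transp i) * jacobi_trudi2 k k p q)"
proof -
  have i: "1 \<le> i" using \<open>k < i\<close> by simp
  have "divided_diff i (jacobi_trudi2 k k p q) = 0"
    using \<open>k < i\<close>
    by (simp add: jacobi_trudi2_def divided_diff_diff divided_diff_mult divided_diff_hsym_beyond)
  then have "divided_diff i (schubert w * jacobi_trudi2 k k p q)
      = schubert (w \<circ> adj_transp i) * jacobi_trudi2 k k p q"
    using divided_diff_schubert_descent[OF w(1) i w(2)] by (simp add: divided_diff_mult_symmetric)
  then show ?thesis by (simp only: schubert_dual_divided_diff[OF span v(1) i v(2)])
qed

lemma schubert_coeff_last_descent:
  assumes w: "w permutes {1..Suc (Suc k)}" and desc: "w (Suc (Suc k)) < w (Suc k)"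
    and "q \<le> p" and v: "v \<in> finitary_perms"
  shows "schubert_coeff (schubert w * jacobi_trudi2 k k p q) v \<in> {0..2}"
proof -
  let ?K = "Suc k" and ?f = "schubert w * jacobi_trudi2 k k p q"
  interpret gapped_front ?K "w (Suc ?K)" w
    by (rule gapped_front_permutes[OF w _ desc]) simp
  have span_front: "?f \<in> schubert_span (increasing_after ?K)"
    by (rule schubert_jacobi_trudi2_span[OF refl])
  then have span: "?f \<in> schubert_span finitary_perms"
    by (rule schubert_span_mono[OF _ increasing_after_subset])
  consider (outside) "v \<notin> increasing_after ?K" | (descent) "v (Suc ?K) < v ?K"
    | (ascent) "v \<in> increasing_after ?K" "v ?K < v (Suc ?K)"
    using inj_neq_Suc[OF finitary_perms_inj[OF v], of ?K] by linarith
  then have "schubert_dual v ?f \<in> {0..2}"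
  proof cases
    case outside
    then show ?thesis
      using schubert_dual_not_in_support[OF span_front increasing_after_subset] by simp
  next
    case descent
    let ?w = "w \<circ> adj_transp ?K"
    have "?w permutes {1..Suc ?K}" by (rule permutes_comp_adj_transp[OF w]) auto
    moreover have "?w i < ?w (Suc i)" if "k < i" "i < Suc ?K" for i
      using that desc by (auto simp: less_Suc_eq)
    ultimately have "schubert_dual (v \<circ> adj_transp ?K) (schubert ?w * jacobi_trudi2 k k p q)
        \<in> {0..int (2 choose (2 div 2))}"
      using \<open>q \<le> p\<close> by (intro schubert_dual_increasing_after) auto
    then show ?thesis
      using schubert_dual_last_descent[OF increasing_after_finitary[OF V] desc v descent _ span]
      by (simp add: choose_one del: o_apply)
  next
    case ascent
    then show ?thesis by (rule dual_ascent_bound[OF _ _ refl \<open>q \<le> p\<close>])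
  qed
  then show ?thesis by (simp add: schubert_coeff_eq_schubert_dual[OF span])
qed

lemma schubert_coeff_two_missing:
  assumes w: "w permutes {1..Suc (Suc k)}" and "q \<le> p" and v: "v \<in> finitary_perms"
  shows "schubert_coeff (schubert w * jacobi_trudi2 k k p q) v \<in> {0..2}"
proof (cases "w (Suc k) < w (Suc (Suc k))")
  case True
  then have "w i < w (Suc i)" if "k < i" "i < Suc (Suc k)" for i
    using that by (auto simp: less_Suc_eq)
  then show ?thesis
    using schubert_coeff_increasing_after[OF w, of k 2 q p v] \<open>q \<le> p\<close> by (simp add: choose_one)
next
  case False
  then have "w (Suc (Suc k)) < w (Suc k)"
    using inj_neq_Suc[OF permutes_inj[OF w], of "Suc k"] by simp
  then show ?thesis by (rule schubert_coeff_last_descent[OF w _ \<open>q \<le> p\<close> v])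
qed

theorem theorem1p1:
  fixes n1 n2 k :: nat and \<tau> w :: "nat \<Rightarrow> nat" and \<mu> :: "nat list"
  assumes "n1 \<ge> 1" and "n2 \<ge> 1"
    and "grassmannian k n1 \<tau>"
    and "\<mu> = grassmannian_shape k \<tau>"
    and "length \<mu> = 2"
    and "w permutes {1..n2}"
  shows "(k = n2 \<longrightarrow>
            (\<forall>v\<in>finitary_perms. schubert_coeff (schubert w * schur \<mu> k) v \<in> {0, 1})) \<and>
         (k + 1 = n2 \<longrightarrow>
            (\<forall>v\<in>finitary_perms. schubert_coeff (schubert w * schur \<mu> k) v \<in> {0, 1})) \<and>
         (k + 2 = n2 \<longrightarrow>
            (\<forall>v\<in>finitary_perms. schubert_coeff (schubert w * schur \<mu> k) v \<in> {0, 1, 2}))"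
proof -
  obtain p q where \<mu>: "\<mu> = [p, q]" and "q \<le> p"
    using grassmannian_shape_two_rows[OF assms(3)] assms(4,5) by metis
  then have schur: "schur \<mu> k = jacobi_trudi2 k k (int p) (int q)" and pq: "int q \<le> int p"
    by (simp_all add: schur_two_rows)
  have "schubert_coeff (schubert w * schur \<mu> k) v \<in> {0..1}" if "k = n2 \<or> k + 1 = n2" for v
    using schubert_coeff_increasing_after[OF assms(6) _ _ _ pq, of k 1 v] that
    by (auto simp: schur)
  moreover have "schubert_coeff (schubert w * schur \<mu> k) v \<in> {0..2}"
    if "k + 2 = n2" "v \<in> finitary_perms" for v
    using schubert_coeff_two_missing[OF _ pq that(2)] assms(6) that(1)
    by (auto simp: schur)
  moreover have "{0..1} = {0, 1 :: int}" "{0..2} = {0, 1, 2 :: int}" by auto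
  ultimately show ?thesis by auto
qed

end
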